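(* Let $\varepsilon=0$, $T>0$, $U_0>0$, $V_0>0$. The unique weak solution $w$ of the problem $$w_t=\mathcal{D}(w)_{xx}\ \text{ in }Q_T=\mathbb{R}\times(0,T),\qquad w(x,0)=w_0(x):=\begin{cases}U_0,& x<0,\\-V_0,& x>0,\end{cases}$$ has a self-similar form: there exist a function $f:\mathbb{R}\to\mathbb{R}$ and a constant $a>0$ such that $w(x,t)=f\left(\frac{x}{\sqrt t}\right)$ for (almost every) $(x,t)\in Q_T$, and the free boundary is $\beta(t)=a\sqrt t$, $t\in[0,T]$ (that is, $w(x,t)>0$ if $x<\beta(t)$ and $w(x,t)<0$ if $x>\beta(t)$). Writing $\eta=x/\sqrt t$, $f$ satisfies the system $$\begin{aligned} &-\tfrac12\eta f'(\eta)=[\phi'(f(\eta))f'(\eta)]' &&\text{if }\eta<a,\\ &f(\eta)=-V_0 &&\text{if }\eta>a,\\ &\lim_{\eta\to-\infty}f(\eta)=U_0,\qquad \lim_{\eta\nearrow a}f(\eta)=0,\\ &\lim_{\eta\nearrow a}\phi'(f(\eta))f'(\eta)=-\frac{aV_0}{2}, \end{aligned}$$ where a prime on $f$ or on a bracket denotes differentiation with respect to $\eta$.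
   Context: $\phi\in C^2(\mathbb{R})$ is such that $\phi$ and $\phi'$ are strictly increasing on $[0,\infty)$, $\phi(s)>0$ for $s>0$, $\phi(0)=\phi'(0)=0$, and $\int_0^1\frac{\phi'(s)}{s}\,ds<\infty$, $\int_1^\infty\frac{\phi'(s)}{s}\,ds=\infty$. Since $\varepsilon=0$, the function $\mathcal{D}$ is $\mathcal{D}(s)=\phi(s)$ for $s\ge0$ and $\mathcal{D}(s)=0$ for $s<0$. Weak solution: a function $w$ is a weak solution if (i) $w\in L^\infty(Q_T)$; (ii) $\mathcal{D}(w)\in\mathcal{D}(\hat w)+L^2(0,T;W^{1,2}(\mathbb{R}))$, where $\hat w\in C^\infty(\mathbb{R})$ is a fixed smooth function of $x$ with $\hat w(x)=U_0$ for $x<-1$ and $\hat w(x)=-V_0$ for $x>1$; (iii) $\int_{\mathbb{R}}w_0(x)\Psi(x,0)\,dx+\iint_{Q_T}w\,\Psi_t\,dx\,dt=\iint_{Q_T}\mathcal{D}(w)_x\,\Psi_x\,dx\,dt$ for all $\Psi\in C^1(\mathbb{R}\times[0,T])$ with $\Psi(\cdot,T)=0$ and $\operatorname{supp}\Psi\subset[-J,J]\times[0,T]$ for some $J>0$. Solutions $f$ of the system are understood classically: $f$ is positive and $C^2$ on $(-\infty,a)$; the value of $f$ at $\eta=a$ is immaterial. *)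

theory Defs
  imports "HOL-Analysis.Analysis"
begin

text \<open>Functions of class C^k on an open set of reals; the set has to be open because the
  derivatives are two-sided.\<close>

definition Ck_on :: "nat \<Rightarrow> (real \<Rightarrow> real) \<Rightarrow> real set \<Rightarrow> bool" where
  "Ck_on k f S \<longleftrightarrow>
     (\<forall>i<k. \<forall>x\<in>S. (deriv ^^ i) f field_differentiable at x) \<and>
     continuous_on S ((deriv ^^ k) f)"

definition smooth :: "(real \<Rightarrow> real) \<Rightarrow> bool" where
  "smooth f \<longleftrightarrow> (\<forall>k. Ck_on k f UNIV)"


definition locally_integrable :: "(real \<Rightarrow> real) \<Rightarrow> bool" where
  "locally_integrable g \<longleftrightarrow> (\<forall>J. set_integrable lebesgue {-J..J} g)"

definition weak_deriv :: "(real \<Rightarrow> real) \<Rightarrow> (real \<Rightarrow> real) \<Rightarrow> bool" where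
  "weak_deriv v g \<longleftrightarrow> locally_integrable v \<and> locally_integrable g \<and>
     (\<forall>\<psi>. smooth \<psi> \<and> (\<exists>J. \<forall>x. \<bar>x\<bar> > J \<longrightarrow> \<psi> x = 0) \<longrightarrow>
        (LINT x|lebesgue. v x * deriv \<psi> x) = - (LINT x|lebesgue. g x * \<psi> x))"

definition L2 :: "(real \<Rightarrow> real) \<Rightarrow> bool" where
  "L2 v \<longleftrightarrow> v \<in> borel_measurable lebesgue \<and> integrable lebesgue (\<lambda>x. (v x)\<^sup>2)"

text \<open>\<open>W12 v g\<close>: the function \<open>v\<close> belongs to the Sobolev space W^{1,2} of the real line, with
  weak derivative \<open>g\<close>.\<close>

definition W12 :: "(real \<Rightarrow> real) \<Rightarrow> (real \<Rightarrow> real) \<Rightarrow> bool" where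
  "W12 v g \<longleftrightarrow> L2 v \<and> L2 g \<and> weak_deriv v g"


text \<open>Points of the strip are pairs \<open>(x, t)\<close>.\<close>

definition QT :: "real \<Rightarrow> (real \<times> real) set" where
  "QT T = UNIV \<times> {0<..<T}"

definition Linfty :: "real \<Rightarrow> (real \<times> real \<Rightarrow> real) \<Rightarrow> bool" where
  "Linfty T w \<longleftrightarrow> w \<in> borel_measurable (lebesgue_on (QT T)) \<and>
     (\<exists>C. AE p in lebesgue_on (QT T). \<bar>w p\<bar> \<le> C)"

text \<open>The space L^2(0,T; W^{1,2}(R)). Its elements are written as functions of \<open>(x, t)\<close>
  (L^2(0,T; L^2(R)) being L^2 of the strip): \<open>v(\<cdot>, t)\<close> is in W^{1,2}
  for almost every \<open>t\<close>, and the square of its W^{1,2} norm is integrable in \<open>t\<close>. Strong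
  measurability into W^{1,2} is joint measurability of \<open>v\<close> and of its weak \<open>x\<close>-derivative.\<close>

definition L2_W12 :: "real \<Rightarrow> (real \<times> real \<Rightarrow> real) \<Rightarrow> bool" where
  "L2_W12 T v \<longleftrightarrow> (\<exists>g.
     v \<in> borel_measurable (lebesgue_on (QT T)) \<and>
     g \<in> borel_measurable (lebesgue_on (QT T)) \<and>
     (AE t in lebesgue_on {0<..<T}. W12 (\<lambda>x. v (x, t)) (\<lambda>x. g (x, t))) \<and>
     (\<integral>\<^sup>+ t. (\<integral>\<^sup>+ x. ennreal ((v (x, t))\<^sup>2 + (g (x, t))\<^sup>2) \<partial>lebesgue)
        \<partial>lebesgue_on {0<..<T}) < \<infinity>)"

definition weak_dx :: "real \<Rightarrow> (real \<times> real \<Rightarrow> real) \<Rightarrow> (real \<times> real \<Rightarrow> real) \<Rightarrow> bool" where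
  "weak_dx T v g \<longleftrightarrow>
     g \<in> borel_measurable (lebesgue_on (QT T)) \<and>
     (AE t in lebesgue_on {0<..<T}. weak_deriv (\<lambda>x. v (x, t)) (\<lambda>x. g (x, t)))"

text \<open>\<open>\<Psi>\<close> is C^1 on the closed strip, one-sided in \<open>t\<close> at \<open>t = 0\<close> and \<open>t = T\<close>, with partial
  derivatives \<open>\<Psi>x\<close> and \<open>\<Psi>t\<close>.\<close>

definition test_function ::
  "real \<Rightarrow> (real \<times> real \<Rightarrow> real) \<Rightarrow> (real \<times> real \<Rightarrow> real) \<Rightarrow> (real \<times> real \<Rightarrow> real) \<Rightarrow> bool" where
  "test_function T \<Psi> \<Psi>x \<Psi>t \<longleftrightarrow>
     (\<forall>p \<in> UNIV \<times> {0..T}.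
        (\<Psi> has_derivative (\<lambda>h. \<Psi>x p * fst h + \<Psi>t p * snd h)) (at p within UNIV \<times> {0..T})) \<and>
     continuous_on (UNIV \<times> {0..T}) \<Psi>x \<and>
     continuous_on (UNIV \<times> {0..T}) \<Psi>t \<and>
     (\<forall>x. \<Psi> (x, T) = 0) \<and>
     (\<exists>J>0. \<forall>x. \<forall>t\<in>{0..T}. \<bar>x\<bar> > J \<longrightarrow> \<Psi> (x, t) = 0)"


definition Dfun :: "(real \<Rightarrow> real) \<Rightarrow> real \<Rightarrow> real" where
  "Dfun \<phi> s = (if s \<ge> 0 then \<phi> s else 0)"

text \<open>The value at \<open>x = 0\<close> is irrelevant.\<close>

definition initial_datum :: "real \<Rightarrow> real \<Rightarrow> real \<Rightarrow> real" where
  "initial_datum U0 V0 x = (if x < 0 then U0 else - V0)"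

definition weak_solution ::
  "(real \<Rightarrow> real) \<Rightarrow> real \<Rightarrow> real \<Rightarrow> (real \<Rightarrow> real) \<Rightarrow> real \<Rightarrow> (real \<times> real \<Rightarrow> real) \<Rightarrow> bool" where
  "weak_solution \<phi> U0 V0 what T w \<longleftrightarrow>
     Linfty T w \<and>
     L2_W12 T (\<lambda>(x, t). Dfun \<phi> (w (x, t)) - Dfun \<phi> (what x)) \<and>
     (\<exists>g. weak_dx T (\<lambda>p. Dfun \<phi> (w p)) g \<and>
        (\<forall>\<Psi> \<Psi>x \<Psi>t. test_function T \<Psi> \<Psi>x \<Psi>t \<longrightarrow>
           (LINT x|lebesgue. initial_datum U0 V0 x * \<Psi> (x, 0))
             + (LINT p|lebesgue_on (QT T). w p * \<Psi>t p)
           = (LINT p|lebesgue_on (QT T). g p * \<Psi>x p)))"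

text \<open>The curve \<open>x = \<beta> t\<close> separates the regions where the solution is positive and negative.
  For \<open>t = 0\<close> the solution is given by the datum \<open>w0\<close>; for \<open>t > 0\<close> it is defined almost
  everywhere.\<close>

definition free_boundary ::
  "real \<Rightarrow> (real \<Rightarrow> real) \<Rightarrow> (real \<times> real \<Rightarrow> real) \<Rightarrow> (real \<Rightarrow> real) \<Rightarrow> bool" where
  "free_boundary T w0 w \<beta> \<longleftrightarrow>
     (\<forall>x. (x < \<beta> 0 \<longrightarrow> w0 x > 0) \<and> (x > \<beta> 0 \<longrightarrow> w0 x < 0)) \<and>
     (AE p in lebesgue_on (QT T).
        (fst p < \<beta> (snd p) \<longrightarrow> w p > 0) \<and> (fst p > \<beta> (snd p) \<longrightarrow> w p < 0))"

text \<open>Classical solutions of the free boundary problem for the profile \<open>f\<close>. The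
  differential equation is stated in the form that the flux \<open>\<phi>'(f) f'\<close> has derivative
  \<open>- \<eta> f'(\<eta>) / 2\<close>. No condition is put on \<open>f a\<close>.\<close>

definition profile :: "(real \<Rightarrow> real) \<Rightarrow> real \<Rightarrow> real \<Rightarrow> (real \<Rightarrow> real) \<Rightarrow> real \<Rightarrow> bool" where
  "profile \<phi> U0 V0 f a \<longleftrightarrow>
     (\<forall>\<eta><a. f \<eta> > 0) \<and> Ck_on 2 f {..<a} \<and>
     (\<forall>\<eta><a. ((\<lambda>y. deriv \<phi> (f y) * deriv f y) has_real_derivative
                - (1 / 2) * \<eta> * deriv f \<eta>) (at \<eta>)) \<and>
     (\<forall>\<eta>>a. f \<eta> = - V0) \<and>
     (f \<longlongrightarrow> U0) at_bot \<and>
     (f \<longlongrightarrow> 0) (at_left a) \<and>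
     ((\<lambda>\<eta>. deriv \<phi> (f \<eta>) * deriv f \<eta>) \<longlongrightarrow> - (a * V0 / 2)) (at_left a)"

end

theory Submission
  imports Defs
begin

text \<open>
  Existence is a hodograph argument. Taking \<open>s = f\<close> as independent variable and
  \<open>R\<close> proportional to the negative flux, the profile equation becomes
  \<open>R'' = - c \<phi>' / R\<close> with \<open>R 0 = V\<close>, \<open>R' 0 = 1\<close>, and the conditions at
  \<open>- \<infinity>\<close> reduce to \<open>R U = 0\<close>. For given \<open>c\<close> the integral equation
  is solved by monotone iteration, the endpoint value depends continuously on \<open>c\<close>, and the
  intermediate value theorem selects \<open>c = 2 / a\<^sup>2\<close>; then \<open>\<eta> = a R'\<close> is
  inverted. The field \<open>w\<close> and its flux have the common potential
  \<open>\<surd>t P (x / \<surd>t)\<close>, which gives the weak identity.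

  Uniqueness is Oleinik's argument: for the difference \<open>z\<close> of two solutions and the
  difference \<open>e\<close> of their images under \<open>Dfun \<phi>\<close>, the time primitive \<open>H\<close> of
  \<open>e\<^sub>x\<close> satisfies \<open>H\<^sub>x = z\<close>. Integrating \<open>z e\<close> by parts over
  \<open>[-R, R]\<close> yields \<open>\<integral>\<integral> z e + \<integral> H(T)\<^sup>2 / 2 = \<integral> [H e]\<close>, and
  since \<open>z e \<ge> 0\<close> while the boundary term is integrable in \<open>R\<close>, \<open>z e\<close> vanishes.
\<close>

section \<open>Primitives of locally integrable functions\<close>

text \<open>The obstacle in the existence part is the degeneracy at the interface:
  \<open>\<phi>'\<close> vanishes at 0 while the flux does not, so f' is unbounded near
  \<open>a\<close>. In the variable s = f this is harmless, because \<open>\<phi>'\<close> enters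
  only as a numerator; the singularity moves to s = U, where R vanishes. With q = - \<phi>'(f) f'
  one finds dq/ds = \<eta>/2, so q = (a/2) R gives R' = \<eta>/a and R'' = - (2/a^2) \<phi>'/R. This
  is the origin of c, of R' 0 = 1 at the interface and of R 0 = V from the flux condition.

  The obstacle in the uniqueness part is that Oleinik's test function, the integral of e from t to
  T, is not C^1. Only products of a spatial bump with a function of time are tested; the lemma of du
  Bois-Reymond turns the result into a statement on almost every time slice, where continuous
  representatives can be integrated by parts. Two further points need care: no decay of z is
  available, and z e = 0 says nothing about z where both solutions are nonpositive, so z = 0 has to
  be recovered from the potential.\<close>

lemma AE_zero_if_halfline_integrals_zero:
  fixes f :: "real \<Rightarrow> real"
  assumes f: "integrable lborel f"
    and zero: "\<And>b. (LINT x:{..b}|lborel. f x) = 0"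
  shows "AE x in lborel. f x = 0"
proof (rule sigma_finite_measure.density_zero[OF sigma_finite_lborel f])
  have int: "set_integrable lborel A f" if "A \<in> sets borel" for A
    using f that unfolding set_integrable_def by (intro integrable_mult_indicator) auto
  have "(\<lambda>n. LINT x:{..real n}|lborel. f x) \<longlonglongrightarrow> (LINT x|lborel. f x)"
    unfolding set_lebesgue_integral_def
  proof (rule integral_dominated_convergence[where w = "\<lambda>x. \<bar>f x\<bar>"])
    show "AE x in lborel. (\<lambda>n. indicat_real {..real n} x *\<^sub>R f x) \<longlonglongrightarrow> f x"
    proof (rule AE_I2)
      fix x :: real
      obtain N where "x \<le> real N" using real_arch_simple by blast
      then have "indicat_real {..real n} x *\<^sub>R f x = f x" if "n \<ge> N" for n
        using that by (auto simp: indicator_def)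
      then show "(\<lambda>n. indicat_real {..real n} x *\<^sub>R f x) \<longlonglongrightarrow> f x"
        by (intro tendsto_eventually) (auto simp: eventually_sequentially)
    qed
  qed (use f in \<open>auto simp: indicator_def\<close>)
  then have total: "(LINT x|lborel. f x) = 0"
    using zero by (simp add: LIMSEQ_const_iff)
  fix A assume "A \<in> sets (lborel :: real measure)"
  \<comment> \<open>Half-lines form an intersection-stable generator of the Borel sets, so vanishing
    passes from them to all Borel sets. The total integral, needed for complements, has just been
    obtained as a limit of half-lines.\<close>
  then have A: "A \<in> sigma_sets UNIV (range atMost)"
    by (simp add: borel_eq_atMost)
  have "Int_stable (range (atMost :: real \<Rightarrow> real set))"
    by (auto simp: Int_stable_def)
  moreover have "range atMost \<subseteq> Pow (UNIV :: real set)" by simp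
  ultimately show "(LINT x:A|lborel. f x) = 0"
    using A
  proof (induction rule: sigma_sets_induct_disjoint)
    case (basic B) then show ?case using zero by auto
  next
    case empty then show ?case by (simp add: set_lebesgue_integral_def)
  next
    case (compl B)
    then have B: "B \<in> sets borel" by (simp add: borel_eq_atMost)
    have "(LINT x:B \<union> (UNIV - B)|lborel. f x)
        = (LINT x:B|lborel. f x) + (LINT x:UNIV - B|lborel. f x)"
      by (intro set_integral_Un int) (use B in auto)
    moreover have "B \<union> (UNIV - B) = UNIV" by blast
    ultimately show ?case using compl.IH total by (simp add: set_lebesgue_integral_def)
  next
    case (union B)
    then have B: "B i \<in> sets lborel" for i by (auto simp: borel_eq_atMost)
    have "(LINT x:(\<Union>i. B i)|lborel. f x) = (\<Sum>i. LINT x:B i|lborel. f x)"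
    proof (rule lebesgue_integral_countable_add)
      have "(\<Union>i. B i) \<in> sets borel" using B by (intro sets.countable_UN) auto
      then show "set_integrable lborel (\<Union>i. B i) f" by (rule int)
    qed (use B union in \<open>auto simp: disjoint_family_on_def\<close>)
    then show ?case using union by simp
  qed
qed

text \<open>The Borel counterpart of \<open>locally_integrable\<close>: products, Fubini and
  sections are handled over \<open>lborel\<close>, and statements over \<open>lebesgue\<close> are
  translated at the outer ends of the argument.\<close>

definition locally_lborel_integrable :: "(real \<Rightarrow> real) \<Rightarrow> bool" where
  "locally_lborel_integrable g \<longleftrightarrow> (\<forall>a b. set_integrable lborel {a..b} g)"

text \<open>Local absolute continuity in integral form. It is recorded through increments only, so
  that no almost everywhere differentiation has to be carried along; the additive constant stays
  free.\<close>

definition primitive :: "(real \<Rightarrow> real) \<Rightarrow> (real \<Rightarrow> real) \<Rightarrow> bool" where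
  "primitive F g \<longleftrightarrow> (\<forall>a b. a \<le> b \<longrightarrow> F b - F a = (LINT x:{a..b}|lborel. g x))"

text \<open>Rational endpoints suffice because the integral over \<open>{..b}\<close> depends
  continuously on \<open>b\<close>. The restriction matters later: for a family of time slices only
  countably many tests can share one exceptional null set.\<close>

lemma AE_zero_if_interval_integrals_zero:
  fixes f :: "real \<Rightarrow> real"
  assumes f: "locally_lborel_integrable f"
    and zero: "\<And>a b. a \<in> \<rat> \<Longrightarrow> b \<in> \<rat> \<Longrightarrow> a \<le> b \<Longrightarrow> (LINT x:{a..b}|lborel. f x) = 0"
  shows "AE x in lborel. f x = 0"
proof -
  have "AE x in lborel. indicat_real {- real N..real N} x * f x = 0" for N
  proof (rule AE_zero_if_halfline_integrals_zero)
    let ?f = "\<lambda>x. indicat_real {- real N..real N} x * f x"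
    show int: "integrable lborel ?f"
      using f by (auto simp: locally_lborel_integrable_def set_integrable_def)
    have f_meas: "?f \<in> borel_measurable lborel" using int by auto
    fix b :: real
    define c where "c n = min (real N) (real_of_int \<lfloor>real (Suc n) * b\<rfloor> / real (Suc n))" for n
    \<comment> \<open>These quotients are rational and tend to \<open>b\<close>; cutting with
      \<open>{- real N..real N}\<close> keeps both endpoints of the resulting intervals
      rational.\<close>
    have floor_lim: "(\<lambda>n. real_of_int \<lfloor>real (Suc n) * b\<rfloor> / real (Suc n)) \<longlonglongrightarrow> b"
    proof (rule tendsto_sandwich[where f = "\<lambda>n. b - 1 / real (Suc n)" and h = "\<lambda>_. b"])
      show "\<forall>\<^sub>F n in sequentially. b - 1 / real (Suc n) \<le> real_of_int \<lfloor>real (Suc n) * b\<rfloor> / real (Suc n)"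
      proof (intro always_eventually allI)
        fix n
        have "real (Suc n) * b - 1 \<le> real_of_int \<lfloor>real (Suc n) * b\<rfloor>" by linarith
        then have "(real (Suc n) * b - 1) / real (Suc n) \<le> real_of_int \<lfloor>real (Suc n) * b\<rfloor> / real (Suc n)"
          by (intro divide_right_mono) auto
        then show "b - 1 / real (Suc n) \<le> real_of_int \<lfloor>real (Suc n) * b\<rfloor> / real (Suc n)"
          by (simp add: diff_divide_distrib del: of_nat_Suc)
      qed
      show "\<forall>\<^sub>F n in sequentially. real_of_int \<lfloor>real (Suc n) * b\<rfloor> / real (Suc n) \<le> b"
        by (intro always_eventually allI)
           (simp add: divide_le_eq mult.commute del: of_nat_Suc)
      have "(\<lambda>n. 1 / real (Suc n)) \<longlonglongrightarrow> 0" using LIMSEQ_inverse_real_of_nat by (simp add: inverse_eq_divide)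
      from tendsto_diff[OF tendsto_const[of b] this]
      show "(\<lambda>n. b - 1 / real (Suc n)) \<longlonglongrightarrow> b" by simp
    qed auto
    have "(\<lambda>n. LINT x:{..real_of_int \<lfloor>real (Suc n) * b\<rfloor> / real (Suc n)}|lborel. ?f x)
        \<longlonglongrightarrow> (LINT x:{..b}|lborel. ?f x)"
      unfolding set_lebesgue_integral_def
    proof (rule integral_dominated_convergence[where w = "\<lambda>x. \<bar>?f x\<bar>"])
      show "AE x in lborel. (\<lambda>n. indicat_real {..real_of_int \<lfloor>real (Suc n) * b\<rfloor> / real (Suc n)} x *\<^sub>R ?f x)
          \<longlonglongrightarrow> indicat_real {..b} x *\<^sub>R ?f x"
        using AE_lborel_singleton[of b]
      proof eventually_elim
        case (elim x)
        consider "x < b" | "b < x" using elim by linarith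
        then show ?case
        proof cases
          case 1
          from order_tendstoD(1)[OF floor_lim 1] show ?thesis
            by (intro tendsto_eventually, elim eventually_mono) (use 1 in \<open>simp add: indicator_def\<close>)
        next
          case 2
          from order_tendstoD(2)[OF floor_lim 2] show ?thesis
            by (intro tendsto_eventually, elim eventually_mono) (use 2 in \<open>simp add: indicator_def\<close>)
        qed
      qed
    qed (use int f_meas in \<open>auto simp: indicator_def intro!: borel_measurable_times\<close>)
    moreover have "(LINT x:{..q}|lborel. ?f x) = 0" if "q \<in> \<rat>" for q
    proof (cases "- real N \<le> min q (real N)")
      case True
      have "(LINT x:{..q}|lborel. ?f x) = (LINT x:{- real N..min q (real N)}|lborel. f x)"
        unfolding set_lebesgue_integral_def by (rule Bochner_Integration.integral_cong) (auto simp: indicator_def)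
      also have "\<dots> = 0" by (rule zero) (use True that in \<open>auto simp: min_def\<close>)
      finally show ?thesis .
    next
      case False
      then have "(LINT x:{..q}|lborel. ?f x) = (LINT x:{}|lborel. f x)"
        unfolding set_lebesgue_integral_def by (intro Bochner_Integration.integral_cong) (auto simp: indicator_def)
      then show ?thesis by (simp add: set_lebesgue_integral_def)
    qed
    ultimately show "(LINT x:{..b}|lborel. ?f x) = 0"
      by (simp add: LIMSEQ_const_iff del: of_nat_Suc)
  qed
  then have "AE x in lborel. \<forall>N. indicat_real {- real N..real N} x * f x = 0"
    by (subst AE_all_countable) blast
  then show ?thesis
  proof eventually_elim
    case (elim x)
    obtain N where "\<bar>x\<bar> \<le> real N" using real_arch_simple by blast
    then show ?case using elim[rule_format, of N] by (auto simp: indicator_def)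
  qed
qed

lemma set_integral_Icc_combine:
  fixes g :: "real \<Rightarrow> real"
  assumes "locally_lborel_integrable g" "a \<le> b" "b \<le> c"
  shows "(LINT x:{a..c}|lborel. g x) = (LINT x:{a..b}|lborel. g x) + (LINT x:{b..c}|lborel. g x)"
  using assms
  by (simp add: locally_lborel_integrable_def set_borel_integral_eq_integral Henstock_Kurzweil_Integration.integral_combine)

lemma primitive_exists:
  assumes g: "locally_lborel_integrable g"
  obtains F where "primitive F g"
proof
  let ?F = "\<lambda>x. if 0 \<le> x then (LINT y:{0..x}|lborel. g y) else - (LINT y:{x..0}|lborel. g y)"
  show "primitive ?F g"
    unfolding primitive_def
  proof (intro allI impI)
    fix a b :: real assume "a \<le> b"
    consider "0 \<le> a" | "a < 0" "0 \<le> b" | "b < 0" by linarith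
    then show "?F b - ?F a = (LINT x:{a..b}|lborel. g x)"
    proof cases
      case 1 then show ?thesis using set_integral_Icc_combine[OF g, of 0 a b] \<open>a \<le> b\<close> by auto
    next
      case 2 then show ?thesis using set_integral_Icc_combine[OF g, of a 0 b] by auto
    next
      case 3 then show ?thesis using set_integral_Icc_combine[OF g, of a b 0] \<open>a \<le> b\<close> by auto
    qed
  qed
qed

lemma primitive_continuous_on:
  assumes g: "locally_lborel_integrable g" and F: "primitive F g"
  shows "continuous_on S F"
proof -
  have "continuous_on {a..b} F" for a b
  proof (rule continuous_on_eq)
    have "g integrable_on {a..b}"
      using g set_borel_integral_eq_integral(1) by (auto simp: locally_lborel_integrable_def)
    then show "continuous_on {a..b} (\<lambda>x. F a + integral {a..x} g)"
      by (intro continuous_intros indefinite_integral_continuous_1)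
    show "F a + integral {a..x} g = F x" if "x \<in> {a..b}" for x
      using F g that set_borel_integral_eq_integral(2)[of "{a..x}" g]
      by (auto simp: locally_lborel_integrable_def primitive_def algebra_simps)
  qed
  then have "isCont F x" for x
    by (rule continuous_on_interior[of "{x - 1..x + 1}"]) simp
  then show ?thesis by (simp add: continuous_at_imp_continuous_on)
qed

lemma locally_lborel_integrable_continuous:
  "continuous_on UNIV g \<Longrightarrow> locally_lborel_integrable g"
  unfolding locally_lborel_integrable_def set_integrable_def
  by (intro allI borel_integrable_compact) (auto intro: continuous_on_subset)

lemma locally_lborel_integrable_mult_continuous:
  assumes g: "locally_lborel_integrable g" and F: "continuous_on UNIV F"
  shows "locally_lborel_integrable (\<lambda>x. g x * F x)"
  unfolding locally_lborel_integrable_def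
proof (intro allI)
  fix a b :: real
  have "compact (F ` {a..b})"
    by (intro compact_continuous_image continuous_on_subset[OF F]) auto
  then obtain B where B: "\<And>x. x \<in> {a..b} \<Longrightarrow> \<bar>F x\<bar> \<le> B"
    by (auto dest!: compact_imp_bounded simp: bounded_iff simp del: atLeastAtMost_iff, blast)
  have F_meas: "F \<in> borel_measurable borel" by (rule borel_measurable_continuous_onI[OF F])
  have g_int: "integrable lborel (\<lambda>x. indicat_real {a..b} x *\<^sub>R g x)"
    using g by (auto simp: locally_lborel_integrable_def set_integrable_def)
  show "set_integrable lborel {a..b} (\<lambda>x. g x * F x)"
    unfolding set_integrable_def
  proof (rule Bochner_Integration.integrable_bound)
    show "integrable lborel (\<lambda>x. B * (indicat_real {a..b} x *\<^sub>R g x))"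
      using g_int by auto
    have "(\<lambda>x. (indicat_real {a..b} x *\<^sub>R g x) * F x) \<in> borel_measurable lborel"
      using g_int F_meas by (intro borel_measurable_times) auto
    then show "(\<lambda>x. indicat_real {a..b} x *\<^sub>R (g x * F x)) \<in> borel_measurable lborel"
      by (simp add: mult.assoc)
    show "AE x in lborel. norm (indicat_real {a..b} x *\<^sub>R (g x * F x))
        \<le> norm (B * (indicat_real {a..b} x *\<^sub>R g x))"
    proof (rule AE_I2)
      fix x
      show "norm (indicat_real {a..b} x *\<^sub>R (g x * F x)) \<le> norm (B * (indicat_real {a..b} x *\<^sub>R g x))"
        using B[of x] by (auto simp: indicator_def abs_mult mult.commute[of "\<bar>g x\<bar>"] intro!: mult_right_mono)
    qed
  qed
qed

text \<open>Most dominating functions used with Fubini in the plane have this product form.\<close>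

lemma integrable_pair_product:
  fixes f g :: "real \<Rightarrow> real"
  assumes f: "integrable lborel f" and g: "integrable lborel g"
  shows "integrable (lborel \<Otimes>\<^sub>M lborel) (\<lambda>(x, y). f x * g y)"
proof (rule lborel_pair.Fubini_integrable)
  have [measurable]: "f \<in> borel_measurable borel" "g \<in> borel_measurable borel" using f g by auto
  show "(\<lambda>(x, y). f x * g y) \<in> borel_measurable (lborel \<Otimes>\<^sub>M lborel)" by measurable
  have "(\<lambda>x. LINT y|lborel. norm (case (x, y) of (x, y) \<Rightarrow> f x * g y))
      = (\<lambda>x. \<bar>f x\<bar> * (LINT y|lborel. \<bar>g y\<bar>))" by (simp add: abs_mult)
  then show "integrable lborel (\<lambda>x. LINT y|lborel. norm (case (x, y) of (x, y) \<Rightarrow> f x * g y))"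
    using f by simp
qed (use g in auto)

text \<open>No differentiability is involved. The product of the two increments is the integral of
  \<open>f' x * g' y\<close> over a square; splitting the square along its diagonal and integrating
  over each triangle by Fubini produces the two terms of the product rule.\<close>

lemma primitive_by_parts:
  assumes f': "locally_lborel_integrable f'" and f: "primitive f f'"
    and g': "locally_lborel_integrable g'" and g: "primitive g g'" and ab: "a \<le> b"
  shows "(LINT x:{a..b}|lborel. f' x * g x + f x * g' x) = f b * g b - f a * g a"
proof -
  define u v where "u x = indicat_real {a..b} x * f' x" and "v x = indicat_real {a..b} x * g' x" for x
  have u: "integrable lborel u" and v: "integrable lborel v"
    using f' g' by (auto simp: locally_lborel_integrable_def set_integrable_def u_def[abs_def] v_def[abs_def])
  have [measurable]: "u \<in> borel_measurable borel" "v \<in> borel_measurable borel" using u v by auto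
  have U: "(LINT y|lborel. u y * indicat_real {..x} y) = f x - f a" if "x \<in> {a..b}" for x
  proof -
    have "(LINT y|lborel. u y * indicat_real {..x} y) = (LINT y:{a..x}|lborel. f' y)"
      unfolding set_lebesgue_integral_def u_def
      by (rule Bochner_Integration.integral_cong) (use that in \<open>auto simp: indicator_def\<close>)
    then show ?thesis using f that by (auto simp: primitive_def)
  qed
  have V: "(LINT y|lborel. v y * indicat_real {..x} y) = g x - g a" if "x \<in> {a..b}" for x
  proof -
    have "(LINT y|lborel. v y * indicat_real {..x} y) = (LINT y:{a..x}|lborel. g' y)"
      unfolding set_lebesgue_integral_def v_def
      by (rule Bochner_Integration.integral_cong) (use that in \<open>auto simp: indicator_def\<close>)
    then show ?thesis using g that by (auto simp: primitive_def)
  qed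
  have totu: "(LINT y|lborel. u y) = f b - f a" and totv: "(LINT y|lborel. v y) = g b - g a"
    using f g ab unfolding primitive_def u_def v_def set_lebesgue_integral_def by auto
  have int: "integrable (lborel \<Otimes>\<^sub>M lborel) (\<lambda>(x, y). u x * v y)"
    by (rule integrable_pair_product[OF u v])
  have int1: "integrable (lborel \<Otimes>\<^sub>M lborel) (\<lambda>(x, y). u x * v y * indicat_real {..x} y)"
    by (rule Bochner_Integration.integrable_bound[OF int]) (auto simp: indicator_def)
  have int2: "integrable (lborel \<Otimes>\<^sub>M lborel) (\<lambda>(x, y). u x * v y * indicat_real {..y} x)"
    by (rule Bochner_Integration.integrable_bound[OF int]) (auto simp: indicator_def)
  have I1: "(LINT x|lborel. LINT y|lborel. u x * v y * indicat_real {..x} y)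
      = (LINT x|lborel. u x * (g x - g a))"
  proof (rule Bochner_Integration.integral_cong)
    fix x
    show "(LINT y|lborel. u x * v y * indicat_real {..x} y) = u x * (g x - g a)"
      using V[of x] by (cases "x \<in> {a..b}") (auto simp: mult.assoc, auto simp: u_def)
  qed simp
  have I2: "(LINT y|lborel. LINT x|lborel. u x * v y * indicat_real {..y} x)
      = (LINT y|lborel. v y * (f y - f a))"
  proof (rule Bochner_Integration.integral_cong)
    fix y
    have "(LINT x|lborel. u x * v y * indicat_real {..y} x)
        = v y * (LINT x|lborel. u x * indicat_real {..y} x)"
      by (subst integral_mult_right_zero[symmetric]) (simp add: mult_ac)
    then show "(LINT x|lborel. u x * v y * indicat_real {..y} x) = v y * (f y - f a)"
      using U[of y] by (cases "y \<in> {a..b}") (auto, auto simp: v_def)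
  qed simp
  have "(f b - f a) * (g b - g a) = (LINT x|lborel. LINT y|lborel. u x * v y)"
    by (simp add: totu totv)
  also have "\<dots> = (LINT p|(lborel \<Otimes>\<^sub>M lborel). (\<lambda>(x, y). u x * v y) p)"
    using lborel_pair.integral_fst'[OF int] by simp
  \<comment> \<open>The two closed triangles overlap in the diagonal, a null set, so the integrands
    agree only almost everywhere.\<close>
  also have "\<dots> = (LINT p|(lborel \<Otimes>\<^sub>M lborel). (\<lambda>(x, y). u x * v y * indicat_real {..x} y) p
      + (\<lambda>(x, y). u x * v y * indicat_real {..y} x) p)"
  proof (rule integral_cong_AE)
    have "AE p in lborel \<Otimes>\<^sub>M lborel. fst p \<noteq> (snd p :: real)"
    proof (rule lborel_pair.AE_pair_measure)
      show "AE x in lborel. AE y in lborel. fst (x, y) \<noteq> (snd (x, y) :: real)"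
        using AE_lborel_singleton by (auto simp: eq_commute)
    qed measurable
    then show "AE p in lborel \<Otimes>\<^sub>M lborel. (\<lambda>(x, y). u x * v y) p
        = (\<lambda>(x, y). u x * v y * indicat_real {..x} y) p + (\<lambda>(x, y). u x * v y * indicat_real {..y} x) p"
      by eventually_elim (auto simp: indicator_def)
  qed (unfold indicator_def atMost_iff, measurable)
  also have "\<dots> = (LINT p|(lborel \<Otimes>\<^sub>M lborel). (\<lambda>(x, y). u x * v y * indicat_real {..x} y) p)
      + (LINT p|(lborel \<Otimes>\<^sub>M lborel). (\<lambda>(x, y). u x * v y * indicat_real {..y} x) p)"
    by (rule Bochner_Integration.integral_add[OF int1 int2])
  also have "(LINT p|(lborel \<Otimes>\<^sub>M lborel). (\<lambda>(x, y). u x * v y * indicat_real {..x} y) p)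
      = (LINT x|lborel. u x * (g x - g a))"
    using lborel_pair.integral_fst'[OF int1] I1 by simp
  also have "(LINT p|(lborel \<Otimes>\<^sub>M lborel). (\<lambda>(x, y). u x * v y * indicat_real {..y} x) p)
      = (LINT y|lborel. v y * (f y - f a))"
    using lborel_pair.integral_snd[OF int2] I2 by simp
  finally have main: "(f b - f a) * (g b - g a)
      = (LINT x|lborel. u x * (g x - g a)) + (LINT y|lborel. v y * (f y - f a))" .
  have cont: "continuous_on UNIV f" "continuous_on UNIV g"
    using primitive_continuous_on f f' g g' by auto
  have ug: "integrable lborel (\<lambda>x. u x * g x)" and vf: "integrable lborel (\<lambda>x. v x * f x)"
    using locally_lborel_integrable_mult_continuous[OF f' cont(2)]
      locally_lborel_integrable_mult_continuous[OF g' cont(1)]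
    by (auto simp: locally_lborel_integrable_def set_integrable_def u_def v_def mult.assoc)
  have "(LINT x|lborel. u x * (g x - g a)) = (LINT x|lborel. u x * g x) - (f b - f a) * g a"
    using ug u by (simp add: right_diff_distrib totu)
  moreover have "(LINT x|lborel. v x * (f x - f a)) = (LINT x|lborel. v x * f x) - (g b - g a) * f a"
    using vf v by (simp add: right_diff_distrib totv)
  moreover have "(LINT x:{a..b}|lborel. f' x * g x + f x * g' x)
      = (LINT x|lborel. u x * g x) + (LINT x|lborel. v x * f x)"
    by (subst Bochner_Integration.integral_add[OF ug vf, symmetric])
       (auto simp: set_lebesgue_integral_def u_def v_def algebra_simps intro!: Bochner_Integration.integral_cong)
  ultimately show ?thesis using main by (simp add: algebra_simps)
qed

section \<open>The lemma of du Bois-Reymond\<close>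

text \<open>A witness sequence of derivatives replaces the iterates of \<open>deriv\<close>: sums,
  multiples and affine substitutions act on it term by term, and an antiderivative shifts it by one
  place.\<close>

lemma smooth_iff:
  "smooth f \<longleftrightarrow> (\<exists>D. D 0 = f \<and> (\<forall>i x. (D i has_real_derivative D (Suc i) x) (at x)))"
proof
  assume "smooth f"
  then have "(deriv ^^ i) f field_differentiable at x" for i x
    unfolding smooth_def Ck_on_def by (metis UNIV_I lessI)
  then have "((deriv ^^ i) f has_real_derivative (deriv ^^ Suc i) f x) (at x)" for i x
    by (simp add: DERIV_deriv_iff_field_differentiable)
  then show "\<exists>D. D 0 = f \<and> (\<forall>i x. (D i has_real_derivative D (Suc i) x) (at x))"
    by (intro exI[of _ "\<lambda>i. (deriv ^^ i) f"]) auto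
next
  assume "\<exists>D. D 0 = f \<and> (\<forall>i x. (D i has_real_derivative D (Suc i) x) (at x))"
  then obtain D where D: "D 0 = f" "\<And>i x. (D i has_real_derivative D (Suc i) x) (at x)" by blast
  have eq: "(deriv ^^ i) f = D i" for i
  proof (induction i)
    case (Suc i) then show ?case using D(2) by (auto intro!: DERIV_imp_deriv)
  qed (simp add: D)
  show "smooth f"
    unfolding smooth_def Ck_on_def eq
    using D(2) by (auto simp: field_differentiable_def intro!: continuous_at_imp_continuous_on DERIV_isCont)
qed

lemma smooth_deriv: "smooth f \<Longrightarrow> (f has_real_derivative deriv f x) (at x)"
  unfolding smooth_iff by (metis DERIV_imp_deriv)

lemma smooth_continuous_deriv: "smooth f \<Longrightarrow> continuous_on UNIV (deriv f)"
  by (auto simp: smooth_def Ck_on_def dest!: spec[of _ 1])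

lemma smooth_const: "smooth (\<lambda>x. c)"
  unfolding smooth_iff
  by (rule exI[of _ "\<lambda>i x. if i = 0 then c else 0"]) (auto intro: derivative_eq_intros)

lemma smooth_add: "smooth f \<Longrightarrow> smooth g \<Longrightarrow> smooth (\<lambda>x. f x + g x)"
  unfolding smooth_iff
proof (elim exE conjE)
  fix D E
  assume "D 0 = f" "\<forall>i x. (D i has_real_derivative D (Suc i) x) (at x)"
    "E 0 = g" "\<forall>i x. (E i has_real_derivative E (Suc i) x) (at x)"
  then show "\<exists>D. D 0 = (\<lambda>x. f x + g x) \<and> (\<forall>i x. (D i has_real_derivative D (Suc i) x) (at x))"
    by (intro exI[of _ "\<lambda>i x. D i x + E i x"]) (auto intro: DERIV_add)
qed

lemma smooth_cmult: "smooth f \<Longrightarrow> smooth (\<lambda>x. c * f x)"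
  unfolding smooth_iff
proof (elim exE conjE)
  fix D
  assume "D 0 = f" "\<forall>i x. (D i has_real_derivative D (Suc i) x) (at x)"
  then show "\<exists>D. D 0 = (\<lambda>x. c * f x) \<and> (\<forall>i x. (D i has_real_derivative D (Suc i) x) (at x))"
    by (intro exI[of _ "\<lambda>i x. c * D i x"]) (auto intro: DERIV_cmult)
qed

lemma smooth_diff: "smooth f \<Longrightarrow> smooth g \<Longrightarrow> smooth (\<lambda>x. f x - g x)"
  using smooth_add[of f "\<lambda>x. - 1 * g x"] smooth_cmult[of g "- 1"] by simp

lemma smooth_affine: "smooth f \<Longrightarrow> smooth (\<lambda>x. f (c * x + d))"
  unfolding smooth_iff
proof (elim exE conjE)
  fix D
  assume D: "D 0 = f" "\<forall>i x. (D i has_real_derivative D (Suc i) x) (at x)"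
  show "\<exists>D. D 0 = (\<lambda>x. f (c * x + d)) \<and> (\<forall>i x. (D i has_real_derivative D (Suc i) x) (at x))"
  proof (intro exI[of _ "\<lambda>i x. c ^ i * D i (c * x + d)"] conjI allI)
    fix i x
    have "((\<lambda>x. D i (c * x + d)) has_real_derivative D (Suc i) (c * x + d) * c) (at x)"
      by (rule DERIV_chain2[where f = "D i"]) (use D in \<open>auto intro!: derivative_eq_intros\<close>)
    from DERIV_cmult[OF this, of "c ^ i"]
    show "((\<lambda>x. c ^ i * D i (c * x + d)) has_real_derivative c ^ Suc i * D (Suc i) (c * x + d)) (at x)"
      by (simp add: mult_ac)
  qed (use D in auto)
qed

lemma smooth_antiderivative:
  assumes "smooth f" "\<And>x. (F has_real_derivative f x) (at x)"
  shows "smooth F"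
proof -
  obtain D where "D 0 = f" "\<forall>i x. (D i has_real_derivative D (Suc i) x) (at x)"
    using assms(1) by (auto simp: smooth_iff)
  then show ?thesis
    unfolding smooth_iff using assms(2)
    by (intro exI[of _ "\<lambda>i. case i of 0 \<Rightarrow> F | Suc j \<Rightarrow> D j"]) (auto split: nat.split)
qed

lemma primitive_if_DERIV:
  assumes "\<And>x. (F has_real_derivative f x) (at x)" "continuous_on UNIV f"
  shows "primitive F f"
  unfolding primitive_def set_lebesgue_integral_def
proof (intro allI impI)
  fix a b :: real assume "a \<le> b"
  then show "F b - F a = (LINT x|lborel. indicat_real {a..b} x *\<^sub>R f x)"
    by (intro integral_FTC_Icc[symmetric])
       (use assms in \<open>auto simp: has_real_derivative_iff_has_vector_derivative
         intro: has_vector_derivative_at_within continuous_on_subset\<close>)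
qed

text \<open>\<open>S\<close> is a smooth transition from 0 to 1 and \<open>A\<close> its
  antiderivative, which is affine with slope one beyond 1. Inside [-1, 1] the step may oscillate,
  since it will be obtained from an arbitrary reference function; hence its bound is some
  \<open>B\<close> and not 1.\<close>

locale smooth_step =
  fixes S A :: "real \<Rightarrow> real"
  assumes smooth_S: "smooth S"
    and S_left: "\<And>y. y < -1 \<Longrightarrow> S y = 0" and S_right: "\<And>y. y > 1 \<Longrightarrow> S y = 1"
    and A_DERIV: "\<And>y. (A has_real_derivative S y) (at y)"
    and A_left: "\<And>y. y < -1 \<Longrightarrow> A y = 0"
begin

lemma continuous_S: "continuous_on X S"
  using smooth_deriv[OF smooth_S] by (meson DERIV_isCont continuous_at_imp_continuous_on)

lemma borel_S [measurable]: "S \<in> borel_measurable borel"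
  by (intro borel_measurable_continuous_onI continuous_S)

lemma S_bounded: obtains B where "B \<ge> 0" "\<And>y. \<bar>S y\<bar> \<le> B"
proof -
  have "compact (S ` {-1..1})" by (intro compact_continuous_image continuous_S) auto
  then obtain B where B: "\<forall>y\<in>{-1..1}. \<bar>S y\<bar> \<le> B"
    by (auto dest!: compact_imp_bounded simp: bounded_iff simp del: atLeastAtMost_iff)
  have "\<bar>S y\<bar> \<le> max B 1" for y
    using S_left[of y] S_right[of y] B by (cases "y < -1"; cases "y > 1") (auto simp: le_max_iff_disj)
  then show ?thesis by (intro that[of "max B 1"]) auto
qed

lemma A_right: obtains \<kappa> where "\<And>y. y > 1 \<Longrightarrow> A y = y + \<kappa>"
proof -
  have "\<exists>c. \<forall>x\<in>{1<..}. A x - x = c"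
  proof (rule has_field_derivative_zero_constant)
    fix x :: real assume "x \<in> {1<..}"
    then have "S x = 1" using S_right by simp
    then show "((\<lambda>x. A x - x) has_real_derivative 0) (at x within {1<..})"
      using DERIV_diff[OF A_DERIV[of x] DERIV_ident] by (simp add: has_field_derivative_at_within)
  qed simp
  then obtain c where c: "\<And>x. x \<in> {1<..} \<Longrightarrow> A x - x = c" by blast
  show ?thesis
  proof (rule that[of c])
    fix y :: real assume "y > 1"
    then show "A y = y + c" using c[of y] by simp
  qed
qed

lemma S_scaled_lim:
  assumes "x \<noteq> b"
  shows "(\<lambda>n. S (real (Suc n) * (x - b))) \<longlonglongrightarrow> (if b < x then 1 else 0)"
proof (rule tendsto_eventually)
  obtain N where "1 / \<bar>x - b\<bar> < real N" using reals_Archimedean2 by blast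
  then have N: "1 < real N * \<bar>x - b\<bar>" using assms by (simp add: field_simps)
  show "\<forall>\<^sub>F n in sequentially. S (real (Suc n) * (x - b)) = (if b < x then 1 else 0)"
    unfolding eventually_sequentially
  proof (intro exI[of _ N] allI impI)
    fix n assume "N \<le> n"
    then have "real N * \<bar>x - b\<bar> \<le> real (Suc n) * \<bar>x - b\<bar>" by (intro mult_right_mono) auto
    with N have "1 < real (Suc n) * \<bar>x - b\<bar>" by linarith
    then show "S (real (Suc n) * (x - b)) = (if b < x then 1 else 0)"
      using assms by (cases "b < x") (auto simp: abs_if algebra_simps intro!: S_left S_right)
  qed
qed

text \<open>Differences of steepened steps are continuous, uniformly bounded and tend to indicators
  of intervals, so continuous tests recover all interval integrals of \<open>Y\<close>.\<close>

lemma AE_zero_if_continuous_tests_zero: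
  fixes Y :: "real \<Rightarrow> real"
  assumes Y: "integrable lborel Y"
    and zero: "\<And>\<alpha>. continuous_on UNIV \<alpha> \<Longrightarrow> (LINT t|lborel. \<alpha> t * Y t) = 0"
  shows "AE t in lborel. Y t = 0"
proof (rule AE_zero_if_interval_integrals_zero)
  show "locally_lborel_integrable Y"
    using Y unfolding locally_lborel_integrable_def set_integrable_def
    by (intro allI integrable_mult_indicator) auto
  fix b c :: real assume "b \<le> c"
  have [measurable]: "Y \<in> borel_measurable borel" using Y by auto
  obtain B where B: "B \<ge> 0" "\<And>y. \<bar>S y\<bar> \<le> B" using S_bounded by blast
  define \<alpha> where "\<alpha> n t = S (real (Suc n) * (t - b)) - S (real (Suc n) * (t - c))" for n t
  have "(\<lambda>n. LINT t|lborel. \<alpha> n t * Y t) \<longlonglongrightarrow> (LINT t|lborel. indicat_real {b..c} t *\<^sub>R Y t)"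
  proof (rule integral_dominated_convergence[where w = "\<lambda>t. 2 * B * \<bar>Y t\<bar>"])
    show "AE t in lborel. (\<lambda>n. \<alpha> n t * Y t) \<longlonglongrightarrow> indicat_real {b..c} t *\<^sub>R Y t"
      using AE_lborel_singleton[of b] AE_lborel_singleton[of c]
    proof eventually_elim
      case (elim t)
      have "(\<lambda>n. \<alpha> n t * Y t) \<longlonglongrightarrow> ((if b < t then 1 else 0) - (if c < t then 1 else 0)) * Y t"
        unfolding \<alpha>_def by (intro tendsto_intros S_scaled_lim) (use elim in auto)
      then show ?case using elim \<open>b \<le> c\<close> by (auto simp: indicator_def split: if_splits)
    qed
    show "AE t in lborel. norm (\<alpha> n t * Y t) \<le> 2 * B * \<bar>Y t\<bar>" for n
    proof (rule AE_I2)
      fix t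
      have "\<bar>\<alpha> n t\<bar> \<le> 2 * B"
        unfolding \<alpha>_def using B(2)[of "real (Suc n) * (t - b)"] B(2)[of "real (Suc n) * (t - c)"] by linarith
      then show "norm (\<alpha> n t * Y t) \<le> 2 * B * \<bar>Y t\<bar>" by (simp add: abs_mult mult_right_mono)
    qed
  qed (use Y in \<open>auto simp: \<alpha>_def\<close>)
  moreover have "continuous_on UNIV (\<alpha> n)" for n
    unfolding \<alpha>_def
    by (intro continuous_intros continuous_on_compose2[OF continuous_S[of UNIV]]) auto
  ultimately show "(LINT t:{b..c}|lborel. Y t) = 0"
    using zero by (simp add: set_lebesgue_integral_def LIMSEQ_const_iff)
qed

text \<open>\<open>comb S n b c\<close> tends to the indicator of \<open>[b, c]\<close> minus \<open>c - b\<close> times the indicator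
  of \<open>[0, 1]\<close>; its mean is zero, so that its antiderivative \<open>bump n b c\<close> has compact support.\<close>

definition comb :: "(real \<Rightarrow> real) \<Rightarrow> nat \<Rightarrow> real \<Rightarrow> real \<Rightarrow> real \<Rightarrow> real" where
  "comb h n b c x = h (real (Suc n) * (x - b)) - h (real (Suc n) * (x - c))
     - (c - b) * (h (real (Suc n) * x) - h (real (Suc n) * (x - 1)))"

definition bump :: "nat \<Rightarrow> real \<Rightarrow> real \<Rightarrow> real \<Rightarrow> real" where
  "bump n b c x = comb A n b c x / real (Suc n)"

lemma bump_DERIV: "(bump n b c has_real_derivative comb S n b c x) (at x)"
proof -
  have "((\<lambda>x. A (real (Suc n) * (x - d))) has_real_derivative S (real (Suc n) * (x - d)) * real (Suc n)) (at x)" for d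
    by (rule DERIV_chain2[where f = A, OF A_DERIV]) (auto intro!: derivative_eq_intros)
  note * = this
  have "((\<lambda>x. comb A n b c x / real (Suc n)) has_real_derivative
      (S (real (Suc n) * (x - b)) * real (Suc n) - S (real (Suc n) * (x - c)) * real (Suc n)
       - (c - b) * (S (real (Suc n) * x) * real (Suc n) - S (real (Suc n) * (x - 1)) * real (Suc n)))
      / real (Suc n)) (at x)"
    unfolding comb_def using *[of 0] by (intro DERIV_cdivide DERIV_diff DERIV_cmult *) simp
  also have "(S (real (Suc n) * (x - b)) * real (Suc n) - S (real (Suc n) * (x - c)) * real (Suc n)
       - (c - b) * (S (real (Suc n) * x) * real (Suc n) - S (real (Suc n) * (x - 1)) * real (Suc n)))
      / real (Suc n) = comb S n b c x"
    by (simp add: comb_def field_simps del: of_nat_Suc)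
  finally show ?thesis by (simp add: bump_def[abs_def])
qed

lemma deriv_bump: "deriv (bump n b c) = comb S n b c"
  using bump_DERIV by (auto intro!: DERIV_imp_deriv)

lemma continuous_comb_S: "continuous_on X (comb S n b c)"
  unfolding comb_def
  by (intro continuous_intros continuous_on_compose2[OF continuous_S[of UNIV]]) auto

lemma smooth_comb_S: "smooth (comb S n b c)"
proof -
  have *: "smooth (\<lambda>x. S (real (Suc n) * (x - d)))" for d
    using smooth_affine[OF smooth_S, of "real (Suc n)" "- real (Suc n) * d"]
    by (simp add: right_diff_distrib del: of_nat_Suc)
  show ?thesis
    unfolding comb_def[abs_def] using *[of 0] by (intro smooth_diff smooth_cmult *) simp
qed

lemma smooth_bump: "smooth (bump n b c)"
  by (rule smooth_antiderivative[OF smooth_comb_S bump_DERIV])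

lemma scaled_large:
  assumes "\<bar>x\<bar> > 2 + \<bar>b\<bar> + \<bar>c\<bar>" "\<bar>d\<bar> \<le> 1 + \<bar>b\<bar> + \<bar>c\<bar>"
  shows "x > 0 \<Longrightarrow> real (Suc n) * (x - d) > 1" "x < 0 \<Longrightarrow> real (Suc n) * (x - d) < - 1"
proof -
  assume "x > 0"
  then have "x - d > 1" using assms by linarith
  then have "1 * 1 < real (Suc n) * (x - d)" by (intro mult_le_less_imp_less) auto
  then show "real (Suc n) * (x - d) > 1" by simp
next
  assume "x < 0"
  then have "d - x > 1" using assms by linarith
  then have "1 * 1 < real (Suc n) * (d - x)" by (intro mult_le_less_imp_less) auto
  then show "real (Suc n) * (x - d) < - 1" by (simp add: algebra_simps)
qed

text \<open>To the right of all transitions each \<open>A\<close> is its argument plus the same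
  \<kappa>, and the linear terms cancel because the reference interval [0, 1] has length one and
  carries the weight \<open>c - b\<close>. Without the reference part the antiderivative would end
  at c - b instead of 0.\<close>

lemma comb_support:
  assumes "\<bar>x\<bar> > 2 + \<bar>b\<bar> + \<bar>c\<bar>"
  shows "comb S n b c x = 0" "bump n b c x = 0"
proof -
  note L = scaled_large[OF assms, of _ n]
  have L0: "x > 0 \<Longrightarrow> real (Suc n) * x > 1" "x < 0 \<Longrightarrow> real (Suc n) * x < - 1"
    using L[of 0] by auto
  have L1: "x > 0 \<Longrightarrow> real (Suc n) * (x - d) > 1" "x < 0 \<Longrightarrow> real (Suc n) * (x - d) < - 1"
    if "d \<in> {b, c, 1}" for d
    using that L[of d] by auto
  obtain \<kappa> where \<kappa>: "\<And>y. y > 1 \<Longrightarrow> A y = y + \<kappa>" using A_right by blast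
  consider "x > 0" | "x < 0" using assms by linarith
  then have "comb S n b c x = 0 \<and> bump n b c x = 0"
  proof cases
    case 1
    note L = L0(1)[OF 1] L1(1)[OF _ 1, of b] L1(1)[OF _ 1, of c] L1(1)[OF _ 1, of 1]
    have "comb A n b c x = real (Suc n) * (x - b) - real (Suc n) * (x - c)
        - (c - b) * (real (Suc n) * x - real (Suc n) * (x - 1))"
      unfolding comb_def using L by (simp add: \<kappa> del: of_nat_Suc)
    then have "comb A n b c x = 0" by (simp add: algebra_simps del: of_nat_Suc)
    moreover have "comb S n b c x = 0"
      unfolding comb_def using L by (simp add: S_right del: of_nat_Suc)
    ultimately show ?thesis by (simp add: bump_def)
  next
    case 2
    note L = L0(2)[OF 2] L1(2)[OF _ 2, of b] L1(2)[OF _ 2, of c] L1(2)[OF _ 2, of 1]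
    show ?thesis
      unfolding comb_def bump_def using L by (simp add: A_left S_left del: of_nat_Suc)
  qed
  then show "comb S n b c x = 0" "bump n b c x = 0" by auto
qed

lemma comb_bounded: obtains K where "K \<ge> 0" "\<And>n x. \<bar>comb S n b c x\<bar> \<le> K"
proof -
  obtain B where B: "B \<ge> 0" "\<And>y. \<bar>S y\<bar> \<le> B" using S_bounded by blast
  have "\<bar>comb S n b c x\<bar> \<le> 2 * B + \<bar>c - b\<bar> * (2 * B)" for n x
  proof -
    have "\<bar>S p - S q\<bar> \<le> 2 * B" for p q using B(2)[of p] B(2)[of q] by linarith
    note * = this
    have "\<bar>comb S n b c x\<bar> \<le> \<bar>S (real (Suc n) * (x - b)) - S (real (Suc n) * (x - c))\<bar>
        + \<bar>(c - b) * (S (real (Suc n) * x) - S (real (Suc n) * (x - 1)))\<bar>"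
      unfolding comb_def by linarith
    also have "\<dots> \<le> 2 * B + \<bar>c - b\<bar> * (2 * B)"
      unfolding abs_mult by (intro add_mono mult_left_mono *) auto
    finally show ?thesis .
  qed
  then show ?thesis using B by (intro that[of "2 * B + \<bar>c - b\<bar> * (2 * B)"]) auto
qed

lemma borel_comb [measurable]: "comb S n b c \<in> borel_measurable borel"
  by (intro borel_measurable_continuous_onI continuous_comb_S)

lemma comb_lim:
  assumes "b \<le> c" "x \<noteq> b" "x \<noteq> c" "x \<noteq> 0" "x \<noteq> 1"
  shows "(\<lambda>n. comb S n b c x) \<longlonglongrightarrow> indicat_real {b..c} x - (c - b) * indicat_real {0..1} x"
proof -
  have "(\<lambda>n. comb S n b c x) \<longlonglongrightarrow> (if b < x then 1 else 0) - (if c < x then 1 else 0)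
      - (c - b) * ((if 0 < x then 1 else 0) - (if 1 < x then 1 else 0))"
    unfolding comb_def using S_scaled_lim[of x 0]
    by (intro tendsto_intros S_scaled_lim) (use assms in auto)
  moreover have "(if b < x then 1 else 0) - (if c < x then 1 else 0)
      - (c - b) * ((if 0 < x then 1 else 0) - (if 1 < x then 1 else 0))
      = indicat_real {b..c} x - (c - b) * indicat_real {0..1} x"
    using assms by (auto simp: indicator_def)
  ultimately show ?thesis by simp
qed

text \<open>\<open>V = v - F\<close> annihilates every \<open>comb S n b c\<close>, because
  integration by parts absorbs \<open>g\<close> into \<open>F\<close>. In the limit the integral of
  \<open>V\<close> over [b, c] equals c - b times its integral over [0, 1], so \<open>V\<close>
  minus that number has vanishing interval integrals.\<close>

lemma du_bois_reymond:
  assumes v: "locally_lborel_integrable v" and g: "locally_lborel_integrable g"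
    and weak: "\<And>n b c. b \<in> \<rat> \<Longrightarrow> c \<in> \<rat> \<Longrightarrow> b \<le> c \<Longrightarrow>
      (LINT x|lborel. v x * comb S n b c x) = - (LINT x|lborel. g x * bump n b c x)"
    and F: "primitive F g"
  obtains k where "AE x in lborel. v x = F x + k"
proof -
  have F_cont: "continuous_on UNIV F" by (rule primitive_continuous_on[OF g F])
  define V where "V x = v x - F x" for x
  have V: "locally_lborel_integrable V"
    using v locally_lborel_integrable_continuous[OF F_cont]
    by (auto simp: locally_lborel_integrable_def V_def[abs_def] intro: set_integral_diff)
  \<comment> \<open>The mean over the reference interval that is built into
    \<open>comb\<close>.\<close>
  define k where "k = (LINT x:{0..1}|lborel. V x)"
  have "AE x in lborel. V x - k = 0"
  proof (rule AE_zero_if_interval_integrals_zero)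
    show "locally_lborel_integrable (\<lambda>x. V x - k)"
      using V locally_lborel_integrable_continuous[of "\<lambda>_. k"]
      by (auto simp: locally_lborel_integrable_def intro: set_integral_diff)
    fix b c :: real assume bc: "b \<in> \<rat>" "c \<in> \<rat>" "b \<le> c"
    define J where "J = 3 + \<bar>b\<bar> + \<bar>c\<bar>"
    have out: "comb S n b c x = 0" "bump n b c x = 0" if "x \<notin> {- J..J}" for n x
      using comb_support[of b c x n] that by (auto simp: J_def)
    have bump_cont: "continuous_on UNIV (bump n b c)" for n
      using bump_DERIV by (meson DERIV_isCont continuous_at_imp_continuous_on)
    have cut: "(LINT x|lborel. h x * comb S n b c x) = (LINT x:{- J..J}|lborel. h x * comb S n b c x)"
        "(LINT x|lborel. h x * bump n b c x) = (LINT x:{- J..J}|lborel. h x * bump n b c x)" for h n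
      unfolding set_lebesgue_integral_def
      by (intro Bochner_Integration.integral_cong; use out in \<open>auto simp: indicator_def\<close>)+
    have I: "set_integrable lborel {- J..J} (\<lambda>x. v x * comb S n b c x)"
        "set_integrable lborel {- J..J} (\<lambda>x. F x * comb S n b c x)"
        "set_integrable lborel {- J..J} (\<lambda>x. g x * bump n b c x)"
        "set_integrable lborel {- J..J} (\<lambda>x. V x * comb S n b c x)" for n
      using locally_lborel_integrable_mult_continuous[OF v continuous_comb_S]
        locally_lborel_integrable_mult_continuous[OF V continuous_comb_S]
        locally_lborel_integrable_mult_continuous[OF g bump_cont]
        locally_lborel_integrable_mult_continuous[OF locally_lborel_integrable_continuous[OF F_cont] continuous_comb_S]
      by (auto simp: locally_lborel_integrable_def)
    have zero: "(LINT x:{- J..J}|lborel. V x * comb S n b c x) = 0" for n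
    proof -
      have "(LINT x:{- J..J}|lborel. g x * bump n b c x + F x * comb S n b c x)
          = F J * bump n b c J - F (- J) * bump n b c (- J)"
        by (intro primitive_by_parts F g locally_lborel_integrable_continuous continuous_comb_S
            primitive_if_DERIV bump_DERIV) (auto simp: J_def)
      also have "\<dots> = 0" using comb_support(2)[of b c J n] comb_support(2)[of b c "- J" n] by (auto simp: J_def)
      finally have "(LINT x:{- J..J}|lborel. g x * bump n b c x) + (LINT x:{- J..J}|lborel. F x * comb S n b c x) = 0"
        by (simp add: set_integral_add I)
      moreover have "(LINT x:{- J..J}|lborel. v x * comb S n b c x) = - (LINT x:{- J..J}|lborel. g x * bump n b c x)"
        using weak[OF bc, of n] by (simp add: cut)
      moreover have "(LINT x:{- J..J}|lborel. V x * comb S n b c x)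
          = (LINT x:{- J..J}|lborel. v x * comb S n b c x) - (LINT x:{- J..J}|lborel. F x * comb S n b c x)"
        unfolding V_def left_diff_distrib by (rule set_integral_diff[OF I(1,2)])
      ultimately show ?thesis by simp
    qed
    obtain K where K: "K \<ge> 0" "\<And>n x. \<bar>comb S n b c x\<bar> \<le> K" using comb_bounded by metis
    have V_int: "integrable lborel (\<lambda>x. indicat_real {p..q} x *\<^sub>R V x)" for p q
      using V by (auto simp: locally_lborel_integrable_def set_integrable_def)
    have "(\<lambda>n. LINT x:{- J..J}|lborel. V x * comb S n b c x)
        \<longlonglongrightarrow> (LINT x|lborel. (indicat_real {- J..J} x *\<^sub>R V x) * (indicat_real {b..c} x - (c - b) * indicat_real {0..1} x))"
      unfolding set_lebesgue_integral_def
    proof (rule integral_dominated_convergence[where w = "\<lambda>x. K * \<bar>indicat_real {- J..J} x *\<^sub>R V x\<bar>"])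
      show "AE x in lborel. (\<lambda>n. indicat_real {- J..J} x *\<^sub>R (V x * comb S n b c x))
          \<longlonglongrightarrow> (indicat_real {- J..J} x *\<^sub>R V x) * (indicat_real {b..c} x - (c - b) * indicat_real {0..1} x)"
        using AE_lborel_singleton[of b] AE_lborel_singleton[of c] AE_lborel_singleton[of 0] AE_lborel_singleton[of 1]
      proof eventually_elim
        case (elim x)
        have "(\<lambda>n. (indicat_real {- J..J} x *\<^sub>R V x) * comb S n b c x)
          \<longlonglongrightarrow> (indicat_real {- J..J} x *\<^sub>R V x) * (indicat_real {b..c} x - (c - b) * indicat_real {0..1} x)"
          by (intro tendsto_intros comb_lim) (use bc elim in auto)
        then show ?case by (simp add: mult.assoc)
      qed
      show "(\<lambda>x. indicat_real {- J..J} x *\<^sub>R (V x * comb S n b c x)) \<in> borel_measurable lborel" for n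
        using I(4)[of n] by (auto simp: set_integrable_def)
      show "(\<lambda>x. (indicat_real {- J..J} x *\<^sub>R V x) * (indicat_real {b..c} x - (c - b) * indicat_real {0..1} x))
          \<in> borel_measurable lborel"
        using V_int[of "- J" J] by (intro borel_measurable_times) auto
      show "integrable lborel (\<lambda>x. K * \<bar>indicat_real {- J..J} x *\<^sub>R V x\<bar>)"
        using V_int[of "- J" J] by (intro integrable_mult_right integrable_abs)
      show "AE x in lborel. norm (indicat_real {- J..J} x *\<^sub>R (V x * comb S n b c x))
          \<le> K * \<bar>indicat_real {- J..J} x *\<^sub>R V x\<bar>" for n
        using K by (intro AE_I2) (auto simp: abs_mult indicator_def mult.commute[of "\<bar>V _\<bar>"] intro!: mult_right_mono)
    qed
    \<comment> \<open>\<open>J\<close> is large enough for \<open>{- J..J}\<close> to contain both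
      [b, c] and [0, 1], so the cutoff disappears.\<close>
    moreover have "(LINT x|lborel. (indicat_real {- J..J} x *\<^sub>R V x) * (indicat_real {b..c} x - (c - b) * indicat_real {0..1} x))
        = (LINT x|lborel. indicat_real {b..c} x *\<^sub>R V x - (c - b) * (indicat_real {0..1} x *\<^sub>R V x))"
      by (rule Bochner_Integration.integral_cong) (auto simp: indicator_def J_def right_diff_distrib mult.commute)
    moreover have "\<dots> = (LINT x:{b..c}|lborel. V x) - (c - b) * k"
      by (subst Bochner_Integration.integral_diff) (use V_int in \<open>auto simp: k_def set_lebesgue_integral_def\<close>)
    ultimately have "(LINT x:{b..c}|lborel. V x) = (c - b) * k"
      using zero by (simp add: LIMSEQ_const_iff)
    moreover have "(LINT x:{b..c}|lborel. V x - k) = (LINT x:{b..c}|lborel. V x) - (LINT x:{b..c}|lborel. k)"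
      using V locally_lborel_integrable_continuous[of "\<lambda>_. k"]
      by (intro set_integral_diff) (auto simp: locally_lborel_integrable_def)
    ultimately show "(LINT x:{b..c}|lborel. V x - k) = 0"
      using bc by (simp add: set_lebesgue_integral_def)
  qed
  then show ?thesis by (intro that[of k]) (auto simp: V_def algebra_simps)
qed

lemma continuous_bump: "continuous_on X (bump n b c)"
  using bump_DERIV by (meson DERIV_isCont continuous_at_imp_continuous_on)

lemma borel_bump [measurable]: "bump n b c \<in> borel_measurable borel"
  by (intro borel_measurable_continuous_onI continuous_bump)

lemma test_bounds:
  obtains K J where "K \<ge> 0" "\<And>x. \<bar>comb S n b c x\<bar> \<le> K * indicat_real {- J..J} x"
    "\<And>x. \<bar>bump n b c x\<bar> \<le> K * indicat_real {- J..J} x"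
proof -
  define J where "J = 2 + \<bar>b\<bar> + \<bar>c\<bar>"
  have "\<exists>K. \<forall>x\<in>{- J..J}. \<bar>h x\<bar> \<le> K" if "continuous_on UNIV h" for h :: "real \<Rightarrow> real"
  proof -
    have "compact (h ` {- J..J})" by (intro compact_continuous_image continuous_on_subset[OF that]) auto
    then show ?thesis by (auto dest!: compact_imp_bounded simp: bounded_iff simp del: atLeastAtMost_iff)
  qed
  note * = this
  obtain K1 where K1: "\<And>x. x \<in> {- J..J} \<Longrightarrow> \<bar>comb S n b c x\<bar> \<le> K1" using *[OF continuous_comb_S] by blast
  obtain K2 where K2: "\<And>x. x \<in> {- J..J} \<Longrightarrow> \<bar>bump n b c x\<bar> \<le> K2" using *[OF continuous_bump] by blast
  show ?thesis
  proof (rule that[of "max 0 (max K1 K2)" J])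
    fix x
    show "\<bar>comb S n b c x\<bar> \<le> max 0 (max K1 K2) * indicat_real {- J..J} x"
      "\<bar>bump n b c x\<bar> \<le> max 0 (max K1 K2) * indicat_real {- J..J} x"
      using K1[of x] K2[of x] comb_support[of b c x n]
      by (cases "x \<in> {- J..J}"; auto simp: J_def le_max_iff_disj)+
  qed simp
qed

end

section \<open>The hodograph equation\<close>

lemma integrable_indicator_Icc [simp]: "integrable lborel (indicat_real {a..b :: real})"
  using borel_integrable_compact[of "{a..b}" "\<lambda>_. 1 :: real"] by simp

text \<open>After weighting with \<open>exp (- (2 * M * s))\<close> the integral term carries the
  factor 1/2 and can be absorbed into the supremum. \<open>u\<close> is merely bounded and
  measurable, so a supremum takes the place of the usual differential inequality.\<close>

lemma gronwall_bounded:
  fixes u :: "real \<Rightarrow> real"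
  assumes u_meas: "u \<in> borel_measurable borel" and u_bound: "\<And>s. s \<in> {0..L} \<Longrightarrow> 0 \<le> u s \<and> u s \<le> B"
    and L: "0 \<le> L" and M: "M > 0" and A: "A \<ge> 0"
    and ineq: "\<And>s. s \<in> {0..L} \<Longrightarrow> u s \<le> A + M * (LINT r:{0..s}|lborel. u r)"
    and s: "s \<in> {0..L}"
  shows "u s \<le> 2 * A * exp (2 * M * L)"
proof -
  define w where "w s = exp (- (2 * M * s)) * u s" for s
  define m where "m = (SUP s\<in>{0..L}. w s)"
  have B0: "0 \<le> B" using u_bound[of 0] L by auto
  have w_le_B: "w s \<le> B" if "s \<in> {0..L}" for s
  proof -
    have "exp (- (2 * M * s)) * u s \<le> 1 * B"
      using that u_bound[OF that] M by (intro mult_mono) auto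
    then show ?thesis by (simp add: w_def)
  qed
  have bdd: "bdd_above (w ` {0..L})" using w_le_B by (intro bdd_aboveI[of _ B]) auto
  have w_le_m: "w s \<le> m" if "s \<in> {0..L}" for s
    unfolding m_def by (rule cSUP_upper[OF that bdd])
  have u_le: "u s \<le> m * exp (2 * M * s)" if "s \<in> {0..L}" for s
  proof -
    have "w s * exp (2 * M * s) \<le> m * exp (2 * M * s)"
      using w_le_m[OF that] by (intro mult_right_mono) auto
    moreover have "w s * exp (2 * M * s) = u s" by (simp add: w_def exp_minus field_simps)
    ultimately show ?thesis by simp
  qed
  have "w s \<le> A + m / 2" if s: "s \<in> {0..L}" for s
  proof -
    have FTC: "has_bochner_integral lborel (\<lambda>r. (m * exp (2 * M * r)) * indicator {0..s} r)
        (m * exp (2 * M * s) / (2 * M) - m * exp (2 * M * 0) / (2 * M))"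
      by (rule has_bochner_integral_FTC_Icc_real)
         (use s M in \<open>auto intro!: derivative_eq_intros continuous_intros\<close>)
    then have int: "set_integrable lborel {0..s} (\<lambda>r. m * exp (2 * M * r))"
      unfolding set_integrable_def by (auto simp: has_bochner_integral_iff mult.commute)
    have int_u: "set_integrable lborel {0..s} u"
    proof (rule set_integrable_bound[OF int])
      have "norm (u r) \<le> norm (m * exp (2 * M * r))" if "r \<in> {0..s}" for r
        using that s u_bound[of r] u_le[of r] by auto
      then show "AE r\<in>{0..s} in lborel. norm (u r) \<le> norm (m * exp (2 * M * r))" by (intro AE_I2) blast
    qed (use u_meas in \<open>auto simp: set_borel_measurable_def\<close>)
    have m0: "m \<ge> 0" using w_le_m[of 0] u_bound[of 0] L by (auto simp: w_def)
    have "(LINT r:{0..s}|lborel. u r) \<le> (LINT r:{0..s}|lborel. m * exp (2 * M * r))"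
      by (rule set_integral_mono[OF int_u int]) (use s u_le in auto)
    also have "\<dots> = m * exp (2 * M * s) / (2 * M) - m / (2 * M)"
      using has_bochner_integral_integral_eq[OF FTC]
      by (simp add: set_lebesgue_integral_def mult.commute[of "indicat_real {0..s} _"] mult.assoc)
    also have "\<dots> \<le> m * exp (2 * M * s) / (2 * M)" using m0 M by simp
    finally have "M * (LINT r:{0..s}|lborel. u r) \<le> m * exp (2 * M * s) / 2"
      using M by (simp add: field_simps)
    then have "u s \<le> A + m * exp (2 * M * s) / 2" using ineq[OF s] by linarith
    then have "w s \<le> exp (- (2 * M * s)) * (A + m * exp (2 * M * s) / 2)"
      unfolding w_def by (intro mult_left_mono) auto
    also have "\<dots> = exp (- (2 * M * s)) * A + m / 2" by (simp add: exp_minus field_simps)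
    also have "\<dots> \<le> 1 * A + m / 2" using A M s by (intro add_right_mono mult_right_mono) auto
    finally show ?thesis by simp
  qed
  then have "(SUP s\<in>{0..L}. w s) \<le> A + m / 2" using L by (intro cSUP_least) auto
  then have "m \<le> A + m / 2" by (simp add: m_def[symmetric])
  then have "m \<le> 2 * A" by simp
  then have "u s \<le> (2 * A) * exp (2 * M * s)"
    using u_le[OF s] mult_right_mono[OF \<open>m \<le> 2 * A\<close> exp_ge_zero[of "2 * M * s"]] by linarith
  also have "\<dots> \<le> (2 * A) * exp (2 * M * L)" using A M s by (intro mult_left_mono) auto
  finally show ?thesis .
qed

text \<open>\<open>p\<close> plays the role of \<open>\<phi>'\<close>. It may vanish at 0 but not to
  the right of it, and it enters the equation only as a numerator.\<close>

locale hodograph =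
  fixes p :: "real \<Rightarrow> real" and U V :: real
  assumes U: "U > 0" and V: "V > 0" and p_cont: "continuous_on UNIV p"
    and p_nonneg: "\<And>s. 0 \<le> s \<Longrightarrow> 0 \<le> p s" and p_pos: "\<And>s. 0 < s \<Longrightarrow> 0 < p s"
begin

definition chord :: "real \<Rightarrow> real" where
  "chord r = V * (1 - r / U)"

text \<open>The truncation by the chord keeps the iteration away from the singularity. It is inactive for the
  solution that vanishes at \<open>U\<close>, which is concave and so lies above the chord.\<close>

definition src :: "(real \<Rightarrow> real) \<Rightarrow> real \<Rightarrow> real" where
  "src R r = p r / max (R r) (chord r)"

text \<open>The double primitive of \<open>src R\<close>, written with the kernel
  \<open>max 0 (s - r)\<close>. The domain of integration is the same for every \<open>s\<close>, so
  limits in \<open>s\<close> need no moving endpoints.\<close>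

definition potential :: "(real \<Rightarrow> real) \<Rightarrow> real \<Rightarrow> real" where
  "potential R s = (LINT r:{0..U}|lborel. max 0 (s - r) * src R r)"

text \<open>Its fixed points are the solutions of R'' = - c \<open>src R\<close> with R 0 = V and R'
  0 = 1.\<close>

definition step :: "real \<Rightarrow> (real \<Rightarrow> real) \<Rightarrow> real \<Rightarrow> real" where
  "step c R s = V + s - c * potential R s"

section \<open>Bounds for the integral operator\<close>

lemma p_meas [measurable]: "p \<in> borel_measurable borel"
  by (rule borel_measurable_continuous_onI[OF p_cont])

lemma chord_meas [measurable]: "chord \<in> borel_measurable borel"
  unfolding chord_def[abs_def] by measurable

lemma src_meas [measurable]: "R \<in> borel_measurable borel \<Longrightarrow> src R \<in> borel_measurable borel"
  unfolding src_def[abs_def] by measurable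

lemma chord_nonneg: "r \<le> U \<Longrightarrow> 0 \<le> chord r" and chord_pos: "r < U \<Longrightarrow> 0 < chord r"
  using U V by (auto simp: chord_def)

lemma chord_antimono: "r \<le> s \<Longrightarrow> chord s \<le> chord r"
  using U V by (auto simp: chord_def divide_right_mono intro!: mult_left_mono)

lemma src_nonneg: "r \<in> {0..U} \<Longrightarrow> 0 \<le> src R r"
  using p_nonneg[of r] chord_nonneg[of r] by (auto simp: src_def)

lemma p_bounded: obtains P where "P > 0" "\<And>r. r \<in> {0..U} \<Longrightarrow> p r \<le> P"
proof -
  have "compact (p ` {0..U})" by (intro compact_continuous_image continuous_on_subset[OF p_cont]) auto
  then obtain B where B: "\<forall>y\<in>{0..U}. \<bar>p y\<bar> \<le> B"
    by (auto dest!: compact_imp_bounded simp: bounded_iff simp del: atLeastAtMost_iff)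
  then show ?thesis by (intro that[of "max B 1"]) (auto simp: abs_le_iff le_max_iff_disj)
qed

text \<open>The singularity at \<open>U\<close> is compensated: below \<open>s\<close> the kernel is
  at most \<open>U - r\<close>, and \<open>(U - r) / chord r\<close> is the constant
  \<open>U / V\<close>. The bound does not depend on \<open>R\<close>, which makes it the dominating
  constant of the later limits.\<close>

lemma kernel_bounded:
  obtains C where "C > 0"
    "\<And>R s r. s \<in> {0..U} \<Longrightarrow> r \<in> {0..U} \<Longrightarrow> 0 \<le> max 0 (s - r) * src R r \<and> max 0 (s - r) * src R r \<le> C"
proof -
  obtain P where P: "P > 0" "\<And>r. r \<in> {0..U} \<Longrightarrow> p r \<le> P" using p_bounded by blast
  have "0 \<le> max 0 (s - r) * src R r \<and> max 0 (s - r) * src R r \<le> P * U / V"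
    if s: "s \<in> {0..U}" and r: "r \<in> {0..U}" for R s r
  proof
    show "0 \<le> max 0 (s - r) * src R r" using src_nonneg[OF r] by simp
    show "max 0 (s - r) * src R r \<le> P * U / V"
    proof (cases "r < s")
      case True
      then have "r < U" using s by auto
      then have "chord r > 0" by (rule chord_pos)
      have "src R r \<le> P / chord r"
        unfolding src_def using P(2)[OF r] P(1) \<open>chord r > 0\<close> p_nonneg[of r] r by (intro frac_le) auto
      then have "max 0 (s - r) * src R r \<le> (U - r) * (P / chord r)"
        using s \<open>r < U\<close> src_nonneg[OF r] by (intro mult_mono) auto
      also have "\<dots> = P * U / V" using U V \<open>r < U\<close> by (simp add: chord_def field_simps)
      finally show ?thesis .
    next
      case False then show ?thesis using P U V by simp
    qed
  qed
  moreover have "P * U / V > 0" using P U V by simp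
  ultimately show ?thesis using that by blast
qed

lemma kernel_integrable:
  assumes [measurable]: "R \<in> borel_measurable borel" and s: "s \<in> {0..U}"
  shows "set_integrable lborel {0..U} (\<lambda>r. max 0 (s - r) * src R r)"
proof -
  obtain C where C: "\<And>R s r. s \<in> {0..U} \<Longrightarrow> r \<in> {0..U} \<Longrightarrow> 0 \<le> max 0 (s - r) * src R r \<and> max 0 (s - r) * src R r \<le> C"
    using kernel_bounded by metis
  have "set_integrable lborel {0..U} (\<lambda>_. C)" by (simp add: set_integrable_def)
  then show ?thesis
    by (rule set_integrable_bound) (use C[OF s, of _ R] in \<open>fastforce simp: set_borel_measurable_def\<close>)+
qed

lemma potential_meas [measurable]:
  assumes [measurable]: "R \<in> borel_measurable borel"
  shows "potential R \<in> borel_measurable borel"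
  unfolding potential_def[abs_def] set_lebesgue_integral_def by measurable

lemma potential_nonneg: "s \<in> {0..U} \<Longrightarrow> 0 \<le> potential R s"
  unfolding potential_def set_lebesgue_integral_def
  using src_nonneg[of _ R] by (intro integral_nonneg_AE AE_I2) (auto simp: indicator_def)

lemma potential_le:
  obtains C where "C > 0" "\<And>R s. R \<in> borel_measurable borel \<Longrightarrow> s \<in> {0..U} \<Longrightarrow> potential R s \<le> C"
proof -
  obtain C where C: "C > 0" "\<And>R s r. s \<in> {0..U} \<Longrightarrow> r \<in> {0..U} \<Longrightarrow> 0 \<le> max 0 (s - r) * src R r \<and> max 0 (s - r) * src R r \<le> C"
    using kernel_bounded by metis
  have "potential R s \<le> U * C" if "R \<in> borel_measurable borel" "s \<in> {0..U}" for R s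
  proof -
    have "potential R s \<le> (LINT r:{0..U}|lborel. C)"
      unfolding potential_def
      by (rule set_integral_mono[OF kernel_integrable[OF that]]) (use C that in \<open>auto simp: set_integrable_def\<close>)
    then show ?thesis using U by (simp add: set_lebesgue_integral_def)
  qed
  then show ?thesis using C U by (intro that[of "U * C"]) auto
qed

text \<open>A larger \<open>R\<close> weakens the source. For nonnegative \<open>c\<close> the map
  \<open>step c\<close> is therefore order preserving.\<close>

lemma potential_antimono:
  assumes [measurable]: "R \<in> borel_measurable borel" "R' \<in> borel_measurable borel"
    and le: "\<And>r. r \<in> {0..U} \<Longrightarrow> R r \<le> R' r" and s: "s \<in> {0..U}"
  shows "potential R' s \<le> potential R s"
  unfolding potential_def
proof (rule set_integral_mono[OF kernel_integrable kernel_integrable])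
  fix r assume r: "r \<in> {0..U}"
  show "max 0 (s - r) * src R' r \<le> max 0 (s - r) * src R r"
  proof (cases "r < s")
    case True
    then have "chord r > 0" using s by (intro chord_pos) auto
    then have "src R' r \<le> src R r"
      unfolding src_def using le[OF r] p_nonneg[of r] r by (intro divide_left_mono mult_pos_pos) (auto simp: less_max_iff_disj)
    then show ?thesis by (intro mult_left_mono) auto
  qed simp
qed (use s in auto)

text \<open>The start \<open>V + s\<close> is the value of \<open>step\<close> without source. For
  nonnegative \<open>c\<close> it bounds the image of every function from above, so the first
  iterate lies below it and monotonicity makes the whole sequence decrease.\<close>

primrec iter :: "real \<Rightarrow> nat \<Rightarrow> real \<Rightarrow> real" where
  "iter c 0 = (\<lambda>s. V + s)"
| "iter c (Suc n) = step c (iter c n)"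

definition sol :: "real \<Rightarrow> real \<Rightarrow> real" where
  "sol c s = lim (\<lambda>n. iter c n s)"

lemma step_meas [measurable]: "R \<in> borel_measurable borel \<Longrightarrow> step c R \<in> borel_measurable borel"
  unfolding step_def[abs_def] by measurable

lemma iter_meas [measurable]: "iter c n \<in> borel_measurable borel"
  by (induction n) auto

lemma sol_meas [measurable]: "sol c \<in> borel_measurable borel"
  unfolding sol_def[abs_def] by (rule borel_measurable_lim_metric) simp

lemma iter_decreasing: "c \<ge> 0 \<Longrightarrow> s \<in> {0..U} \<Longrightarrow> iter c (Suc n) s \<le> iter c n s"
proof (induction n arbitrary: s)
  case 0 then show ?case using potential_nonneg[of s] by (simp add: step_def)
next
  case (Suc n)
  have "potential (iter c n) s \<le> potential (iter c (Suc n)) s"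
    by (rule potential_antimono) (use Suc in auto)
  then have "c * potential (iter c n) s \<le> c * potential (iter c (Suc n)) s"
    using Suc.prems by (intro mult_left_mono) auto
  then show ?case unfolding iter.simps(2)[of c "Suc n"] by (simp add: step_def)
qed

lemma iter_tendsto_sol:
  assumes "c \<ge> 0" "s \<in> {0..U}"
  shows "(\<lambda>n. iter c n s) \<longlonglongrightarrow> sol c s"
proof -
  obtain C where C: "C > 0" "\<And>R s. R \<in> borel_measurable borel \<Longrightarrow> s \<in> {0..U} \<Longrightarrow> potential R s \<le> C"
    using potential_le by metis
  have "decseq (\<lambda>n. iter c n s)" using iter_decreasing[OF assms] by (intro decseq_SucI)
  moreover have "V + s - c * C \<le> iter c n s" for n
  proof (cases n)
    case (Suc k)
    have "c * potential (iter c k) s \<le> c * C" using C(2)[of "iter c k" s] assms by (intro mult_left_mono) auto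
    then show ?thesis by (simp add: Suc step_def)
  qed (use assms C in auto)
  ultimately have "convergent (\<lambda>n. iter c n s)"
    by (metis decseq_convergent convergent_def)
  then show ?thesis unfolding sol_def by (simp add: convergent_LIMSEQ_iff)
qed

text \<open>Function and point vary together so that one statement serves the limit of the
  iteration, continuity in \<open>c\<close> and continuity in \<open>s\<close>. Convergence is asked
  for only at r < U; this is what lets the dependence on \<open>c\<close> reach the
  endpoint.\<close>

lemma potential_tendsto:
  assumes [measurable]: "\<And>n. X n \<in> borel_measurable borel" "R \<in> borel_measurable borel"
    and lim: "\<And>r. r \<in> {0..<U} \<Longrightarrow> (\<lambda>n. X n r) \<longlonglongrightarrow> R r"
    and s: "\<And>n. s n \<in> {0..U}" "s \<longlonglongrightarrow> t" and t: "t \<in> {0..U}"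
  shows "(\<lambda>n. potential (X n) (s n)) \<longlonglongrightarrow> potential R t"
proof -
  obtain C where C: "C > 0" "\<And>R s r. s \<in> {0..U} \<Longrightarrow> r \<in> {0..U} \<Longrightarrow> 0 \<le> max 0 (s - r) * src R r \<and> max 0 (s - r) * src R r \<le> C"
    using kernel_bounded by metis
  show ?thesis
    unfolding potential_def set_lebesgue_integral_def
  proof (rule integral_dominated_convergence[where w = "\<lambda>r. indicat_real {0..U} r * C"])
    show "AE r in lborel. (\<lambda>n. indicat_real {0..U} r *\<^sub>R (max 0 (s n - r) * src (X n) r))
        \<longlonglongrightarrow> indicat_real {0..U} r *\<^sub>R (max 0 (t - r) * src R r)"
      using AE_lborel_singleton[of U]
    proof eventually_elim
      case (elim r)
      show ?case
      proof (cases "r \<in> {0..U}")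
        case True
        then have r: "r \<in> {0..<U}" using elim by auto
        then have "chord r > 0" by (intro chord_pos) auto
        then have "(\<lambda>n. src (X n) r) \<longlonglongrightarrow> src R r"
          unfolding src_def by (intro tendsto_intros lim[OF r]) auto
        then show ?thesis by (intro tendsto_intros s(2))
      qed simp
    qed
    show "AE r in lborel. norm (indicat_real {0..U} r *\<^sub>R (max 0 (s n - r) * src (X n) r)) \<le> indicat_real {0..U} r * C" for n
      using C(2)[OF s(1)[of n], of _ "X n"] by (intro AE_I2) (auto simp: indicator_def)
  qed auto
qed

lemma sol_eq:
  assumes "c \<ge> 0" "s \<in> {0..U}"
  shows "sol c s = V + s - c * potential (sol c) s"
proof -
  have "(\<lambda>n. iter c (Suc n) s) \<longlonglongrightarrow> V + s - c * potential (sol c) s"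
    unfolding iter.simps step_def
    by (intro tendsto_intros potential_tendsto[where s = "\<lambda>_. s"]) (use assms iter_tendsto_sol in auto)
  moreover have "(\<lambda>n. iter c (Suc n) s) \<longlonglongrightarrow> sol c s"
    using iter_tendsto_sol[OF assms] by (rule LIMSEQ_Suc)
  ultimately show ?thesis by (metis LIMSEQ_unique)
qed

section \<open>Dependence on the parameter, and its choice\<close>

lemma sol_lipschitz:
  assumes L: "0 \<le> L" "L < U" and \<Lambda>: "0 \<le> \<Lambda>"
  obtains C where "\<And>c d s. c \<in> {0..\<Lambda>} \<Longrightarrow> d \<in> {0..\<Lambda>} \<Longrightarrow> s \<in> {0..L} \<Longrightarrow> \<bar>sol c s - sol d s\<bar> \<le> C * \<bar>c - d\<bar>"
proof -
  obtain P where P: "P > 0" "\<And>r. r \<in> {0..U} \<Longrightarrow> p r \<le> P" using p_bounded by blast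
  obtain C where C: "C > 0" "\<And>R s. R \<in> borel_measurable borel \<Longrightarrow> s \<in> {0..U} \<Longrightarrow> potential R s \<le> C"
    using potential_le by metis
  have cL: "chord L > 0" using L by (intro chord_pos)
  \<comment> \<open>Below \<open>L\<close> the truncation keeps all denominators above
    \<open>chord L\<close>, so \<open>src\<close> is Lipschitz in \<open>R\<close> with constant P /
    (chord L)^2. The estimate degenerates as L tends to U. Taking \<open>\<Lambda> + 1\<close>
    instead of \<open>\<Lambda>\<close> keeps \<open>M\<close> positive.\<close>
  define M where "M = (\<Lambda> + 1) * (U * P / (chord L)\<^sup>2)"
  have M: "M > 0" using U P cL \<Lambda> by (simp add: M_def)
  have "\<bar>sol c s - sol d s\<bar> \<le> 2 * (C * \<bar>c - d\<bar>) * exp (2 * M * L)"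
    if c: "c \<in> {0..\<Lambda>}" and d: "d \<in> {0..\<Lambda>}" and s: "s \<in> {0..L}" for c d s
  proof (rule gronwall_bounded[where u = "\<lambda>s. \<bar>sol c s - sol d s\<bar>" and B = "2 * \<Lambda> * C"])
    fix s assume s: "s \<in> {0..L}"
    then have sU: "s \<in> {0..U}" using L by auto
    have eq: "sol c s - sol d s = d * potential (sol d) s - c * potential (sol c) s"
      using sol_eq[of c s] sol_eq[of d s] c d sU by auto
    have bnd: "0 \<le> e * potential (sol e) s \<and> e * potential (sol e) s \<le> \<Lambda> * C" if "e \<in> {0..\<Lambda>}" for e
      using that C sU potential_nonneg[OF sU, of "sol e"] by (auto intro!: mult_mono)
    show "0 \<le> \<bar>sol c s - sol d s\<bar> \<and> \<bar>sol c s - sol d s\<bar> \<le> 2 * \<Lambda> * C"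
      using bnd[OF c] bnd[OF d] eq by auto
    let ?u = "\<lambda>r. \<bar>sol c r - sol d r\<bar>"
    have u_int: "set_integrable lborel {0..s} ?u"
    proof (rule set_integrable_bound)
      show "set_integrable lborel {0..s} (\<lambda>_. 2 * \<Lambda> * C)" by (simp add: set_integrable_def)
      have "\<bar>sol c r - sol d r\<bar> \<le> 2 * \<Lambda> * C" if r: "r \<in> {0..s}" for r
      proof -
        have rU: "r \<in> {0..U}" using r sU by auto
        have "sol c r - sol d r = d * potential (sol d) r - c * potential (sol c) r"
          using sol_eq[of c r] sol_eq[of d r] c d rU by auto
        moreover have "0 \<le> e * potential (sol e) r \<and> e * potential (sol e) r \<le> \<Lambda> * C" if "e \<in> {0..\<Lambda>}" for e
          using that C rU potential_nonneg[OF rU, of "sol e"] by (auto intro!: mult_mono)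
        note this[OF c] this[OF d]
        ultimately show ?thesis by auto
      qed
      then show "AE r\<in>{0..s} in lborel. norm \<bar>sol c r - sol d r\<bar> \<le> norm (2 * \<Lambda> * C)"
        by (intro AE_I2) fastforce
    qed (auto simp: set_borel_measurable_def)
    have ker: "\<bar>max 0 (s - r) * src (sol d) r - max 0 (s - r) * src (sol c) r\<bar>
        \<le> (U * P / (chord L)\<^sup>2) * (indicat_real {0..s} r * ?u r)" if r: "r \<in> {0..U}" for r
    proof (cases "r < s")
      case True
      have ch: "chord L \<le> chord r" using True s by (intro chord_antimono) auto
      define x y where "x = max (sol c r) (chord r)" and "y = max (sol d r) (chord r)"
      have xy: "x \<ge> chord L" "y \<ge> chord L" using ch by (auto simp: x_def y_def)
      have "src (sol d) r - src (sol c) r = p r * (x - y) / (x * y)"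
        unfolding src_def x_def[symmetric] y_def[symmetric] using xy cL by (simp add: field_simps)
      then have "\<bar>src (sol d) r - src (sol c) r\<bar> = p r * \<bar>x - y\<bar> / (x * y)"
        using xy cL p_nonneg[of r] r by (simp add: abs_mult)
      also have "\<dots> \<le> P * ?u r / (chord L * chord L)"
        by (intro frac_le mult_mono) (use xy cL P r p_nonneg[of r] in \<open>auto simp: x_def y_def\<close>)
      finally have *: "\<bar>src (sol d) r - src (sol c) r\<bar> \<le> P * ?u r / (chord L * chord L)" .
      have "\<bar>max 0 (s - r) * src (sol d) r - max 0 (s - r) * src (sol c) r\<bar>
          = (s - r) * \<bar>src (sol d) r - src (sol c) r\<bar>"
        using True by (simp add: abs_mult right_diff_distrib[symmetric])
      also have "\<dots> \<le> U * (P * ?u r / (chord L * chord L))"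
        using * sU r True by (intro mult_mono) auto
      finally show ?thesis using True r by (simp add: power2_eq_square)
    qed (use U P in auto)
    have "\<bar>potential (sol d) s - potential (sol c) s\<bar>
        = \<bar>LINT r:{0..U}|lborel. max 0 (s - r) * src (sol d) r - max 0 (s - r) * src (sol c) r\<bar>"
      unfolding potential_def by (subst set_integral_diff) (auto intro!: kernel_integrable sU[simplified])
    also have "\<dots> \<le> (LINT r|lborel. norm (indicat_real {0..U} r *\<^sub>R (max 0 (s - r) * src (sol d) r - max 0 (s - r) * src (sol c) r)))"
      unfolding set_lebesgue_integral_def real_norm_def[symmetric] by (rule integral_norm_bound)
    also have "\<dots> \<le> (LINT r|lborel. (U * P / (chord L)\<^sup>2) * (indicat_real {0..s} r *\<^sub>R ?u r))"
    proof (rule integral_mono)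
      have "set_integrable lborel {0..U} (\<lambda>r. max 0 (s - r) * src (sol d) r - max 0 (s - r) * src (sol c) r)"
        by (intro set_integral_diff kernel_integrable sU) auto
      then show "integrable lborel (\<lambda>r. norm (indicat_real {0..U} r *\<^sub>R (max 0 (s - r) * src (sol d) r - max 0 (s - r) * src (sol c) r)))"
        unfolding set_integrable_def by (rule integrable_norm)
      show "integrable lborel (\<lambda>r. (U * P / (chord L)\<^sup>2) * (indicat_real {0..s} r *\<^sub>R ?u r))"
        using u_int unfolding set_integrable_def by (rule integrable_mult_right)
      show "norm (indicat_real {0..U} r *\<^sub>R (max 0 (s - r) * src (sol d) r - max 0 (s - r) * src (sol c) r))
          \<le> (U * P / (chord L)\<^sup>2) * (indicat_real {0..s} r *\<^sub>R ?u r)" for r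
        using ker[of r] U P by (auto simp: indicator_def)
    qed
    also have "\<dots> = (U * P / (chord L)\<^sup>2) * (LINT r:{0..s}|lborel. ?u r)"
      by (simp add: set_lebesgue_integral_def)
    finally have pot: "\<bar>potential (sol d) s - potential (sol c) s\<bar> \<le> (U * P / (chord L)\<^sup>2) * (LINT r:{0..s}|lborel. ?u r)" .
    have "sol c s - sol d s = d * (potential (sol d) s - potential (sol c) s) + (d - c) * potential (sol c) s"
      using eq by (simp add: algebra_simps)
    then have "\<bar>sol c s - sol d s\<bar> \<le> d * \<bar>potential (sol d) s - potential (sol c) s\<bar> + \<bar>c - d\<bar> * potential (sol c) s"
      using d potential_nonneg[OF sU, of "sol c"] abs_triangle_ineq[of "d * (potential (sol d) s - potential (sol c) s)" "(d - c) * potential (sol c) s"]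
      by (simp add: abs_mult abs_minus_commute)
    also have "\<dots> \<le> (\<Lambda> + 1) * ((U * P / (chord L)\<^sup>2) * (LINT r:{0..s}|lborel. ?u r)) + \<bar>c - d\<bar> * C"
      using pot d C(2)[of "sol c", OF _ sU] potential_nonneg[OF sU] by (intro add_mono mult_mono) auto
    finally show "\<bar>sol c s - sol d s\<bar> \<le> C * \<bar>c - d\<bar> + M * (LINT r:{0..s}|lborel. ?u r)"
      by (simp add: M_def algebra_simps)
  qed (use L M C s in auto)
  then show ?thesis by (intro that[of "2 * C * exp (2 * M * L)"]) (simp add: mult_ac)
qed

text \<open>The Lipschitz estimates give convergence at every r < U; the uniform kernel bound then
  carries the limit through the integral up to s = U.\<close>

lemma endpoint_continuous: "continuous_on {0..} (\<lambda>c. sol c U)"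
proof (rule continuous_on_sequentiallyI)
  fix u a assume u: "\<forall>n. u n \<in> {0..}" "a \<in> {0..}" "u \<longlonglongrightarrow> (a :: real)"
  obtain \<Lambda> where \<Lambda>: "\<And>n. u n \<le> \<Lambda>" "a \<le> \<Lambda>"
  proof -
    from convergent_imp_Bseq[of u] u(3) obtain K where "\<And>n. \<bar>u n\<bar> \<le> K"
      by (auto simp: convergent_def Bseq_def)
    then show ?thesis by (intro that[of "max K a"]) (auto simp: abs_le_iff le_max_iff_disj)
  qed
  have lim: "(\<lambda>n. sol (u n) r) \<longlonglongrightarrow> sol a r" if r: "r \<in> {0..<U}" for r
  proof -
    obtain C where C: "\<And>c d s. c \<in> {0..\<Lambda>} \<Longrightarrow> d \<in> {0..\<Lambda>} \<Longrightarrow> s \<in> {0..r} \<Longrightarrow> \<bar>sol c s - sol d s\<bar> \<le> C * \<bar>c - d\<bar>"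
      using sol_lipschitz[of r \<Lambda>] r u(2) \<Lambda>(2) by auto
    have "(\<lambda>n. sol (u n) r - sol a r) \<longlonglongrightarrow> 0"
    proof (rule Lim_null_comparison)
      show "\<forall>\<^sub>F n in sequentially. norm (sol (u n) r - sol a r) \<le> C * \<bar>u n - a\<bar>"
        using C u \<Lambda> r by (intro always_eventually) auto
      show "(\<lambda>n. C * \<bar>u n - a\<bar>) \<longlonglongrightarrow> 0"
        using tendsto_mult[OF tendsto_const[of C] tendsto_rabs[OF tendsto_diff[OF u(3) tendsto_const[of a]]]] by simp
    qed
    then show ?thesis by (simp add: LIM_zero_iff)
  qed
  have "(\<lambda>n. V + U - u n * potential (sol (u n)) U) \<longlonglongrightarrow> V + U - a * potential (sol a) U"
    by (intro tendsto_intros u potential_tendsto[where s = "\<lambda>_. U"] lim) (use U in auto)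
  then show "(\<lambda>n. sol (u n) U) \<longlonglongrightarrow> sol a U"
    using sol_eq[of _ U] u U by (simp add: sol_eq)
qed

text \<open>At c = 0 the endpoint value is V + U > 0. Solution and chord both stay below V + U, so
  the potential at \<open>U\<close> is at least the fixed positive number \<open>?K\<close>, and c =
  (V + U) / ?K already pushes the value to 0 or below.\<close>

lemma endpoint_root: obtains c where "c > 0" "sol c U = 0"
proof -
  let ?K = "LINT r:{0..U}|lborel. (U - r) * (p r / (V + U))"
  have cont: "continuous_on {0..U} (\<lambda>r. (U - r) * (p r / (V + U)))"
    by (intro continuous_intros continuous_on_subset[OF p_cont]) (use U V in auto)
  have Kint: "set_integrable lborel {0..U} (\<lambda>r. (U - r) * (p r / (V + U)))"
    unfolding set_integrable_def by (rule borel_integrable_compact[OF _ cont]) simp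
  have K_eq: "?K = integral {0..U} (\<lambda>r. (U - r) * (p r / (V + U)))"
    by (rule set_borel_integral_eq_integral[OF Kint])
  have "?K \<ge> 0"
    unfolding set_lebesgue_integral_def using p_nonneg U V
    by (intro integral_nonneg_AE AE_I2) (auto simp: indicator_def)
  moreover have "?K \<noteq> 0"
  proof
    assume "?K = 0"
    then have "\<forall>r\<in>{0..U}. (U - r) * (p r / (V + U)) = 0"
      using K_eq integral_eq_0_iff[OF cont U] p_nonneg U V by auto
    from bspec[OF this, of "U / 2"] show False using p_pos[of "U / 2"] U V by simp
  qed
  ultimately have K: "?K > 0" by linarith
  have pot: "?K \<le> potential (sol c) U" if "c \<ge> 0" for c
    unfolding potential_def
  proof (rule set_integral_mono[OF Kint kernel_integrable])
    fix r assume r: "r \<in> {0..U}"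
    show "(U - r) * (p r / (V + U)) \<le> max 0 (U - r) * src (sol c) r"
    proof (cases "r = U")
      case False
      have "sol c r \<le> V + r"
        using sol_eq[OF that r] mult_nonneg_nonneg[OF that potential_nonneg[OF r, of "sol c"]] by linarith
      moreover have "chord r \<le> V" using r U V by (simp add: chord_def field_simps)
      moreover have "chord r > 0" using r False by (intro chord_pos) auto
      ultimately have "p r / (V + U) \<le> src (sol c) r"
        unfolding src_def using r p_nonneg[of r] by (intro divide_left_mono mult_pos_pos) auto
      then show ?thesis using r by (intro mult_mono) (auto intro!: divide_nonneg_nonneg p_nonneg simp: U V less_imp_le)
    qed simp
  qed (use U in auto)
  define \<Lambda> where "\<Lambda> = (V + U) / ?K"
  have \<Lambda>: "\<Lambda> > 0" unfolding \<Lambda>_def by (rule divide_pos_pos) (use K U V in auto)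
  have "sol \<Lambda> U \<le> V + U - \<Lambda> * ?K"
    using sol_eq[of \<Lambda> U] pot[of \<Lambda>] \<Lambda> U mult_left_mono[of ?K "potential (sol \<Lambda>) U" \<Lambda>] by auto
  moreover have "\<Lambda> * ?K = V + U" unfolding \<Lambda>_def using K by (intro nonzero_eq_divide_eq[THEN iffD1]) auto
  ultimately have "sol \<Lambda> U \<le> 0" by linarith
  moreover have s0: "sol 0 U = V + U" using sol_eq[of 0 U] U by simp
  ultimately obtain c where "0 \<le> c" "c \<le> \<Lambda>" "sol c U = 0"
    using IVT2'[of "\<lambda>c. sol c U" \<Lambda> 0 0] continuous_on_subset[OF endpoint_continuous, of "{0..\<Lambda>}"] \<Lambda> U V by auto
  moreover have "c \<noteq> 0" using \<open>sol c U = 0\<close> s0 U V by auto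
  ultimately show ?thesis by (intro that[of c]) auto
qed

lemma sol_ge_chord:
  assumes c: "c > 0" "sol c U = 0" and s: "s \<in> {0..U}"
  shows "chord s \<le> sol c s"
proof -
  have "potential (sol c) s \<le> (LINT r:{0..U}|lborel. (s / U) * (max 0 (U - r) * src (sol c) r))"
    unfolding potential_def
  proof (rule set_integral_mono[OF kernel_integrable])
    show "set_integrable lborel {0..U} (\<lambda>r. (s / U) * (max 0 (U - r) * src (sol c) r))"
      by (intro set_integrable_mult_right kernel_integrable) (use U in auto)
    fix r assume r: "r \<in> {0..U}"
    \<comment> \<open>The kernel is convex in \<open>s\<close> and vanishes at s = 0, so it lies
      below its secant on [0, U]. Combined with the value V + U of
      \<open>c * potential (sol c) U\<close> this puts the solution above the chord.\<close>
    have "max 0 (s - r) \<le> (s / U) * max 0 (U - r)"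
    proof (cases "r < s")
      case True
      have "s * r \<le> U * r" using s r by (intro mult_right_mono) auto
      then show ?thesis using True U s r by (simp add: field_simps)
    qed (use U s in auto)
    then show "max 0 (s - r) * src (sol c) r \<le> (s / U) * (max 0 (U - r) * src (sol c) r)"
      by (subst mult.assoc[symmetric]) (rule mult_right_mono[OF _ src_nonneg[OF r]])
  qed (use s in auto)
  also have "\<dots> = (s / U) * potential (sol c) U" by (simp add: potential_def)
  finally have "c * potential (sol c) s \<le> c * ((s / U) * potential (sol c) U)"
    using c by (intro mult_left_mono) auto
  moreover have "c * potential (sol c) U = V + U" using sol_eq[of c U] c U by simp
  ultimately have "c * potential (sol c) s \<le> (s / U) * (V + U)" by (metis mult.left_commute)
  then have "sol c s \<ge> V + s - (s / U) * (V + U)" using sol_eq[of c s] c s by simp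
  moreover have "V + s - (s / U) * (V + U) = chord s" using U by (simp add: chord_def field_simps)
  ultimately show ?thesis by simp
qed

lemma sol_continuous:
  assumes c: "c > 0"
  shows "continuous_on {0..U} (sol c)"
proof (rule continuous_on_sequentiallyI)
  fix u a assume u: "\<forall>n. u n \<in> {0..U}" "a \<in> {0..U}" "u \<longlonglongrightarrow> a"
  have "(\<lambda>n. V + u n - c * potential (sol c) (u n)) \<longlonglongrightarrow> V + a - c * potential (sol c) a"
    by (intro tendsto_intros u potential_tendsto) (use u in auto)
  then show "(\<lambda>n. sol c (u n)) \<longlonglongrightarrow> sol c a" using sol_eq[of c] u c by simp
qed

text \<open>Writing the kernel as \<open>s * h r - r * h r\<close> separates \<open>s\<close> from
  the integrand: the fundamental theorem applies to each primitive, and the terms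
  \<open>s * h s\<close> cancel. Derivatives are claimed only inside (0, U), since \<open>h\<close>
  blows up at \<open>U\<close>; continuity of \<open>R1\<close> down to 0 with value 1 places the
  interface at \<eta> = a.\<close>

lemma sol_regular:
  assumes c: "c > 0" "sol c U = 0"
  obtains R1 where
    "\<And>s. s \<in> {0<..<U} \<Longrightarrow> (sol c has_real_derivative R1 s) (at s)"
    "\<And>s. s \<in> {0<..<U} \<Longrightarrow> (R1 has_real_derivative - c * p s / sol c s) (at s)"
    "continuous_on {0..<U} R1" "R1 0 = 1"
proof -
  define h where "h r = p r / sol c r" for r
  define I0 where "I0 s = integral {0..s} h" for s
  define I1 where "I1 s = integral {0..s} (\<lambda>r. r * h r)" for s
  have pos: "sol c r > 0" if "r \<in> {0..<U}" for r
    using sol_ge_chord[OF c, of r] chord_pos[of r] that by auto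
  have h_src: "src (sol c) r = h r" if "r \<in> {0..<U}" for r
    using sol_ge_chord[OF c, of r] that by (simp add: src_def h_def max_absorb1)
  have cont_h: "continuous_on {0..L} h" if "L < U" for L
    unfolding h_def
    by (intro continuous_intros continuous_on_subset[OF p_cont] continuous_on_subset[OF sol_continuous[OF c(1)]])
       (use that pos in force)+
  have eq: "sol c s = V + s - c * (s * I0 s - I1 s)" if s: "s \<in> {0..<U}" for s
  proof -
    have int: "set_integrable lborel {0..s} (\<lambda>r. (s - r) * h r)"
      unfolding set_integrable_def
      by (intro borel_integrable_compact continuous_intros cont_h) (use s in auto)
    have "potential (sol c) s = (LINT r:{0..s}|lborel. (s - r) * h r)"
      unfolding potential_def set_lebesgue_integral_def
      by (intro Bochner_Integration.integral_cong) (use s h_src in \<open>auto simp: indicator_def\<close>)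
    also have "\<dots> = integral {0..s} (\<lambda>r. s * h r - r * h r)"
      using set_borel_integral_eq_integral(2)[OF int] by (simp add: left_diff_distrib)
    also have "\<dots> = s * I0 s - I1 s"
      unfolding I0_def I1_def
      by (subst Henstock_Kurzweil_Integration.integral_diff)
         (use s in \<open>auto intro!: integrable_continuous_interval continuous_intros cont_h\<close>)
    finally show ?thesis using sol_eq[of c s] c s by simp
  qed
  have I0_deriv: "(I0 has_real_derivative h s) (at s)" and I1_deriv: "(I1 has_real_derivative s * h s) (at s)"
    if s: "s \<in> {0<..<U}" for s
  proof -
    define L where "L = (s + U) / 2"
    have L: "s < L" "L < U" using s by (auto simp: L_def)
    have "(I0 has_real_derivative h s) (at s within {0..L})"
      unfolding I0_def by (rule integral_has_real_derivative) (use s L cont_h in auto)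
    moreover have "(I1 has_real_derivative s * h s) (at s within {0..L})"
      unfolding I1_def by (rule integral_has_real_derivative) (use s L in \<open>auto intro!: continuous_intros cont_h\<close>)
    moreover have "at s within {0..L} = at s" by (rule at_within_interior) (use s L in auto)
    ultimately show "(I0 has_real_derivative h s) (at s)" "(I1 has_real_derivative s * h s) (at s)" by auto
  qed
  show ?thesis
  proof (rule that[of "\<lambda>s. 1 - c * I0 s"])
    fix s assume s: "s \<in> {0<..<U}"
    have "((\<lambda>s. V + s - c * (s * I0 s - I1 s)) has_real_derivative 1 - c * I0 s) (at s)"
      using I0_deriv[OF s] I1_deriv[OF s] by (auto intro!: derivative_eq_intros)
    then show "(sol c has_real_derivative 1 - c * I0 s) (at s)"
      by (rule has_field_derivative_transform_within_open[of _ _ _ "{0<..<U}"]) (use s eq in auto)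
    show "((\<lambda>s. 1 - c * I0 s) has_real_derivative - c * p s / sol c s) (at s)"
      using I0_deriv[OF s] by (auto intro!: derivative_eq_intros simp: h_def)
  next
    have "continuous_on {0..L} I0" if "L < U" for L
      unfolding I0_def
      by (intro indefinite_integral_continuous_1 integrable_continuous_interval cont_h that)
    then have "continuous_on {0..L} (\<lambda>s. 1 - c * I0 s)" if "L < U" for L
      using that by (intro continuous_intros)
    note * = this
    show "continuous_on {0..<U} (\<lambda>s. 1 - c * I0 s)"
      unfolding continuous_on_eq_continuous_within
    proof
      fix s assume s: "s \<in> {0..<U}"
      define L where "L = (s + U) / 2"
      have L: "s < L" "L < U" using s by (auto simp: L_def)
      have "continuous (at s within {0..L}) (\<lambda>s. 1 - c * I0 s)"
        using *[OF L(2)] s L by (auto simp: continuous_on_eq_continuous_within)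
      moreover have "at s within {0..L} = at s within {0..<U}"
        by (rule at_within_nhd[of _ "{..<L}"]) (use s L in auto)
      ultimately show "continuous (at s within {0..<U}) (\<lambda>s. 1 - c * I0 s)"
        by (simp add: continuous_within)
    qed
  qed (simp add: I0_def)
qed

text \<open>With slope bounded below, the solution would be at most \<open>B' * (U - s)\<close>, and
  its second derivative at most - k / (U - s) near \<open>U\<close>, whose integral diverges
  logarithmically. The unbounded slope makes \<eta> = a R' run through the whole half-line, so that
  \<open>U\<close> is approached only at -\<infinity>.\<close>

lemma sol_slope_unbounded:
  assumes c: "c > 0" "sol c U = 0"
    and R1: "\<And>s. s \<in> {0<..<U} \<Longrightarrow> (sol c has_real_derivative R1 s) (at s)"
    and R2: "\<And>s. s \<in> {0<..<U} \<Longrightarrow> (R1 has_real_derivative - c * p s / sol c s) (at s)"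
  shows "\<exists>s\<in>{0<..<U}. R1 s < - B"
proof (rule ccontr)
  assume "\<not> (\<exists>s\<in>{0<..<U}. R1 s < - B)"
  then have R1_ge: "- B \<le> R1 s" if "s \<in> {0<..<U}" for s using that by force
  define B' where "B' = max B 1"
  have B': "B' > 0" "\<And>s. s \<in> {0<..<U} \<Longrightarrow> - B' \<le> R1 s"
    using R1_ge by (auto simp: B'_def) (smt (verit) max.cobounded1)
  have pos: "sol c r > 0" if "r \<in> {0..<U}" for r
    using sol_ge_chord[OF c, of r] chord_pos[of r] that by auto
  have R_le: "sol c s \<le> B' * (U - s)" if s: "s \<in> {0<..<U}" for s
  proof -
    have "continuous_on {s..U} (sol c)"
      using s by (intro continuous_on_subset[OF sol_continuous[OF c(1)]]) auto
    moreover have "sol c differentiable (at x)" if "s < x" "x < U" for x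
      using R1[of x] s that by (auto simp: real_differentiable_def)
    ultimately obtain l z where z: "s < z" "z < U" "(sol c has_real_derivative l) (at z)"
        "sol c U - sol c s = (U - s) * l"
      using MVT[of s U "sol c"] s by auto
    then have "l = R1 z" using R1[of z] s DERIV_unique by force
    then have "(U - s) * (- B') \<le> (U - s) * l" using B'(2)[of z] z s by (intro mult_left_mono) auto
    then show ?thesis using z(4) c by (simp add: algebra_simps)
  qed
  \<comment> \<open>The interval stays away from s = 0, where \<open>p\<close> may vanish, so the
    minimum is positive.\<close>
  obtain m where m: "m \<in> {U/2..U}" "\<And>r. r \<in> {U/2..U} \<Longrightarrow> p m \<le> p r"
    using continuous_attains_inf[of "{U/2..U}" p] continuous_on_subset[OF p_cont] U by auto
  have pm: "p m > 0" using m(1) U by (intro p_pos) auto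
  define k where "k = c * p m / B'"
  have k: "k > 0" using c pm B' by (simp add: k_def)
  define C0 where "C0 = R1 (U/2) - k * ln (U - U/2)"
  \<comment> \<open>Small enough for \<open>C0 + k * ln e\<close> to drop to at most
    \<open>- B' - 1\<close>, below the assumed lower bound of the slope.\<close>
  define e where "e = min (U/2) (exp ((- B' - C0 - 1) / k))"
  have e: "e > 0" "e \<le> U/2" using U by (auto simp: e_def)
  have "R1 (U - e) - k * ln (U - (U - e)) \<le> R1 (U/2) - k * ln (U - U/2)"
  proof (rule DERIV_nonpos_imp_nonincreasing[where f = "\<lambda>s. R1 s - k * ln (U - s)" and a = "U/2" and b = "U - e"])
    fix s assume s: "U/2 \<le> s" "s \<le> U - e"
    then have sU: "s \<in> {0<..<U}" using U e by auto
    have "c * p m / (B' * (U - s)) \<le> c * p s / sol c s"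
      using R_le[OF sU] pos[of s] sU m(2)[of s] s c pm e by (intro frac_le mult_left_mono mult_nonneg_nonneg) auto
    then have "- c * p s / sol c s - k * (- 1 / (U - s)) \<le> 0" by (simp add: k_def)
    moreover have "((\<lambda>s. R1 s - k * ln (U - s)) has_real_derivative - c * p s / sol c s - k * (- 1 / (U - s))) (at s)"
      using R2[OF sU] sU by (auto intro!: derivative_eq_intros)
    ultimately show "\<exists>y. ((\<lambda>s. R1 s - k * ln (U - s)) has_real_derivative y) (at s) \<and> y \<le> 0" by blast
  qed (use e in auto)
  then have "R1 (U - e) \<le> C0 + k * ln e" unfolding C0_def by simp
  also have "\<dots> \<le> C0 + k * ((- B' - C0 - 1) / k)"
  proof -
    have "ln e \<le> ln (exp ((- B' - C0 - 1) / k))"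
      using e by (subst ln_le_cancel_iff) (auto simp: e_def)
    then have "k * ln e \<le> k * ((- B' - C0 - 1) / k)" using k by (intro mult_left_mono) auto
    then show ?thesis by simp
  qed
  also have "\<dots> = - B' - 1" using k by simp
  finally show False using B'(2)[of "U - e"] e U by simp
qed

text \<open>The map \<open>g s = a * R1 s\<close> decreases strictly from \<open>a\<close> to
  -\<infinity>; \<open>f\<close> is its inverse, and \<open>q = a / 2 * R\<close> composed with
  \<open>f\<close> is the negative flux. The lower bound on \<open>q\<close> by a multiple of
  \<open>U - f\<close> is the chord estimate in new variables; it will yield the exponential
  approach to \<open>U\<close>.\<close>

lemma similarity_profile_exists:
  obtains f q :: "real \<Rightarrow> real" and a k M where
    "a > 0" "k > 0"
    "\<And>x. x < a \<Longrightarrow> 0 < f x" "\<And>x. x < a \<Longrightarrow> f x < U"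
    "\<And>x. x < a \<Longrightarrow> (f has_real_derivative - q x / p (f x)) (at x)"
    "\<And>x. x < a \<Longrightarrow> (q has_real_derivative - x / 2 * (q x / p (f x))) (at x)"
    "\<And>x. x < a \<Longrightarrow> 0 < q x" "\<And>x. x < a \<Longrightarrow> k * (U - f x) \<le> q x" "\<And>x. x < a \<Longrightarrow> q x \<le> M"
    "(f \<longlongrightarrow> U) at_bot" "(f \<longlongrightarrow> 0) (at_left a)" "(q \<longlongrightarrow> a * V / 2) (at_left a)"
    "\<And>x. x \<ge> a \<Longrightarrow> f x = - V"
proof -
  obtain c where c: "c > 0" "sol c U = 0" using endpoint_root by blast
  obtain R1 where R1: "\<And>s. s \<in> {0<..<U} \<Longrightarrow> (sol c has_real_derivative R1 s) (at s)"
    and R2: "\<And>s. s \<in> {0<..<U} \<Longrightarrow> (R1 has_real_derivative - c * p s / sol c s) (at s)"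
    and R1_cont: "continuous_on {0..<U} R1" and R1_0: "R1 0 = 1"
    using sol_regular[OF c] by blast
  have pos: "sol c r > 0" if "r \<in> {0..<U}" for r
    using sol_ge_chord[OF c, of r] chord_pos[of r] that by auto
  \<comment> \<open>The inverse function has derivative - R / (a c p). This equals - q / p for q =
    (a/2) R precisely when c = 2 / a^2.\<close>
  define a where "a = sqrt (2 / c)"
  have a: "a > 0" "a * a = 2 / c" using c by (auto simp: a_def)
  define g where "g s = a * R1 s" for s
  have g_deriv: "(g has_real_derivative a * (- c * p s / sol c s)) (at s)" if "s \<in> {0<..<U}" for s
    unfolding g_def[abs_def] by (rule DERIV_cmult[OF R2[OF that]])
  have g_slope: "a * (- c * p s / sol c s) < 0" if "s \<in> {0<..<U}" for s
    using a c p_pos[of s] pos[of s] that by (auto intro!: mult_pos_pos divide_pos_pos)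
  have g_cont: "continuous_on {0..<U} g" unfolding g_def[abs_def] by (intro continuous_intros R1_cont)
  have g_anti: "g t < g s" if "0 \<le> s" "s < t" "t < U" for s t
  proof (rule DERIV_neg_imp_decreasing_open[OF that(2)])
    show "\<exists>y. (g has_real_derivative y) (at x) \<and> y < 0" if "s < x" "x < t" for x
      using g_deriv[of x] g_slope[of x] that \<open>0 \<le> s\<close> \<open>t < U\<close> by fastforce
    show "continuous_on {s..t} g" by (rule continuous_on_subset[OF g_cont]) (use that in auto)
  qed
  have g_inj: "s = t" if "g s = g t" "s \<in> {0<..<U}" "t \<in> {0<..<U}" for s t
    using g_anti[of s t] g_anti[of t s] that by (cases s t rule: linorder_cases) auto
  have g_less_a: "g s < a" if "s \<in> {0<..<U}" for s
    using g_anti[of 0 s] that by (simp add: g_def R1_0)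
  have g_surj: "\<exists>s\<in>{0<..<U}. g s = y" if y: "y < a" for y
  proof -
    obtain t where t: "t \<in> {0<..<U}" "R1 t < - (\<bar>y\<bar> / a)"
      using sol_slope_unbounded[OF c R1 R2] by blast
    have "g t \<le> y" using t(2) a mult_strict_left_mono[OF t(2) a(1)] by (simp add: g_def)
    moreover have "continuous_on {0..t} g" by (rule continuous_on_subset[OF g_cont]) (use t in auto)
    ultimately obtain s where s: "0 \<le> s" "s \<le> t" "g s = y"
      using IVT2'[of g t y 0] y t by (auto simp: g_def R1_0)
    then have "s \<noteq> 0" using y by (auto simp: g_def R1_0)
    then show ?thesis using s t by auto
  qed
  define f where "f y = (if y < a then (THE s. s \<in> {0<..<U} \<and> g s = y) else - V)" for y
  have f: "f y \<in> {0<..<U}" "g (f y) = y" if "y < a" for y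
  proof -
    have "\<exists>!s. s \<in> {0<..<U} \<and> g s = y" using g_surj[OF that] g_inj by blast
    from theI'[OF this] show "f y \<in> {0<..<U}" "g (f y) = y" using that by (auto simp: f_def)
  qed
  have fg: "f (g s) = s" if "s \<in> {0<..<U}" for s
    using f[OF g_less_a[OF that]] g_inj that by blast
  have f_less: "f y < s" if "g s < y" "y < a" "s \<in> {0<..<U}" for s y
  proof (rule ccontr)
    assume "\<not> f y < s"
    then have "g (f y) \<le> g s" using g_anti[of s "f y"] f[OF that(2)] that(3) by (cases "f y = s") auto
    then show False using f[OF that(2)] that by simp
  qed
  have f_greater: "s < f y" if "y < g s" "s \<in> {0<..<U}" for s y
  proof (rule ccontr)
    have ya: "y < a" using g_less_a[OF that(2)] that by simp
    assume "\<not> s < f y"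
    then have "g s \<le> g (f y)" using g_anti[of "f y" s] f[OF ya] that(2) by (cases "f y = s") auto
    then show False using f[OF ya] that by simp
  qed
  have f_cont: "isCont f y" if y: "y < a" for y
  proof -
    let ?s = "f y"
    have s: "0 < ?s" "?s < U" using f[OF y] by auto
    have "isCont f (g ?s)"
    proof (rule isCont_inverse_function2[of "?s / 2" ?s "(?s + U) / 2" f g])
      fix z assume "?s / 2 \<le> z" "z \<le> (?s + U) / 2"
      then have z: "z \<in> {0<..<U}" using s by auto
      show "f (g z) = z" by (rule fg[OF z])
      show "isCont g z" by (rule DERIV_isCont[OF g_deriv[OF z]])
    qed (use s in auto)
    then show ?thesis using f[OF y] by simp
  qed
  define q where "q y = a / 2 * sol c (f y)" for y
  have f_deriv: "(f has_real_derivative - q y / p (f y)) (at y)" if y: "y < a" for y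
  proof -
    have "(f has_real_derivative inverse (a * (- c * p (f y) / sol c (f y)))) (at y)"
      by (rule DERIV_inverse_function[where f = g and a = "y - 1" and b = a])
         (use g_deriv g_slope[of "f y"] f f_cont y in auto)
    also have "inverse (a * (- c * p (f y) / sol c (f y))) = - q y / p (f y)"
    proof -
      have "2 / (a * c) = a" using a c by (simp add: field_simps)
      then show ?thesis using a c pos[of "f y"] p_pos[of "f y"] f[OF y]
        by (simp add: q_def field_simps)
    qed
    finally show ?thesis .
  qed
  have q_deriv: "(q has_real_derivative - y / 2 * (q y / p (f y))) (at y)" if y: "y < a" for y
  proof -
    have "((\<lambda>y. sol c (f y)) has_real_derivative R1 (f y) * (- q y / p (f y))) (at y)"
      by (rule DERIV_chain2[OF R1[OF f(1)[OF y]] f_deriv[OF y]])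
    from DERIV_cmult[OF this, of "a / 2"]
    have "(q has_real_derivative a / 2 * (R1 (f y) * (- q y / p (f y)))) (at y)"
      by (simp add: q_def[abs_def])
    also have "a / 2 * (R1 (f y) * (- q y / p (f y))) = g (f y) / 2 * (- q y / p (f y))"
      by (simp add: g_def)
    finally show ?thesis using f(2)[OF y] by simp
  qed
  have lim_a: "(f \<longlongrightarrow> 0) (at_left a)"
  proof (rule tendstoI)
    fix e :: real assume e: "e > 0"
    define s where "s = min (e / 2) (U / 2)"
    have s: "s \<in> {0<..<U}" "s < e" using e U by (auto simp: s_def)
    have "eventually (\<lambda>y. y \<in> {g s<..<a}) (at_left a)"
      using g_less_a[OF s(1)] by (rule eventually_at_left_real)
    then show "eventually (\<lambda>y. dist (f y) 0 < e) (at_left a)"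
    proof eventually_elim
      case (elim y)
      then show ?case using f_less[of s y] f(1)[of y] s by auto
    qed
  qed
  have lim_bot: "(f \<longlongrightarrow> U) at_bot"
  proof (rule tendstoI)
    fix e :: real assume e: "e > 0"
    define s where "s = U - min (e / 2) (U / 2)"
    have s: "s \<in> {0<..<U}" "U - e < s" using e U by (auto simp: s_def)
    have "eventually (\<lambda>y. y < g s) at_bot" by (rule eventually_gt_at_bot)
    then show "eventually (\<lambda>y. dist (f y) U < e) at_bot"
    proof eventually_elim
      case (elim y)
      then show ?case using f_greater[of y s] f(1)[of y] s g_less_a[OF s(1)] by (auto simp: dist_real_def)
    qed
  qed
  have "sol c 0 = V"
  proof -
    have "potential (sol c) 0 = (LINT r:{0..U}|lborel. 0)"
      unfolding potential_def set_lebesgue_integral_def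
      by (rule Bochner_Integration.integral_cong) (auto simp: indicator_def)
    then show ?thesis using sol_eq[of c 0] c U by (simp add: set_lebesgue_integral_def)
  qed
  moreover have "((\<lambda>y. sol c (f y)) \<longlongrightarrow> sol c 0) (at_left a)"
  proof (rule continuous_on_tendsto_compose[OF sol_continuous[OF c(1)] lim_a])
    have "eventually (\<lambda>y. y \<in> {a - 1<..<a}) (at_left a)" by (rule eventually_at_left_real) simp
    then show "eventually (\<lambda>y. f y \<in> {0..U}) (at_left a)"
      by eventually_elim (use f(1) in fastforce)
  qed (use U in auto)
  ultimately have q_lim: "(q \<longlongrightarrow> a * V / 2) (at_left a)"
    unfolding q_def[abs_def] by (auto intro!: tendsto_eq_intros)
  show ?thesis
  proof (rule that[of a "a * V / (2 * U)" f q "a / 2 * (V + U)", OF a(1) _ _ _ f_deriv q_deriv _ _ _ lim_bot lim_a q_lim])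
    show "a * V / (2 * U) > 0" using a U V by simp
    fix x
    show "f x = - V" if "x \<ge> a" using that by (simp add: f_def)
    assume x: "x < a"
    have fx: "f x \<in> {0<..<U}" by (rule f(1)[OF x])
    then show "0 < f x" "f x < U" by auto
    show "0 < q x" using a pos[of "f x"] fx by (simp add: q_def)
    have "a / 2 * chord (f x) \<le> q x"
      unfolding q_def using sol_ge_chord[OF c, of "f x"] fx a by (intro mult_left_mono) auto
    then show "a * V / (2 * U) * (U - f x) \<le> q x" using U by (simp add: chord_def field_simps)
    have "sol c (f x) \<le> V + f x"
      using sol_eq[of c "f x"] c fx potential_nonneg[of "f x" "sol c"] by simp
    then show "q x \<le> a / 2 * (V + U)" unfolding q_def using fx a by (intro mult_left_mono) auto
  qed
qed

end

section \<open>The similarity profile\<close>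

lemma locally_lborel_integrable_bounded:
  assumes "g \<in> borel_measurable borel" "\<And>x. \<bar>g x\<bar> \<le> B"
  shows "locally_lborel_integrable g"
  unfolding locally_lborel_integrable_def set_integrable_def
proof (intro allI)
  fix a b :: real
  show "integrable lborel (\<lambda>x. indicat_real {a..b} x *\<^sub>R g x)"
  proof (rule Bochner_Integration.integrable_bound)
    show "integrable lborel (\<lambda>x. B * indicat_real {a..b} x)" by simp
    show "(\<lambda>x. indicat_real {a..b} x *\<^sub>R g x) \<in> borel_measurable lborel" using assms(1) by simp
    show "AE x in lborel. norm (indicat_real {a..b} x *\<^sub>R g x) \<le> norm (B * indicat_real {a..b} x)"
    proof (rule AE_I2)
      fix x
      show "norm (indicat_real {a..b} x *\<^sub>R g x) \<le> norm (B * indicat_real {a..b} x)"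
        using assms(2)[of x] by (auto simp: indicator_def)
    qed
  qed
qed

text \<open>One exceptional point is allowed because the functions treated later have a kink at the
  interface \<open>a\<close> while staying continuous there.\<close>

lemma primitive_if_DERIV_except:
  fixes F g :: "real \<Rightarrow> real"
  assumes F: "continuous_on UNIV F" and deriv: "\<And>x. x \<noteq> c \<Longrightarrow> (F has_real_derivative g x) (at x)"
    and g: "locally_lborel_integrable g"
  shows "primitive F g"
  unfolding primitive_def
proof (intro allI impI)
  fix a b :: real assume ab: "a \<le> b"
  have "(g has_integral (F b - F a)) {a..b}"
    by (rule fundamental_theorem_of_calculus_interior_strong[of "{c}"])
       (use ab deriv in \<open>auto simp: has_real_derivative_iff_has_vector_derivative intro: continuous_on_subset[OF F]\<close>)
  then show "F b - F a = (LINT x:{a..b}|lborel. g x)"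
    using g set_borel_integral_eq_integral(2)[of "{a..b}" g]
    by (simp add: locally_lborel_integrable_def integral_unique)
qed

lemma primitive_scaled:
  assumes F: "primitive F g" and r: "r > 0"
  shows "primitive (\<lambda>x. F (x / r)) (\<lambda>x. g (x / r) / r)"
  unfolding primitive_def
proof (intro allI impI)
  fix a b :: real assume ab: "a \<le> b"
  have "(LINT x:{a..b}|lborel. g (x / r) / r) = (LINT x|lborel. (indicat_real {a/r..b/r} (0 + (1/r) * x) *\<^sub>R g (0 + (1/r) * x)) / r)"
    unfolding set_lebesgue_integral_def using r
    by (intro Bochner_Integration.integral_cong) (auto simp: indicator_def field_simps)
  also have "\<dots> = (LINT x|lborel. indicat_real {a/r..b/r} (0 + (1/r) * x) *\<^sub>R g (0 + (1/r) * x)) / r"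
    by simp
  also have "\<dots> = (LINT x:{a/r..b/r}|lborel. g x)"
    unfolding set_lebesgue_integral_def
    using lborel_integral_real_affine[of "1/r" "\<lambda>x. indicat_real {a/r..b/r} x *\<^sub>R g x" 0] r by simp
  also have "\<dots> = F (b / r) - F (a / r)"
    using F ab r by (simp add: primitive_def divide_right_mono)
  finally show "F (b / r) - F (a / r) = (LINT x:{a..b}|lborel. g (x / r) / r)" by simp
qed

lemma primitive_diff:
  assumes "primitive F f" "primitive G g" "locally_lborel_integrable f" "locally_lborel_integrable g"
  shows "primitive (\<lambda>x. F x - G x) (\<lambda>x. f x - g x)"
  using assms by (auto simp: primitive_def locally_lborel_integrable_def set_integral_diff algebra_simps)

lemma weak_deriv_if_primitive:
  assumes F: "primitive F g" and g: "locally_lborel_integrable g" and g_meas: "g \<in> borel_measurable borel"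
  shows "weak_deriv F g"
  unfolding weak_deriv_def
proof (intro conjI allI impI)
  have F_cont: "continuous_on UNIV F" by (rule primitive_continuous_on[OF g F])
  have F_meas: "F \<in> borel_measurable borel" by (rule borel_measurable_continuous_onI[OF F_cont])
  show "locally_integrable F"
    using locally_lborel_integrable_continuous[OF F_cont] F_meas
    by (auto simp: locally_integrable_def locally_lborel_integrable_def set_integrable_def integrable_completion)
  show "locally_integrable g"
    using g g_meas
    by (auto simp: locally_integrable_def locally_lborel_integrable_def set_integrable_def integrable_completion)
  fix \<psi> :: "real \<Rightarrow> real" assume "smooth \<psi> \<and> (\<exists>J. \<forall>x. J < \<bar>x\<bar> \<longrightarrow> \<psi> x = 0)"
  then obtain J' where smooth: "smooth \<psi>" and J': "\<And>x. J' < \<bar>x\<bar> \<Longrightarrow> \<psi> x = 0" by auto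
  \<comment> \<open>The added 1 places \<open>J\<close> strictly outside the support: every point
    with |x| >= J has a neighbourhood on which \<open>\<psi>\<close> vanishes, so the derivative
    vanishes there too.\<close>
  define J where "J = \<bar>J'\<bar> + 1"
  have J: "\<psi> x = 0" "deriv \<psi> x = 0" if "\<bar>x\<bar> \<ge> J" for x
  proof -
    show "\<psi> x = 0" using that J' by (auto simp: J_def)
    have "(\<psi> has_real_derivative 0) (at x)"
    proof (rule has_field_derivative_transform_within_open[where f = "\<lambda>_. 0" and S = "{y. J' < \<bar>y\<bar>}"])
      show "open {y. J' < \<bar>y\<bar>}" by (intro open_Collect_less continuous_intros)
    qed (use J' that in \<open>auto simp: J_def\<close>)
    then show "deriv \<psi> x = 0" by (rule DERIV_imp_deriv)
  qed
  have \<psi>_cont: "continuous_on UNIV \<psi>"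
    using smooth_deriv[OF smooth] by (meson DERIV_isCont continuous_at_imp_continuous_on)
  have [measurable]: "F \<in> borel_measurable borel" "g \<in> borel_measurable borel" "\<psi> \<in> borel_measurable borel"
      "deriv \<psi> \<in> borel_measurable borel"
    using F_meas g_meas \<psi>_cont smooth_continuous_deriv[OF smooth] borel_measurable_continuous_onI by auto
  have I: "set_integrable lborel {- J..J} (\<lambda>x. g x * \<psi> x)" "set_integrable lborel {- J..J} (\<lambda>x. F x * deriv \<psi> x)"
    using locally_lborel_integrable_mult_continuous[OF g \<psi>_cont]
      locally_lborel_integrable_mult_continuous[OF locally_lborel_integrable_continuous[OF F_cont] smooth_continuous_deriv[OF smooth]]
    by (auto simp: locally_lborel_integrable_def)
  have "(LINT x:{- J..J}|lborel. g x * \<psi> x + F x * deriv \<psi> x) = F J * \<psi> J - F (- J) * \<psi> (- J)"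
    by (intro primitive_by_parts F g locally_lborel_integrable_continuous smooth_continuous_deriv smooth
        primitive_if_DERIV smooth_deriv) (simp add: J_def)
  then have "(LINT x:{- J..J}|lborel. g x * \<psi> x) + (LINT x:{- J..J}|lborel. F x * deriv \<psi> x) = 0"
    using I J(1)[of J] J(1)[of "- J"] by (simp add: set_integral_add J_def)
  moreover have "(LINT x:{- J..J}|lborel. g x * \<psi> x) = (LINT x|lborel. g x * \<psi> x)"
      "(LINT x:{- J..J}|lborel. F x * deriv \<psi> x) = (LINT x|lborel. F x * deriv \<psi> x)"
  proof -
    have "\<bar>x\<bar> \<ge> J" if "x \<notin> {- J..J}" for x using that by auto
    then show "(LINT x:{- J..J}|lborel. g x * \<psi> x) = (LINT x|lborel. g x * \<psi> x)"
      "(LINT x:{- J..J}|lborel. F x * deriv \<psi> x) = (LINT x|lborel. F x * deriv \<psi> x)"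
      unfolding set_lebesgue_integral_def using J by (intro Bochner_Integration.integral_cong; auto simp: indicator_def)+
  qed
  ultimately show "(LINT x|lebesgue. F x * deriv \<psi> x) = - (LINT x|lebesgue. g x * \<psi> x)"
    by (simp add: integral_completion)
qed

lemma continuous_glue_left:
  fixes h :: "real \<Rightarrow> real"
  assumes left: "\<And>x. x < a \<Longrightarrow> isCont h x" and lim: "(h \<longlongrightarrow> h a) (at_left a)"
    and right: "continuous_on {a..} h"
  shows "continuous_on UNIV h"
proof -
  have "isCont h x" for x
  proof (cases x a rule: linorder_cases)
    case equal
    have "at_right a = at a within {a<..}" by simp
    have "(h \<longlongrightarrow> h a) (at_right a)"
      using right by (auto simp: continuous_on intro: tendsto_within_subset)
    then show ?thesis
      unfolding equal continuous_at using lim by (simp add: filterlim_split_at)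
  next
    case greater
    have "at x within {a..} = at x" by (rule at_within_interior) (use greater in simp)
    then show ?thesis using right greater by (auto simp: continuous_on_eq_continuous_within dest!: bspec[of _ _ x])
  qed (use left in auto)
  then show ?thesis by (simp add: continuous_at_imp_continuous_on)
qed

text \<open>The product \<open>h x * exp (- c * x)\<close> is nondecreasing; its values at
  \<open>x\<close> and \<open>b\<close> are compared.\<close>

lemma exp_decay_at_bot:
  fixes h h' :: "real \<Rightarrow> real"
  assumes deriv: "\<And>x. x \<le> b \<Longrightarrow> (h has_real_derivative h' x) (at x)"
    and ge: "\<And>x. x \<le> b \<Longrightarrow> c * h x \<le> h' x" and x: "x \<le> b"
  shows "h x \<le> h b * exp (c * (x - b))"
proof -
  have "h x * exp (- c * x) \<le> h b * exp (- c * b)"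
  proof (rule DERIV_nonneg_imp_nondecreasing[where f = "\<lambda>x. h x * exp (- c * x)", OF x])
    fix y assume y: "x \<le> y" "y \<le> b"
    have "((\<lambda>x. h x * exp (- c * x)) has_real_derivative (h' y - c * h y) * exp (- c * y)) (at y)"
      using deriv[OF y(2)] by (auto intro!: derivative_eq_intros simp: algebra_simps)
    moreover have "(h' y - c * h y) * exp (- c * y) \<ge> 0" using ge[OF y(2)] by simp
    ultimately show "\<exists>z. ((\<lambda>x. h x * exp (- c * x)) has_real_derivative z) (at y) \<and> 0 \<le> z" by blast
  qed
  then have "(h x * exp (- c * x)) * exp (c * x) \<le> (h b * exp (- c * b)) * exp (c * x)"
    by (intro mult_right_mono) auto
  moreover have "(h x * exp (- c * x)) * exp (c * x) = h x" by (simp add: mult.assoc flip: exp_add)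
  moreover have "(h b * exp (- c * b)) * exp (c * x) = h b * exp (c * (x - b))"
    by (simp add: mult.assoc algebra_simps flip: exp_add)
  ultimately show ?thesis by linarith
qed

lemma integrable_exp_neg_abs:
  assumes c: "c > 0"
  shows "integrable lborel (\<lambda>x :: real. exp (- c * \<bar>x\<bar>))"
proof -
  have "(\<lambda>x. exp (- c * x)) absolutely_integrable_on {0..}"
    using has_integral_exp_minus_to_infinity[OF c, of 0]
    by (intro nonnegative_absolutely_integrable_1) (auto simp: integrable_on_def)
  then have 1: "integrable lborel (\<lambda>x. indicat_real {0..} x *\<^sub>R exp (- c * x))"
    by (simp add: set_integrable_def integrable_completion)
  then have 2: "integrable lborel (\<lambda>x. indicat_real {0..} (0 + - 1 * x) *\<^sub>R exp (- c * (0 + - 1 * x)))"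
    by (rule lborel_integrable_real_affine) simp
  show ?thesis
    by (rule Bochner_Integration.integrable_bound[OF Bochner_Integration.integrable_add[OF 1 2]])
       (auto simp: indicator_def)
qed

text \<open>The x-derivative of the similarity solution is of size 1 / sqrt t; integrability of this
  rate at t = 0 carries the estimates down to the initial time.\<close>

lemma set_integrable_inverse_sqrt: "set_integrable lborel {0..T} (\<lambda>t. 1 / sqrt t)"
proof (cases "T \<ge> 0")
  case True
  have "((\<lambda>t. 1 / sqrt t) has_integral (2 * sqrt T - 2 * sqrt 0)) {0..T}"
    by (rule fundamental_theorem_of_calculus_interior)
       (use True in \<open>auto simp: has_real_derivative_iff_has_vector_derivative[symmetric] field_simps
         intro!: continuous_intros derivative_eq_intros\<close>)
  then have "(\<lambda>t. 1 / sqrt t) absolutely_integrable_on {0..T}"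
    by (intro nonnegative_absolutely_integrable_1) (auto simp: integrable_on_def)
  then show ?thesis by (simp add: set_integrable_def integrable_completion)
qed (simp add: set_integrable_def)

definition Dfun' :: "(real \<Rightarrow> real) \<Rightarrow> real \<Rightarrow> real" where
  "Dfun' \<phi> s = (if s \<ge> 0 then deriv \<phi> s else 0)"

section \<open>The truncated nonlinearity\<close>

locale degenerate_diffusion =
  fixes \<phi> :: "real \<Rightarrow> real"
  assumes phi_DERIV: "\<And>s. (\<phi> has_real_derivative deriv \<phi> s) (at s)"
    and phi'_cont: "continuous_on UNIV (deriv \<phi>)"
    and phi_0: "\<phi> 0 = 0" and phi'_0: "deriv \<phi> 0 = 0"
    and phi'_mono: "\<And>s t. 0 \<le> s \<Longrightarrow> s \<le> t \<Longrightarrow> deriv \<phi> s \<le> deriv \<phi> t"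
    and phi'_pos: "\<And>s. 0 < s \<Longrightarrow> 0 < deriv \<phi> s"
begin

lemma phi'_nonneg: "0 \<le> s \<Longrightarrow> 0 \<le> deriv \<phi> s"
  using phi'_pos[of s] phi'_0 by (cases "s = 0") auto

text \<open>The two branches meet at 0 with common value 0 and common slope 0, so truncation at 0
  does not destroy differentiability.\<close>

lemma Dfun_DERIV: "(Dfun \<phi> has_real_derivative Dfun' \<phi> s) (at s)"
proof (cases s "0 :: real" rule: linorder_cases)
  case less
  have "((\<lambda>_. 0) has_real_derivative 0) (at s)" by simp
  then have "(Dfun \<phi> has_real_derivative 0) (at s)"
    by (rule has_field_derivative_transform_within_open[of _ _ _ "{..<0}"]) (use less in \<open>auto simp: Dfun_def\<close>)
  then show ?thesis using less by (simp add: Dfun'_def)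
next
  case equal
  have "(Dfun \<phi> has_real_derivative 0) (at 0)"
    unfolding has_field_derivative_iff
  proof (rule tendstoI)
    fix e :: real assume "e > 0"
    have "((\<lambda>y. (\<phi> y - \<phi> 0) / (y - 0)) \<longlongrightarrow> 0) (at 0)"
      using phi_DERIV[of 0] unfolding has_field_derivative_iff phi'_0 .
    from tendstoD[OF this \<open>e > 0\<close>]
    show "\<forall>\<^sub>F y in at 0. dist ((Dfun \<phi> y - Dfun \<phi> 0) / (y - 0)) 0 < e"
      by eventually_elim (use \<open>e > 0\<close> in \<open>auto simp: Dfun_def phi_0\<close>)
  qed
  then show ?thesis using equal by (simp add: Dfun'_def phi'_0)
next
  case greater
  have "(Dfun \<phi> has_real_derivative deriv \<phi> s) (at s)"
    by (rule has_field_derivative_transform_within_open[OF phi_DERIV, of "{0<..}"])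
       (use greater in \<open>auto simp: Dfun_def\<close>)
  then show ?thesis using greater by (simp add: Dfun'_def)
qed

lemma continuous_Dfun: "continuous_on X (Dfun \<phi>)"
  using Dfun_DERIV by (meson DERIV_isCont continuous_at_imp_continuous_on)

lemma continuous_Dfun': "continuous_on UNIV (Dfun' \<phi>)"
proof -
  have "Dfun' \<phi> = (\<lambda>s. deriv \<phi> (max s 0))" by (auto simp: Dfun'_def phi'_0 max_def)
  moreover have "continuous_on UNIV (\<lambda>s. deriv \<phi> (max s 0))"
    by (intro continuous_on_compose2[OF phi'_cont] continuous_intros) auto
  ultimately show ?thesis by simp
qed

lemma borel_Dfun [measurable]: "Dfun \<phi> \<in> borel_measurable borel"
  by (rule borel_measurable_continuous_onI[OF continuous_Dfun])

lemma Dfun_mono: "s \<le> t \<Longrightarrow> Dfun \<phi> s \<le> Dfun \<phi> t"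
  using Dfun_DERIV phi'_nonneg
  by (elim DERIV_nonneg_imp_nondecreasing) (metis Dfun'_def order_refl)

end

section \<open>Profile, flux and potential across the interface\<close>

locale similarity_profile = degenerate_diffusion \<phi> for \<phi> :: "real \<Rightarrow> real" +
  fixes f q :: "real \<Rightarrow> real" and U V a k M :: real
  assumes U: "U > 0" and V: "V > 0" and a: "a > 0" and k: "k > 0"
    and f_pos: "\<And>x. x < a \<Longrightarrow> 0 < f x" and f_less: "\<And>x. x < a \<Longrightarrow> f x < U"
    and f_DERIV: "\<And>x. x < a \<Longrightarrow> (f has_real_derivative - q x / deriv \<phi> (f x)) (at x)"
    and q_DERIV: "\<And>x. x < a \<Longrightarrow> (q has_real_derivative - x / 2 * (q x / deriv \<phi> (f x))) (at x)"
    and q_pos: "\<And>x. x < a \<Longrightarrow> 0 < q x" and q_ge: "\<And>x. x < a \<Longrightarrow> k * (U - f x) \<le> q x"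
    and q_le: "\<And>x. x < a \<Longrightarrow> q x \<le> M"
    and f_bot: "(f \<longlongrightarrow> U) at_bot" and f_left: "(f \<longlongrightarrow> 0) (at_left a)"
    and q_left: "(q \<longlongrightarrow> a * V / 2) (at_left a)"
    and f_right: "\<And>x. x \<ge> a \<Longrightarrow> f x = - V"
begin

text \<open>The derivative of \<open>Dfun \<phi> (f x)\<close> away from the interface: on the left
  it is \<phi>'(f) f' = - q, on the right the composition is constant. It jumps at \<open>a\<close>,
  where its value is a convention.\<close>

definition G :: "real \<Rightarrow> real" where
  "G x = (if x < a then - q x else 0)"

text \<open>\<open>\<surd>t P (x / \<surd>t)\<close> has \<open>x\<close>-derivative \<open>f (x / \<surd>t)\<close> and \<open>t\<close>-derivative
  \<open>G (x / \<surd>t) / \<surd>t\<close>.\<close>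

definition P :: "real \<Rightarrow> real" where
  "P x = 2 * G x + x * f x"

abbreviation "F \<equiv> \<lambda>x. Dfun \<phi> (f x)"

lemma M_pos: "M > 0"
  using q_pos[of 0] q_le[of 0] a by linarith

lemma borel_left_piece:
  fixes h :: "real \<Rightarrow> real"
  assumes "\<And>x. x < a \<Longrightarrow> isCont h x" "\<And>x. x \<ge> a \<Longrightarrow> h x = c"
  shows "h \<in> borel_measurable borel"
proof -
  have "continuous_on {..<a} h" using assms(1) by (simp add: continuous_at_imp_continuous_on)
  then have [measurable]: "(\<lambda>x. indicator {..<a} x *\<^sub>R h x) \<in> borel_measurable borel"
    by (intro borel_measurable_continuous_on_indicator) auto
  have "h = (\<lambda>x. indicator {..<a} x *\<^sub>R h x + indicator {a..} x *\<^sub>R c)"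
    using assms(2) by (auto simp: indicator_def fun_eq_iff not_less)
  moreover have "(\<lambda>x. indicator {..<a} x *\<^sub>R h x + indicator {a..} x *\<^sub>R c) \<in> borel_measurable borel"
    by measurable
  ultimately show ?thesis by metis
qed

lemma borel_f [measurable]: "f \<in> borel_measurable borel"
  by (rule borel_left_piece[OF DERIV_isCont[OF f_DERIV] f_right])

lemma G_isCont: "x < a \<Longrightarrow> isCont G x"
proof -
  assume x: "x < a"
  have "(G has_real_derivative - (- x / 2 * (q x / deriv \<phi> (f x)))) (at x)"
    by (rule has_field_derivative_transform_within_open[OF DERIV_minus[OF q_DERIV[OF x]], of "{..<a}"])
       (use x in \<open>auto simp: G_def\<close>)
  then show ?thesis by (rule DERIV_isCont)
qed

lemma borel_G [measurable]: "G \<in> borel_measurable borel"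
  by (rule borel_left_piece[OF G_isCont]) (auto simp: G_def)

lemma f_bounded: "\<bar>f x\<bar> \<le> max U V"
  using f_pos[of x] f_less[of x] f_right[of x] U V by (cases "x < a") auto

lemma G_bounded: "\<bar>G x\<bar> \<le> M"
  using q_pos[of x] q_le[of x] M_pos by (auto simp: G_def)

lemma locally_lborel_integrable_f: "locally_lborel_integrable f"
  by (rule locally_lborel_integrable_bounded[OF borel_f f_bounded])

lemma locally_lborel_integrable_G: "locally_lborel_integrable G"
  by (rule locally_lborel_integrable_bounded[OF borel_G G_bounded])

lemma eventually_at_left_a: "eventually (\<lambda>x. x < a) (at_left a)"
  by (simp add: eventually_at_filter)

lemma G_left: "(G \<longlongrightarrow> - (a * V / 2)) (at_left a)"
  using eventually_at_left_a
  by (intro Lim_transform_eventually[OF tendsto_minus[OF q_left]]) (auto elim!: eventually_mono simp: G_def)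

text \<open>\<open>f\<close> jumps from 0 to -V at \<open>a\<close>, but \<open>Dfun \<phi>\<close>
  sends both values to 0, so the composition is continuous across the interface.\<close>

lemma primitive_F: "primitive F G"
proof (rule primitive_if_DERIV_except[OF _ _ locally_lborel_integrable_G])
  have "isCont F x" if "x < a" for x
    using DERIV_isCont[OF f_DERIV[OF that]] DERIV_isCont[OF Dfun_DERIV] by (rule isCont_o2)
  moreover have "(F \<longlongrightarrow> Dfun \<phi> 0) (at_left a)"
    by (rule isCont_tendsto_compose[OF DERIV_isCont[OF Dfun_DERIV] f_left])
  moreover have "continuous_on {a..} F"
    by (rule continuous_on_eq[of _ "\<lambda>_. 0"]) (use f_right V in \<open>auto simp: Dfun_def\<close>)
  ultimately show "continuous_on UNIV F"
    using f_right[of a] V by (intro continuous_glue_left[where a = a]) (auto simp: Dfun_def phi_0)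
  show "(F has_real_derivative G x) (at x)" if "x \<noteq> a" for x
  proof (cases "x < a")
    case True
    have "(F has_real_derivative Dfun' \<phi> (f x) * (- q x / deriv \<phi> (f x))) (at x)"
      by (rule DERIV_chain2[OF Dfun_DERIV f_DERIV[OF True]])
    also have "Dfun' \<phi> (f x) * (- q x / deriv \<phi> (f x)) = G x"
      using True phi'_pos[OF f_pos[OF True]] f_pos[OF True] by (simp add: Dfun'_def G_def)
    finally show ?thesis .
  next
    case False
    then have "x > a" using that by simp
    have "(F has_real_derivative 0) (at x)"
      by (rule has_field_derivative_transform_within_open[OF DERIV_const[of 0], of "{a<..}"])
         (use \<open>x > a\<close> f_right V in \<open>auto simp: Dfun_def\<close>)
    then show ?thesis using False by (simp add: G_def)
  qed
qed

text \<open>At \<open>a\<close> the left limit of \<open>P\<close> is twice - a V / 2, and the right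
  value is a times -V. Their agreement is exactly the flux condition at the free boundary, a
  Rankine-Hugoniot relation. Away from \<open>a\<close> the derivative is 2 G' + f + x f', and G' =
  - x f' / 2 by the profile equation.\<close>

lemma primitive_P: "primitive P f"
proof (rule primitive_if_DERIV_except[OF _ _ locally_lborel_integrable_f])
  have "isCont P x" if "x < a" for x
    unfolding P_def[abs_def] using G_isCont[OF that] DERIV_isCont[OF f_DERIV[OF that]]
    by (intro continuous_intros)
  moreover have "(P \<longlongrightarrow> 2 * (- (a * V / 2)) + a * 0) (at_left a)"
    unfolding P_def[abs_def] by (intro tendsto_intros G_left f_left)
  moreover have "continuous_on {a..} P"
    by (rule continuous_on_eq[of _ "\<lambda>x. - V * x"]) (auto simp: P_def G_def f_right intro!: continuous_intros)
  ultimately show "continuous_on UNIV P"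
    using f_right[of a] by (intro continuous_glue_left[where a = a]) (auto simp: P_def G_def)
  show "(P has_real_derivative f x) (at x)" if "x \<noteq> a" for x
  proof (cases "x < a")
    case True
    have "((\<lambda>x. 2 * - q x + x * f x) has_real_derivative
        2 * - (- x / 2 * (q x / deriv \<phi> (f x))) + (1 * f x + (- q x / deriv \<phi> (f x)) * x)) (at x)"
      by (intro DERIV_add DERIV_cmult DERIV_minus DERIV_mult DERIV_ident q_DERIV f_DERIV True)
    also have "2 * - (- x / 2 * (q x / deriv \<phi> (f x))) + (1 * f x + (- q x / deriv \<phi> (f x)) * x) = f x"
      by (simp add: field_simps)
    finally show ?thesis
      by (rule has_field_derivative_transform_within_open[of _ _ _ "{..<a}"])
         (use True in \<open>auto simp: P_def G_def\<close>)
  next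
    case False
    then have "x > a" using that by simp
    have "((\<lambda>x. - V * x) has_real_derivative - V) (at x)" by (auto intro!: derivative_eq_intros)
    then show ?thesis
      by (rule has_field_derivative_transform_within_open[of _ _ _ "{a<..}", THEN DERIV_cong])
         (use \<open>x > a\<close> f_right in \<open>auto simp: P_def G_def\<close>)
  qed
qed

text \<open>Since \<phi>'(f) is at most \<phi>'(U), the equations give (U - f)' >= (k / Pm) (U - f),
  and for x <= -1 also q' >= q / (2 Pm). Both quantities therefore decay exponentially to the left.
  Between -1 and \<open>a\<close> they are merely bounded, and beyond \<open>a\<close> the flux is
  zero.\<close>

lemma exponential_tails:
  obtains C c where "C > 0" "c > 0" "\<And>x. \<bar>G x\<bar> \<le> C * exp (- c * \<bar>x\<bar>)"
    "\<And>x. x < a \<Longrightarrow> U - f x \<le> C * exp (- c * \<bar>x\<bar>)"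
proof -
  define Pm where "Pm = deriv \<phi> U"
  have Pm: "Pm > 0" using phi'_pos[OF U] by (simp add: Pm_def)
  define c where "c = min (k / Pm) (1 / (2 * Pm))"
  have c: "c > 0" "c \<le> k / Pm" "c \<le> 1 / (2 * Pm)" using k Pm by (auto simp: c_def)
  have phi'_f: "0 < deriv \<phi> (f x)" "deriv \<phi> (f x) \<le> Pm" if "x < a" for x
    using phi'_pos[of "f x"] phi'_mono[of "f x" U] f_pos[OF that] f_less[OF that] by (auto simp: Pm_def)
  have tail_f: "U - f x \<le> (U - f (- 1)) * exp (c * (x - - 1))" if "x \<le> - 1" for x
  proof (rule exp_decay_at_bot[OF _ _ that])
    fix y :: real assume "y \<le> - 1"
    then have y: "y < a" using a by simp
    show "((\<lambda>x. U - f x) has_real_derivative q y / deriv \<phi> (f y)) (at y)"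
      using f_DERIV[OF y] by (auto intro!: derivative_eq_intros)
    have "c * (U - f y) \<le> k / Pm * (U - f y)" using c f_less[OF y] by (intro mult_right_mono) auto
    also have "\<dots> \<le> q y / Pm" using q_ge[OF y] Pm by (simp add: divide_right_mono)
    also have "\<dots> \<le> q y / deriv \<phi> (f y)" using phi'_f[OF y] q_pos[OF y] by (intro divide_left_mono) auto
    finally show "c * (U - f y) \<le> q y / deriv \<phi> (f y)" .
  qed
  have tail_q: "q x \<le> q (- 1) * exp (c * (x - - 1))" if "x \<le> - 1" for x
  proof (rule exp_decay_at_bot[OF _ _ that])
    fix y :: real assume y1: "y \<le> - 1"
    then have y: "y < a" using a by simp
    show "(q has_real_derivative - y / 2 * (q y / deriv \<phi> (f y))) (at y)" by (rule q_DERIV[OF y])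
    have "c * q y \<le> 1 / (2 * Pm) * q y" using c q_pos[OF y] by (intro mult_right_mono) auto
    also have "\<dots> = 1 / 2 * (q y / Pm)" by simp
    also have "\<dots> \<le> - y / 2 * (q y / deriv \<phi> (f y))"
      using y1 phi'_f[OF y] q_pos[OF y] by (intro mult_mono divide_left_mono) auto
    finally show "c * q y \<le> - y / 2 * (q y / deriv \<phi> (f y))" .
  qed
  \<comment> \<open>The factor \<open>exp (c * (a + 1))\<close> outweighs the decay factor for x
    between -1 and \<open>a\<close>, where only the crude bounds \<open>M\<close> and
    \<open>U\<close> are at hand.\<close>
  define C where "C = (M + U) * exp (c * (a + 1))"
  have MU: "M + U \<le> C * exp (- c * \<bar>x\<bar>)" if "- 1 \<le> x" "x < a" for x
  proof -
    have "\<bar>x\<bar> \<le> a + 1" using that a by linarith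
    then have "1 \<le> exp (c * (a + 1) - c * \<bar>x\<bar>)" using c by (simp add: mult_left_mono)
    then have "(M + U) * 1 \<le> (M + U) * exp (c * (a + 1) - c * \<bar>x\<bar>)" using M_pos U by (intro mult_left_mono) auto
    then show ?thesis by (simp add: C_def mult.assoc flip: exp_add)
  qed
  have MU': "(M + U) * exp (c * (x - - 1)) \<le> C * exp (- c * \<bar>x\<bar>)" if "x \<le> - 1" for x
  proof -
    have "c * (x - - 1) \<le> c * (a + 1) + (- c * \<bar>x\<bar>)" using that a c by (simp add: algebra_simps)
    then have "exp (c * (x - - 1)) \<le> exp (c * (a + 1)) * exp (- c * \<bar>x\<bar>)" by (simp flip: exp_add)
    then show ?thesis using M_pos U unfolding C_def mult.assoc by (intro mult_left_mono) auto
  qed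
  show ?thesis
  proof (rule that[of C c])
    show C: "C > 0" using M_pos U by (simp add: C_def)
    fix x
    have G_le: "\<bar>G x\<bar> \<le> C * exp (- c * \<bar>x\<bar>)" and f_le: "U - f x \<le> C * exp (- c * \<bar>x\<bar>)" if x: "x < a"
    proof -
      have *: "\<bar>G x\<bar> = q x" using x q_pos[OF x] by (simp add: G_def)
      show "\<bar>G x\<bar> \<le> C * exp (- c * \<bar>x\<bar>)"
      proof (cases "x \<le> - 1")
        case True
        have "q (- 1) * exp (c * (x - - 1)) \<le> (M + U) * exp (c * (x - - 1))"
          using q_le[of "- 1"] a U by (intro mult_right_mono) auto
        then show ?thesis unfolding * using tail_q[OF True] MU'[OF True] by linarith
      next
        case False
        then show ?thesis unfolding * using MU[of x] x q_le[OF x] U by linarith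
      qed
      show "U - f x \<le> C * exp (- c * \<bar>x\<bar>)"
      proof (cases "x \<le> - 1")
        case True
        have "(U - f (- 1)) * exp (c * (x - - 1)) \<le> (M + U) * exp (c * (x - - 1))"
          using f_pos[of "- 1"] a M_pos by (intro mult_right_mono) auto
        then show ?thesis using tail_f[OF True] MU'[OF True] by linarith
      next
        case False
        then show ?thesis using MU[of x] x f_pos[OF x] M_pos by linarith
      qed
    qed
    show "\<bar>G x\<bar> \<le> C * exp (- c * \<bar>x\<bar>)"
      using G_le C by (cases "x < a") (auto simp: G_def)
    show "U - f x \<le> C * exp (- c * \<bar>x\<bar>)" if "x < a" by (rule f_le[OF that])
  qed (rule c)
qed

end

section \<open>The self-similar function in the function spaces\<close>

lemma borel_fst_real [measurable]: "(\<lambda>p :: real \<times> real. fst p) \<in> borel_measurable borel"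
  and borel_snd_real [measurable]: "(\<lambda>p :: real \<times> real. snd p) \<in> borel_measurable borel"
  by (intro borel_measurable_continuous_onI continuous_intros)+

lemma borel_lebesgue_on: "h \<in> borel_measurable borel \<Longrightarrow> h \<in> borel_measurable (lebesgue_on S)"
  by (intro measurable_restrict_space1 measurable_completion) simp

lemma exp_power2: "(exp (- c * y))\<^sup>2 = exp (- (2 * c) * (y :: real))"
  by (simp add: power2_eq_square mult.assoc flip: exp_add)

lemma QT_borel [measurable]: "QT T \<in> sets borel"
  unfolding QT_def by (intro borel_open open_Times) auto

text \<open>What existence and uniqueness share: the nonlinearity and the reference function,
  without any profile.\<close>

locale far_field = degenerate_diffusion \<phi> for \<phi> :: "real \<Rightarrow> real" +
  fixes what :: "real \<Rightarrow> real" and U V T :: real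
  assumes U: "U > 0" and V: "V > 0" and T: "T > 0" and what_smooth: "smooth what"
    and what_left: "\<And>x. x < -1 \<Longrightarrow> what x = U"
    and what_right: "\<And>x. x > 1 \<Longrightarrow> what x = - V"
begin

definition what_x :: "real \<Rightarrow> real" where
  "what_x x = Dfun' \<phi> (what x) * deriv what x"

lemma what_cont: "continuous_on X what"
  using smooth_deriv[OF what_smooth] by (meson DERIV_isCont continuous_at_imp_continuous_on)

lemma borel_what [measurable]: "what \<in> borel_measurable borel"
  by (rule borel_measurable_continuous_onI[OF what_cont])

lemma what_x_cont: "continuous_on UNIV what_x"
  unfolding what_x_def
  by (intro continuous_intros continuous_on_compose2[OF continuous_Dfun'] what_cont
      smooth_continuous_deriv what_smooth) auto

lemma borel_what_x [measurable]: "what_x \<in> borel_measurable borel"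
  by (rule borel_measurable_continuous_onI[OF what_x_cont])

lemma what_x_support: "\<bar>x\<bar> > 1 \<Longrightarrow> what_x x = 0"
proof -
  assume x: "\<bar>x\<bar> > 1"
  have "(what has_real_derivative 0) (at x)"
  proof (cases "x > 1")
    case True
    then show ?thesis
      by (intro has_field_derivative_transform_within_open[OF DERIV_const[of "- V"], of "{1<..}"]) (auto simp: what_right)
  next
    case False
    then show ?thesis using x
      by (intro has_field_derivative_transform_within_open[OF DERIV_const[of U], of "{..<-1}"]) (auto simp: what_left)
  qed
  then show ?thesis by (simp add: what_x_def DERIV_imp_deriv)
qed

lemma primitive_Dfun_what: "primitive (\<lambda>x. Dfun \<phi> (what x)) what_x"
  unfolding what_x_def[abs_def]
  by (rule primitive_if_DERIV[OF DERIV_chain2[OF Dfun_DERIV smooth_deriv[OF what_smooth]]])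
     (use what_x_cont in \<open>simp add: what_x_def[abs_def]\<close>)

lemma Dfun_nonneg: "0 \<le> Dfun \<phi> s"
  using Dfun_mono[of 0 s] by (cases "0 \<le> s") (auto simp: Dfun_def phi_0)

lemma Dfun_what_bounded: obtains B where "\<And>x. \<bar>Dfun \<phi> (what x)\<bar> \<le> B"
proof -
  have "compact ((\<lambda>x. Dfun \<phi> (what x)) ` {-1..1})"
    by (intro compact_continuous_image continuous_on_compose2[OF continuous_Dfun[of UNIV]] what_cont) auto
  then obtain B0 where B0: "\<forall>x\<in>{-1..1}. \<bar>Dfun \<phi> (what x)\<bar> \<le> B0"
    by (auto dest!: compact_imp_bounded simp: bounded_iff simp del: atLeastAtMost_iff)
  have "\<bar>Dfun \<phi> (what x)\<bar> \<le> max B0 (Dfun \<phi> U)" for x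
  proof (cases "x \<in> {-1..1}")
    case False
    then have "what x = U \<or> what x = - V" using what_left[of x] what_right[of x] by auto
    then show ?thesis using V Dfun_nonneg[of U] by (auto simp: Dfun_def)
  qed (use B0 in \<open>auto simp: le_max_iff_disj\<close>)
  then show ?thesis by (rule that)
qed

end

locale similarity_solution = similarity_profile \<phi> f q U V a k M + far_field \<phi> what U V T
  for \<phi> f q :: "real \<Rightarrow> real" and U V a k M :: real and what :: "real \<Rightarrow> real" and T :: real
begin

definition w :: "real \<times> real \<Rightarrow> real" where
  "w p = f (fst p / sqrt (snd p))"

definition wx :: "real \<times> real \<Rightarrow> real" where
  "wx p = G (fst p / sqrt (snd p)) / sqrt (snd p)"

lemma borel_w [measurable]: "w \<in> borel_measurable borel"
  unfolding w_def[abs_def] by measurable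

lemma borel_wx [measurable]: "wx \<in> borel_measurable borel"
  unfolding wx_def[abs_def] by measurable

lemma primitive_Dfun_w: "t > 0 \<Longrightarrow> primitive (\<lambda>x. Dfun \<phi> (w (x, t))) (\<lambda>x. wx (x, t))"
  using primitive_scaled[OF primitive_F, of "sqrt t"] by (simp add: w_def wx_def)

lemma locally_lborel_integrable_wx: "t > 0 \<Longrightarrow> locally_lborel_integrable (\<lambda>x. wx (x, t))"
proof (rule locally_lborel_integrable_bounded)
  show "\<bar>wx (x, t)\<bar> \<le> M / sqrt t" if "t > 0" for x
    using G_bounded[of "x / sqrt t"] that by (simp add: wx_def abs_mult divide_right_mono)
qed (simp add: wx_def)

lemma weak_dx_w: "weak_dx T (\<lambda>p. Dfun \<phi> (w p)) wx"
  unfolding weak_dx_def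
proof
  show "wx \<in> borel_measurable (lebesgue_on (QT T))" by (rule borel_lebesgue_on) simp
  show "AE t in lebesgue_on {0<..<T}. weak_deriv (\<lambda>x. Dfun \<phi> (w (x, t))) (\<lambda>x. wx (x, t))"
  proof (rule AE_I2)
    fix t assume "t \<in> space (lebesgue_on {0<..<T})"
    then have "t > 0" by simp
    then show "weak_deriv (\<lambda>x. Dfun \<phi> (w (x, t))) (\<lambda>x. wx (x, t))"
      by (intro weak_deriv_if_primitive primitive_Dfun_w locally_lborel_integrable_wx) (simp_all add: wx_def)
  qed
qed

lemma Linfty_w: "Linfty T w"
  unfolding Linfty_def
proof
  show "w \<in> borel_measurable (lebesgue_on (QT T))" by (rule borel_lebesgue_on) simp
  show "\<exists>C. AE p in lebesgue_on (QT T). \<bar>w p\<bar> \<le> C"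
    using f_bounded by (intro exI[of _ "max U V"] AE_I2) (simp add: w_def)
qed

text \<open>Beyond \<open>X = 1 + a * sqrt T\<close> both functions take the value -V at all times;
  in the middle they are bounded; on the far left \<open>what\<close> equals \<open>U\<close>, and
  the mean value theorem reduces the difference to the tail of U - f. The rate
  \<open>c / sqrt T\<close> is the worst one, since |x| / sqrt t is at least |x| / sqrt T.\<close>

lemma Dfun_difference_bound:
  obtains C c where "C > 0" "c > 0"
    "\<And>x t. t \<in> {0<..<T} \<Longrightarrow> \<bar>Dfun \<phi> (w (x, t)) - Dfun \<phi> (what x)\<bar> \<le> C * exp (- c * \<bar>x\<bar>)"
proof -
  obtain C c where C: "C > 0" and c: "c > 0"
    and tail: "\<And>x. x < a \<Longrightarrow> U - f x \<le> C * exp (- c * \<bar>x\<bar>)"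
    using exponential_tails by metis
  obtain B0 where B0: "\<And>x. \<bar>Dfun \<phi> (what x)\<bar> \<le> B0" using Dfun_what_bounded by blast
  define B where "B = \<bar>B0\<bar> + Dfun \<phi> U"
  have D_V: "Dfun \<phi> (- V) = 0" using V by (simp add: Dfun_def)
  have what_le: "0 \<le> Dfun \<phi> (what x) \<and> Dfun \<phi> (what x) \<le> B" for x
    using B0[of x] Dfun_nonneg[of "what x"] Dfun_nonneg[of U] by (auto simp: B_def)
  have w_le: "0 \<le> Dfun \<phi> (w p) \<and> Dfun \<phi> (w p) \<le> B" for p
  proof -
    have "w p \<le> U" using f_less[of "fst p / sqrt (snd p)"] f_right[of "fst p / sqrt (snd p)"] U V
      by (cases "fst p / sqrt (snd p) < a") (auto simp: w_def)
    then show ?thesis using Dfun_mono[of "w p" U] Dfun_nonneg[of "w p"] by (simp add: B_def)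
  qed
  have B: "B \<ge> 0" using w_le[of undefined] by linarith
  define c' where "c' = c / sqrt T"
  have c': "c' > 0" using c T by (simp add: c'_def)
  define X where "X = 1 + a * sqrt T"
  have X: "X \<ge> 1" using a T by (simp add: X_def)
  define C' where "C' = B * exp (c' * X) + deriv \<phi> U * C"
  have pU: "deriv \<phi> U > 0" by (rule phi'_pos[OF U])
  show ?thesis
  proof (rule that[of C' c'])
    show "C' > 0" using B C pU by (simp add: C'_def add_nonneg_pos)
    fix x t assume t: "t \<in> {0<..<T}"
    define d where "d = Dfun \<phi> (w (x, t)) - Dfun \<phi> (what x)"
    consider "\<bar>x\<bar> \<le> X" | "x > X" | "x < - X" by linarith
    then have "\<bar>d\<bar> \<le> C' * exp (- c' * \<bar>x\<bar>)"
    proof cases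
      case 1
      have "\<bar>d\<bar> \<le> B * 1" using w_le[of "(x, t)"] what_le[of x] by (auto simp: d_def)
      also have "\<dots> \<le> B * exp (c' * X - c' * \<bar>x\<bar>)"
        using B 1 c' by (intro mult_left_mono) (auto simp: mult_left_mono)
      also have "\<dots> = B * exp (c' * X) * exp (- c' * \<bar>x\<bar>)" by (simp add: mult.assoc flip: exp_add)
      also have "\<dots> \<le> C' * exp (- c' * \<bar>x\<bar>)" using C pU by (intro mult_right_mono) (auto simp: C'_def)
      finally show ?thesis .
    next
      case 2
      have "a * sqrt t \<le> a * sqrt T" using a t by (intro mult_left_mono) auto
      then have "x / sqrt t \<ge> a" using 2 t by (simp add: X_def pos_le_divide_eq)
      then have "w (x, t) = - V" using f_right by (simp add: w_def)
      moreover have "what x = - V" using 2 X by (intro what_right) linarith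
      ultimately have "d = 0" by (simp add: d_def)
      then show ?thesis using B C pU by (simp add: C'_def)
    next
      case 3
      then have x: "x < 0" "what x = U" using X what_left[of x] by auto
      have "x / sqrt t < 0" using x t by (intro divide_neg_pos) auto
      then have less: "x / sqrt t < a" using a by linarith
      then have w_bd: "0 < w (x, t)" "w (x, t) < U" using f_pos f_less by (auto simp: w_def)
      obtain z where z: "w (x, t) < z" "z < U" "Dfun \<phi> U - Dfun \<phi> (w (x, t)) = (U - w (x, t)) * Dfun' \<phi> z"
        using MVT2[OF w_bd(2), of "Dfun \<phi>" "Dfun' \<phi>"] Dfun_DERIV by blast
      have "Dfun' \<phi> z \<le> deriv \<phi> U" using z w_bd phi'_mono[of z U] by (simp add: Dfun'_def)
      then have "\<bar>d\<bar> \<le> (U - w (x, t)) * deriv \<phi> U"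
        using z w_bd x phi'_nonneg[of z] Dfun_mono[of "w (x, t)" U]
        by (auto simp: d_def abs_if intro!: mult_left_mono)
      also have "U - w (x, t) \<le> C * exp (- c * \<bar>x / sqrt t\<bar>)" using tail[OF less] by (simp add: w_def)
      also have "\<dots> \<le> C * exp (- c' * \<bar>x\<bar>)"
      proof -
        have "\<bar>x\<bar> / sqrt T \<le> \<bar>x\<bar> / sqrt t" using t by (intro divide_left_mono) auto
        then have "c * (\<bar>x\<bar> / sqrt T) \<le> c * (\<bar>x\<bar> / sqrt t)" using c by (intro mult_left_mono) auto
        then show ?thesis using C t by (intro mult_left_mono) (auto simp: c'_def abs_divide)
      qed
      finally have "\<bar>d\<bar> \<le> C * exp (- c' * \<bar>x\<bar>) * deriv \<phi> U" using pU by (simp add: mult_right_mono)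
      also have "\<dots> = (deriv \<phi> U * C) * exp (- c' * \<bar>x\<bar>)" by simp
      also have "\<dots> \<le> C' * exp (- c' * \<bar>x\<bar>)" using B by (intro mult_right_mono) (auto simp: C'_def)
      finally show ?thesis .
    qed
    then show "\<bar>Dfun \<phi> (w (x, t)) - Dfun \<phi> (what x)\<bar> \<le> C' * exp (- c' * \<bar>x\<bar>)" by (simp add: d_def)
  qed (rule c')
qed

text \<open>The square of the x-derivative is at most C2^2 / t times a function of x / sqrt t.
  Integration in x returns a factor sqrt t and leaves the integrable singularity 1 / sqrt t in time.
  The other terms of the majorant \<open>H\<close> do not depend on t.\<close>

lemma L2_W12_w: "L2_W12 T (\<lambda>(x, t). Dfun \<phi> (w (x, t)) - Dfun \<phi> (what x))"
proof -
  obtain C1 c1 where C1: "C1 > 0" "c1 > 0"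
    and v_le: "\<And>x t. t \<in> {0<..<T} \<Longrightarrow> \<bar>Dfun \<phi> (w (x, t)) - Dfun \<phi> (what x)\<bar> \<le> C1 * exp (- c1 * \<bar>x\<bar>)"
    using Dfun_difference_bound by metis
  obtain C2 c2 where C2: "C2 > 0" "c2 > 0" and G_le: "\<And>x. \<bar>G x\<bar> \<le> C2 * exp (- c2 * \<bar>x\<bar>)"
    using exponential_tails by metis
  define v where "v = (\<lambda>(x, t). Dfun \<phi> (w (x, t)) - Dfun \<phi> (what x))"
  define g where "g = (\<lambda>(x, t). wx (x, t) - what_x x)"
  define E where "E x = exp (- (2 * c2) * \<bar>x\<bar>)" for x :: real
  define H where "H t x = C1\<^sup>2 * exp (- (2 * c1) * \<bar>x\<bar>) + 2 * (what_x x)\<^sup>2 + 2 * C2\<^sup>2 / t * E (x / sqrt t)" for t x :: real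
  have E_int: "integrable lborel E" unfolding E_def[abs_def] using C2 by (intro integrable_exp_neg_abs) simp
  have E_scaled: "integrable lborel (\<lambda>x. E (x / sqrt t))" "(LINT x|lborel. E (x / sqrt t)) = sqrt t * (LINT x|lborel. E x)"
    if "t > 0" for t
  proof -
    have "integrable lborel (\<lambda>x. E (0 + 1 / sqrt t * x))"
      by (rule lborel_integrable_real_affine[OF E_int]) (use that in simp)
    then show "integrable lborel (\<lambda>x. E (x / sqrt t))" by simp
    show "(LINT x|lborel. E (x / sqrt t)) = sqrt t * (LINT x|lborel. E x)"
      using lborel_integral_real_affine[of "1 / sqrt t" E 0] that by simp
  qed
  have what_int: "integrable lborel (\<lambda>x. (what_x x)\<^sup>2)"
  proof -
    have "integrable lborel (\<lambda>x. indicat_real {-1..1} x *\<^sub>R (what_x x)\<^sup>2)"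
      by (intro borel_integrable_compact continuous_intros continuous_on_subset[OF what_x_cont]) auto
    moreover have "(\<lambda>x. indicat_real {-1..1} x *\<^sub>R (what_x x)\<^sup>2) = (\<lambda>x. (what_x x)\<^sup>2)"
    proof
      show "indicat_real {-1..1} x *\<^sub>R (what_x x)\<^sup>2 = (what_x x)\<^sup>2" for x
        using what_x_support[of x] by (cases "\<bar>x\<bar> > 1") (auto simp: indicator_def)
    qed
    ultimately show ?thesis by metis
  qed
  have e1_int: "integrable lborel (\<lambda>x. exp (- (2 * c1) * \<bar>x\<bar>))" using C1 by (intro integrable_exp_neg_abs) simp
  have H_int: "integrable lborel (H t)" if "t > 0" for t
    unfolding H_def using that
    by (intro Bochner_Integration.integrable_add integrable_mult_right e1_int what_int E_scaled)
  define K1 where "K1 = C1\<^sup>2 * (LINT x|lborel. exp (- (2 * c1) * \<bar>x\<bar>)) + 2 * (LINT x|lborel. (what_x x)\<^sup>2)"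
  define K2 where "K2 = 2 * C2\<^sup>2 * (LINT x|lborel. E x)"
  have H_eq: "(LINT x|lborel. H t x) = K1 + K2 * (1 / sqrt t)" if t: "t > 0" for t
  proof -
    have "(LINT x|lborel. H t x) = K1 + 2 * C2\<^sup>2 / t * (sqrt t * (LINT x|lborel. E x))"
    proof -
      have "(LINT x|lborel. H t x) = (LINT x|lborel. C1\<^sup>2 * exp (- (2 * c1) * \<bar>x\<bar>))
          + (LINT x|lborel. 2 * (what_x x)\<^sup>2) + (LINT x|lborel. 2 * C2\<^sup>2 / t * E (x / sqrt t))"
        unfolding H_def
        by (simp only: Bochner_Integration.integral_add Bochner_Integration.integrable_add integrable_mult_right
            e1_int what_int E_scaled(1)[OF t])
      then show ?thesis by (simp only: K1_def integral_mult_right_zero E_scaled(2)[OF t])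
    qed
    also have "2 * C2\<^sup>2 / t * (sqrt t * (LINT x|lborel. E x)) = K2 * (1 / sqrt t)"
    proof -
      have "sqrt t / t = 1 / sqrt t" using t by (simp add: real_div_sqrt field_simps)
      moreover have "2 * C2\<^sup>2 / t * (sqrt t * (LINT x|lborel. E x)) = K2 * (sqrt t / t)" by (simp add: K2_def)
      ultimately show ?thesis by simp
    qed
    finally show ?thesis .
  qed
  have [measurable]: "v \<in> borel_measurable borel" "g \<in> borel_measurable borel"
    unfolding v_def g_def case_prod_beta' prod.collapse by measurable
  have sec: "(\<lambda>x. v (x, t)) \<in> borel_measurable borel" "(\<lambda>x. g (x, t)) \<in> borel_measurable borel" for t
    unfolding v_def g_def case_prod_conv w_def wx_def fst_conv snd_conv by measurable
  have bound: "(v (x, t))\<^sup>2 + (g (x, t))\<^sup>2 \<le> H t x" if t: "t \<in> {0<..<T}" for x t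
  proof -
    have "(v (x, t))\<^sup>2 \<le> (C1 * exp (- c1 * \<bar>x\<bar>))\<^sup>2"
      using v_le[OF t, of x] C1 by (intro abs_le_square_iff[THEN iffD1]) (auto simp: v_def)
    then have 1: "(v (x, t))\<^sup>2 \<le> C1\<^sup>2 * exp (- (2 * c1) * \<bar>x\<bar>)"
      unfolding power_mult_distrib exp_power2 .
    have "\<bar>wx (x, t)\<bar> \<le> C2 * exp (- c2 * \<bar>x / sqrt t\<bar>) / sqrt t"
      using G_le[of "x / sqrt t"] t by (simp add: wx_def abs_mult divide_right_mono)
    then have "(wx (x, t))\<^sup>2 \<le> (C2 * exp (- c2 * \<bar>x / sqrt t\<bar>) / sqrt t)\<^sup>2"
      using C2 t by (intro abs_le_square_iff[THEN iffD1]) auto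
    also have "\<dots> = C2\<^sup>2 / t * E (x / sqrt t)"
      using t unfolding E_def power_mult_distrib power_divide exp_power2 by simp
    finally have 2: "(wx (x, t))\<^sup>2 \<le> C2\<^sup>2 / t * E (x / sqrt t)" .
    have "(g (x, t))\<^sup>2 \<le> 2 * (wx (x, t))\<^sup>2 + 2 * (what_x x)\<^sup>2"
      using zero_le_power2[of "wx (x, t) + what_x x"] by (simp add: g_def power2_eq_square algebra_simps)
    then show ?thesis using 1 2 by (simp add: H_def)
  qed
  have "L2_W12 T v"
    unfolding L2_W12_def
  proof (intro exI[of _ g] conjI)
    show "v \<in> borel_measurable (lebesgue_on (QT T))" "g \<in> borel_measurable (lebesgue_on (QT T))"
      by (rule borel_lebesgue_on; simp)+
    show "AE t in lebesgue_on {0<..<T}. W12 (\<lambda>x. v (x, t)) (\<lambda>x. g (x, t))"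
    proof (rule AE_I2)
      fix t assume "t \<in> space (lebesgue_on {0<..<T})"
      then have t: "t \<in> {0<..<T}" by simp
      have int: "integrable lebesgue (\<lambda>x. (h (x, t))\<^sup>2)"
        if [measurable]: "(\<lambda>x. h (x, t)) \<in> borel_measurable borel" and le: "\<And>x. (h (x, t))\<^sup>2 \<le> H t x" for h
      proof -
        have "integrable lborel (\<lambda>x. (h (x, t))\<^sup>2)"
        proof (rule Bochner_Integration.integrable_bound[OF H_int])
          show "AE x in lborel. norm ((h (x, t))\<^sup>2) \<le> norm (H t x)"
            using le order_trans[OF zero_le_power2 le] by (intro AE_I2) simp
        qed (use t in auto)
        then show ?thesis by (subst integrable_completion) auto
      qed
      have "L2 (\<lambda>x. v (x, t))" "L2 (\<lambda>x. g (x, t))"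
        unfolding L2_def using sec
        by (auto intro!: int measurable_completion order_trans[OF _ bound[OF t]])
      moreover have "weak_deriv (\<lambda>x. v (x, t)) (\<lambda>x. g (x, t))"
      proof (rule weak_deriv_if_primitive)
        show "primitive (\<lambda>x. v (x, t)) (\<lambda>x. g (x, t))"
          unfolding v_def g_def case_prod_conv using t
          by (intro primitive_diff primitive_Dfun_w primitive_Dfun_what locally_lborel_integrable_wx
              locally_lborel_integrable_continuous what_x_cont) auto
        show "locally_lborel_integrable (\<lambda>x. g (x, t))"
          using locally_lborel_integrable_wx[of t] locally_lborel_integrable_continuous[OF what_x_cont] t
          by (auto simp: g_def locally_lborel_integrable_def intro!: set_integral_diff(1))
      qed (rule sec)
      ultimately show "W12 (\<lambda>x. v (x, t)) (\<lambda>x. g (x, t))" by (simp add: W12_def)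
    qed
    have K: "0 \<le> K1 + K2 * (1 / sqrt t)" if "t \<in> {0<..<T}" for t
    proof -
      have "0 \<le> (LINT x|lborel. H t x)"
        using that by (intro integral_nonneg_AE AE_I2) (auto simp: H_def E_def)
      then show ?thesis using H_eq[of t] that by simp
    qed
    have inner: "(\<integral>\<^sup>+ x. ennreal ((v (x, t))\<^sup>2 + (g (x, t))\<^sup>2) \<partial>lebesgue) \<le> ennreal (K1 + K2 * (1 / sqrt t))"
      if t: "t \<in> {0<..<T}" for t
    proof -
      have "(\<integral>\<^sup>+ x. ennreal ((v (x, t))\<^sup>2 + (g (x, t))\<^sup>2) \<partial>lebesgue) \<le> (\<integral>\<^sup>+ x. ennreal (H t x) \<partial>lborel)"
        unfolding nn_integral_completion using bound[OF t] by (intro nn_integral_mono ennreal_leI)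
      also have "\<dots> = ennreal (LINT x|lborel. H t x)"
        using t by (intro nn_integral_eq_integral H_int AE_I2 order_trans[OF _ bound]) auto
      finally show ?thesis using t by (simp add: H_eq)
    qed
    have "(\<integral>\<^sup>+ t. (\<integral>\<^sup>+ x. ennreal ((v (x, t))\<^sup>2 + (g (x, t))\<^sup>2) \<partial>lebesgue) \<partial>lebesgue_on {0<..<T})
        \<le> (\<integral>\<^sup>+ t. ennreal (K1 + K2 * (1 / sqrt t)) \<partial>lebesgue_on {0<..<T})"
      by (rule nn_integral_mono) (use inner in simp)
    also have "\<dots> = (\<integral>\<^sup>+ t. ennreal (K1 + K2 * (1 / sqrt t)) * indicator {0<..<T} t \<partial>lborel)"
      by (simp add: nn_integral_restrict_space nn_integral_completion)
    also have "\<dots> = (\<integral>\<^sup>+ t. ennreal (indicat_real {0<..<T} t *\<^sub>R (K1 + K2 * (1 / sqrt t))) \<partial>lborel)"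
      by (rule nn_integral_cong) (auto simp: indicator_def)
    also have "\<dots> < \<infinity>"
    proof -
      have "set_integrable lborel {0..T} (\<lambda>t. K1)" by (simp add: set_integrable_def)
      then have "set_integrable lborel {0..T} (\<lambda>t. K1 + K2 * (1 / sqrt t))"
        by (intro set_integral_add set_integrable_mult_right set_integrable_inverse_sqrt)
      then have "set_integrable lborel {0<..<T} (\<lambda>t. K1 + K2 * (1 / sqrt t))"
        by (rule set_integrable_subset) auto
      then show ?thesis
        unfolding set_integrable_def using K
        by (subst nn_integral_eq_integral) (auto simp: indicator_def)
    qed
    finally show "(\<integral>\<^sup>+ t. (\<integral>\<^sup>+ x. ennreal ((v (x, t))\<^sup>2 + (g (x, t))\<^sup>2) \<partial>lebesgue) \<partial>lebesgue_on {0<..<T}) < \<infinity>" .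
  qed
  then show ?thesis by (simp add: v_def)
qed

end

section \<open>The weak identity\<close>

lemma lebesgue_on_QT_integral:
  fixes h :: "real \<times> real \<Rightarrow> real"
  assumes "(\<lambda>p. indicator (QT T) p * h p) \<in> borel_measurable borel"
  shows "(LINT p|lebesgue_on (QT T). h p) = (LINT p|(lborel \<Otimes>\<^sub>M lborel). indicator (QT T) p * h p)"
proof -
  have "(LINT p|lebesgue_on (QT T). h p) = (LINT p|lebesgue. indicator (QT T) p *\<^sub>R h p)"
    by (rule integral_restrict_space) simp
  also have "\<dots> = (LINT p|lborel. indicator (QT T) p * h p)"
    using assms by (simp add: integral_completion)
  finally show ?thesis by (simp add: lborel_prod)
qed

lemma integrable_if_bounded_support:
  fixes h :: "real \<Rightarrow> real"
  assumes [measurable]: "h \<in> borel_measurable borel" and bound: "\<And>x. \<bar>h x\<bar> \<le> B * indicat_real {- N..N} x"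
  shows "integrable lborel h"
proof (rule Bochner_Integration.integrable_bound)
  show "integrable lborel (\<lambda>x. B * indicat_real {- N..N} x)" by simp
  show "AE x in lborel. norm (h x) \<le> norm (B * indicat_real {- N..N} x)"
    using bound by (intro AE_I2) (auto intro: order_trans[OF _ abs_ge_self])
qed simp

section \<open>Test functions on the closed strip\<close>

locale strip_test =
  fixes T :: real and \<Psi> \<Psi>x \<Psi>t :: "real \<times> real \<Rightarrow> real" and J B :: real
  assumes T: "T > 0" and test: "test_function T \<Psi> \<Psi>x \<Psi>t" and J: "J > 0"
    and support: "\<And>x t. t \<in> {0..T} \<Longrightarrow> \<bar>x\<bar> > J \<Longrightarrow> \<Psi> (x, t) = 0"
    and bound: "\<And>x t. t \<in> {0..T} \<Longrightarrow> \<bar>x\<bar> \<le> J \<Longrightarrow> \<bar>\<Psi> (x, t)\<bar> \<le> B \<and> \<bar>\<Psi>x (x, t)\<bar> \<le> B \<and> \<bar>\<Psi>t (x, t)\<bar> \<le> B"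
begin

abbreviation "strip \<equiv> (UNIV :: real set) \<times> {0..T}"

lemma has_derivative_strip:
  "p \<in> strip \<Longrightarrow> (\<Psi> has_derivative (\<lambda>h. \<Psi>x p * fst h + \<Psi>t p * snd h)) (at p within strip)"
  using test by (auto simp: test_function_def)

lemma continuous_strip: "continuous_on strip \<Psi>" "continuous_on strip \<Psi>x" "continuous_on strip \<Psi>t"
  using has_derivative_continuous_on[OF has_derivative_strip] test by (auto simp: test_function_def)

lemma final_zero: "\<Psi> (x, T) = 0"
  using test by (auto simp: test_function_def)

lemma B_nonneg: "B \<ge> 0"
  using bound[of 0 0] T J by force

lemma DERIV_x: "t \<in> {0..T} \<Longrightarrow> ((\<lambda>x. \<Psi> (x, t)) has_real_derivative \<Psi>x (x, t)) (at x)"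
proof -
  assume t: "t \<in> {0..T}"
  have "((\<lambda>x. \<Psi> (x, t)) has_derivative (\<lambda>h. \<Psi>x (x, t) * fst (h, 0 :: real) + \<Psi>t (x, t) * snd (h, 0 :: real))) (at x within UNIV)"
    by (rule has_derivative_in_compose2[OF has_derivative_strip])
       (use t in \<open>auto intro!: derivative_eq_intros\<close>)
  then show ?thesis by (simp add: has_field_derivative_def)
qed

text \<open>The similarity variable is constant along these curves. Time 0 is excluded because sqrt
  is not differentiable there; T is included, one-sidedly, so that the final value of
  \<open>\<Psi>\<close> can be used.\<close>

lemma DERIV_curve:
  assumes t: "t \<in> {0<..T}"
  shows "((\<lambda>t. \<Psi> (x * sqrt t, t)) has_real_derivative
    \<Psi>x (x * sqrt t, t) * (x / (2 * sqrt t)) + \<Psi>t (x * sqrt t, t)) (at t within {0<..T})"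
proof -
  have s: "((\<lambda>t. x * sqrt t) has_derivative (\<lambda>h. h * (x / (2 * sqrt t)))) (at t within {0<..T})"
    using t unfolding has_field_derivative_def[symmetric] mult.commute[of _ "x / _"]
    by (auto intro!: derivative_eq_intros simp: field_simps)
  have "((\<lambda>t. (x * sqrt t, t)) has_derivative (\<lambda>h. (h * (x / (2 * sqrt t)), h))) (at t within {0<..T})"
    by (intro has_derivative_Pair s has_derivative_ident)
  then have "((\<lambda>t. \<Psi> (x * sqrt t, t)) has_derivative (\<lambda>h. \<Psi>x (x * sqrt t, t) * fst (h * (x / (2 * sqrt t)), h)
      + \<Psi>t (x * sqrt t, t) * snd (h * (x / (2 * sqrt t)), h))) (at t within {0<..T})"
    by (intro has_derivative_in_compose2[OF has_derivative_strip, of _ "{0<..T}"]) (use t in auto)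
  then show ?thesis
    unfolding has_field_derivative_def
    by (rule has_derivative_eq_rhs) (auto simp: fun_eq_iff algebra_simps)
qed

text \<open>A full neighbourhood on which \<open>\<Psi>\<close> vanishes is needed, hence interior
  times only; the times 0 and T carry no mass in the integrals over the strip.\<close>

lemma derivatives_support:
  assumes t: "t \<in> {0<..<T}" and x: "\<bar>x\<bar> > J"
  shows "\<Psi>x (x, t) = 0" "\<Psi>t (x, t) = 0"
proof -
  let ?S = "{y. J < \<bar>y\<bar>} \<times> {0<..<T}"
  have open_S: "open ?S" by (intro open_Times open_Collect_less continuous_intros open_greaterThanLessThan)
  have "(\<Psi> has_derivative (\<lambda>h. \<Psi>x (x, t) * fst h + \<Psi>t (x, t) * snd h)) (at (x, t) within ?S)"
    by (rule has_derivative_subset[OF has_derivative_strip]) (use t in auto)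
  then have "(\<Psi> has_derivative (\<lambda>h. \<Psi>x (x, t) * fst h + \<Psi>t (x, t) * snd h)) (at (x, t))"
    using at_within_open[OF _ open_S, of "(x, t)"] t x by simp
  moreover have "(\<Psi> has_derivative (\<lambda>h. 0)) (at (x, t))"
    by (rule has_derivative_transform_within_open[OF has_derivative_const[of 0] open_S])
       (use t x support in auto)
  ultimately have "(\<lambda>h. \<Psi>x (x, t) * fst h + \<Psi>t (x, t) * snd h) = (\<lambda>h. 0)"
    by (rule has_derivative_unique)
  from fun_cong[OF this, of "(1, 0)"] fun_cong[OF this, of "(0, 1)"]
  show "\<Psi>x (x, t) = 0" "\<Psi>t (x, t) = 0" by auto
qed

lemma bound_interior:
  assumes "t \<in> {0<..<T}"
  shows "\<bar>\<Psi> (x, t)\<bar> \<le> B * indicat_real {- J..J} x" "\<bar>\<Psi>x (x, t)\<bar> \<le> B * indicat_real {- J..J} x"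
    "\<bar>\<Psi>t (x, t)\<bar> \<le> B * indicat_real {- J..J} x"
  using bound[of t x] derivatives_support[of t x] support[of t x] assms
  by (cases "\<bar>x\<bar> \<le> J"; force simp: indicator_def)+

lemma bound_interior':
  assumes "t \<in> {0<..<T}"
  shows "\<bar>\<Psi> (x, t)\<bar> \<le> B" "\<bar>\<Psi>x (x, t)\<bar> \<le> B" "\<bar>\<Psi>t (x, t)\<bar> \<le> B"
proof -
  have "B * indicat_real {- J..J} x \<le> B" using B_nonneg by (cases "x \<in> {- J..J}") auto
  then show "\<bar>\<Psi> (x, t)\<bar> \<le> B" "\<bar>\<Psi>x (x, t)\<bar> \<le> B" "\<bar>\<Psi>t (x, t)\<bar> \<le> B"
    using bound_interior[OF assms, of x] by linarith+
qed

lemma strip_borel [measurable]: "strip \<in> sets borel"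
  by (intro borel_closed closed_Times) auto

lemma borel_strip [measurable]:
  "(\<lambda>p. indicat_real strip p *\<^sub>R \<Psi> p) \<in> borel_measurable borel"
  "(\<lambda>p. indicat_real strip p *\<^sub>R \<Psi>x p) \<in> borel_measurable borel"
  "(\<lambda>p. indicat_real strip p *\<^sub>R \<Psi>t p) \<in> borel_measurable borel"
  by (intro borel_measurable_continuous_on_indicator strip_borel continuous_strip)+

text \<open>Extensions by zero, which are Borel measurable on the whole plane.\<close>

definition "Z p = indicat_real strip p *\<^sub>R \<Psi> p"
definition "Zx p = indicat_real strip p *\<^sub>R \<Psi>x p"
definition "Zt p = indicat_real strip p *\<^sub>R \<Psi>t p"

lemma borel_Z [measurable]: "Z \<in> borel_measurable borel" "Zx \<in> borel_measurable borel" "Zt \<in> borel_measurable borel"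
  unfolding Z_def[abs_def] Zx_def[abs_def] Zt_def[abs_def] by (rule borel_strip)+

lemma Z_eq: "t \<in> {0..T} \<Longrightarrow> Z (x, t) = \<Psi> (x, t)" "t \<in> {0..T} \<Longrightarrow> Zx (x, t) = \<Psi>x (x, t)"
  "t \<in> {0..T} \<Longrightarrow> Zt (x, t) = \<Psi>t (x, t)"
  by (auto simp: Z_def Zx_def Zt_def)

end

lemma strip_test_exists:
  assumes T: "T > 0" and test: "test_function T \<Psi> \<Psi>x \<Psi>t"
  obtains J B where "strip_test T \<Psi> \<Psi>x \<Psi>t J B"
proof -
  obtain J where J: "J > 0" "\<And>x t. t \<in> {0..T} \<Longrightarrow> \<bar>x\<bar> > J \<Longrightarrow> \<Psi> (x, t) = 0"
    using test by (auto simp: test_function_def)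
  have cont: "continuous_on (UNIV \<times> {0..T}) h" if "h \<in> {\<Psi>, \<Psi>x, \<Psi>t}" for h
  proof -
    have "continuous_on (UNIV \<times> {0..T}) \<Psi>"
      by (rule has_derivative_continuous_on[where f' = "\<lambda>p h. \<Psi>x p * fst h + \<Psi>t p * snd h"])
         (use test in \<open>unfold test_function_def, blast\<close>)
    then show ?thesis using that test by (auto simp: test_function_def)
  qed
  have "\<exists>B. \<forall>p\<in>{- J..J} \<times> {0..T}. \<bar>h p\<bar> \<le> B" if "h \<in> {\<Psi>, \<Psi>x, \<Psi>t}" for h
  proof -
    have "compact (h ` ({- J..J} \<times> {0..T}))"
      by (intro compact_continuous_image continuous_on_subset[OF cont[OF that]] compact_Times) auto
    then show ?thesis
      by (auto dest!: compact_imp_bounded simp: bounded_iff simp del: atLeastAtMost_iff)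
  qed
  then obtain B0 B1 B2 where B: "\<And>p. p \<in> {- J..J} \<times> {0..T} \<Longrightarrow> \<bar>\<Psi> p\<bar> \<le> B0 \<and> \<bar>\<Psi>x p\<bar> \<le> B1 \<and> \<bar>\<Psi>t p\<bar> \<le> B2"
    by (metis insertI1 insertI2)
  show ?thesis
  proof (rule that[of J "max B0 (max B1 B2)"], unfold_locales)
    fix x t assume "t \<in> {0..T}" "\<bar>x\<bar> \<le> J"
    then have "(x, t) \<in> {- J..J} \<times> {0..T}" by auto
    then show "\<bar>\<Psi> (x, t)\<bar> \<le> max B0 (max B1 B2) \<and> \<bar>\<Psi>x (x, t)\<bar> \<le> max B0 (max B1 B2) \<and> \<bar>\<Psi>t (x, t)\<bar> \<le> max B0 (max B1 B2)"
      using B[of "(x, t)"] by (auto simp: le_max_iff_disj)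
  qed (use T test J in auto)
qed

section \<open>The weak identity in similarity variables\<close>

context similarity_solution
begin

context
  fixes \<Psi> \<Psi>x \<Psi>t J B
  assumes st: "strip_test T \<Psi> \<Psi>x \<Psi>t J B"
begin

interpretation st: strip_test T \<Psi> \<Psi>x \<Psi>t J B by (rule st)

definition slice :: "real \<Rightarrow> real" where
  "slice t = (LINT x|lborel. w (x, t) * st.Zt (x, t) - wx (x, t) * st.Zx (x, t))"

definition mU where "mU = max U V"

lemma f_bound: "\<bar>f x\<bar> \<le> mU" and mU_pos: "mU > 0"
  using f_bounded U by (auto simp: mU_def)

lemma borel_slices [measurable]:
  "(\<lambda>x. st.Zx (r * x, t)) \<in> borel_measurable borel"
  "(\<lambda>x. st.Zt (r * x, t)) \<in> borel_measurable borel"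
  "(\<lambda>x. st.Z (x, t)) \<in> borel_measurable borel" "(\<lambda>x. st.Zx (x, t)) \<in> borel_measurable borel"
  "(\<lambda>x. st.Zt (x, t)) \<in> borel_measurable borel"
  by measurable

text \<open>With the similarity variable as x, the bracket is the time derivative of
  \<open>sqrt t * \<Psi> (x * sqrt t, t)\<close> for fixed x. After the same substitution in
  \<open>slice t\<close>, the two integrands differ by 1 / (2 sqrt t) times the x-derivative of P x
  \<Psi>(x sqrt t, t), whose integral vanishes by compact support.\<close>

lemma slice_eq:
  assumes t: "t \<in> {0<..<T}"
  shows "(LINT x|lborel. f x * (st.Z (x * sqrt t, t) / (2 * sqrt t) + x / 2 * st.Zx (x * sqrt t, t)
    + sqrt t * st.Zt (x * sqrt t, t))) = slice t"
proof -
  have t': "t \<in> {0..T}" "sqrt t > 0" using t by auto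
  \<comment> \<open>The extra 1 puts both endpoints strictly outside the support, so the boundary
    terms vanish.\<close>
  define N where "N = J / sqrt t + 1"
  have N: "N > 0" using st.J t' by (simp add: N_def add_nonneg_pos)
  have out: "\<bar>x * sqrt t\<bar> > J" if "x \<notin> {- N<..<N}" for x
  proof -
    have "J / sqrt t < \<bar>x\<bar>" using that by (auto simp: N_def)
    then show ?thesis using t' by (simp add: pos_divide_less_eq abs_mult)
  qed
  have zero: "st.Z (x * sqrt t, t) = 0" "st.Zx (x * sqrt t, t) = 0" "st.Zt (x * sqrt t, t) = 0" if "x \<notin> {- N<..<N}" for x
    using st.derivatives_support[OF t out[OF that]] st.support[OF t'(1) out[OF that]] by (auto simp: st.Z_eq[OF t'(1)])
  have bnd: "\<bar>st.Z (x * sqrt t, t)\<bar> \<le> B" "\<bar>st.Zx (x * sqrt t, t)\<bar> \<le> B" "\<bar>st.Zt (x * sqrt t, t)\<bar> \<le> B" for x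
    using st.bound_interior'[OF t] by (auto simp: st.Z_eq[OF t'(1)])
  have [measurable]: "(\<lambda>x. st.Z (x * sqrt t, t)) \<in> borel_measurable borel"
    "(\<lambda>x. st.Zx (x * sqrt t, t)) \<in> borel_measurable borel" "(\<lambda>x. st.Zt (x * sqrt t, t)) \<in> borel_measurable borel"
    using borel_slices by (simp_all add: mult.commute)
  have Zx_cont: "continuous_on UNIV (\<lambda>x. st.Zx (x * sqrt t, t))"
    unfolding st.Z_eq[OF t'(1)]
    by (intro continuous_on_compose2[OF st.continuous_strip(2)] continuous_intros) (use t in auto)
  have Z_prim: "primitive (\<lambda>x. st.Z (x * sqrt t, t)) (\<lambda>x. st.Zx (x * sqrt t, t) * sqrt t)"
  proof (rule primitive_if_DERIV)
    show "((\<lambda>x. st.Z (x * sqrt t, t)) has_real_derivative st.Zx (x * sqrt t, t) * sqrt t) (at x)" for x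
      unfolding st.Z_eq[OF t'(1)]
      by (rule DERIV_chain2[OF st.DERIV_x[OF t'(1)]]) (auto intro!: derivative_eq_intros)
    show "continuous_on UNIV (\<lambda>x. st.Zx (x * sqrt t, t) * sqrt t)" by (intro continuous_intros Zx_cont)
  qed
  let ?A = "\<lambda>x. f x * st.Z (x * sqrt t, t) + P x * (st.Zx (x * sqrt t, t) * sqrt t)"
  let ?K = "\<lambda>x. sqrt t * (f x * st.Zt (x * sqrt t, t)) - G x * st.Zx (x * sqrt t, t)"
  have "(LINT x:{- N..N}|lborel. ?A x) = P N * st.Z (N * sqrt t, t) - P (- N) * st.Z (- N * sqrt t, t)"
    using N by (intro primitive_by_parts locally_lborel_integrable_f primitive_P Z_prim
        locally_lborel_integrable_continuous continuous_intros Zx_cont) auto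
  also have "\<dots> = 0" using zero(1)[of N] zero(1)[of "- N"] by simp
  finally have "(LINT x:{- N..N}|lborel. ?A x) = 0" .
  moreover have "(LINT x:{- N..N}|lborel. ?A x) = (LINT x|lborel. ?A x)"
    unfolding set_lebesgue_integral_def
  proof (intro Bochner_Integration.integral_cong)
    show "indicat_real {- N..N} x *\<^sub>R ?A x = ?A x" for x
      using zero[of x] by (cases "x \<in> {- N..N}") auto
  qed simp
  ultimately have A0: "(LINT x|lborel. ?A x) = 0" by simp
  have P_meas [measurable]: "P \<in> borel_measurable borel" unfolding P_def[abs_def] by measurable
  have P_le: "\<bar>P x\<bar> \<le> 2 * M + N * mU" if "x \<in> {- N..N}" for x
  proof -
    have "\<bar>x * f x\<bar> \<le> N * mU" unfolding abs_mult using that f_bound[of x] N by (intro mult_mono) auto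
    then show ?thesis using G_bounded[of x] by (auto simp: P_def)
  qed
  have A_int: "integrable lborel ?A"
  proof (rule integrable_if_bounded_support)
    fix x
    show "\<bar>?A x\<bar> \<le> (mU * B + (2 * M + N * mU) * (B * sqrt t)) * indicat_real {- N..N} x"
    proof (cases "x \<in> {- N..N}")
      case True
      have "\<bar>?A x\<bar> \<le> \<bar>f x\<bar> * \<bar>st.Z (x * sqrt t, t)\<bar> + \<bar>P x\<bar> * (\<bar>st.Zx (x * sqrt t, t)\<bar> * sqrt t)"
        using t' abs_triangle_ineq[of "f x * st.Z (x * sqrt t, t)" "P x * (st.Zx (x * sqrt t, t) * sqrt t)"]
        by (simp add: abs_mult)
      also have "\<dots> \<le> mU * B + (2 * M + N * mU) * (B * sqrt t)"
        using True t' N M_pos mU_pos st.B_nonneg by (intro add_mono mult_mono f_bound bnd P_le) auto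
      finally show ?thesis using True by simp
    qed (use zero in auto)
  qed measurable
  have K_int: "integrable lborel ?K"
  proof (rule integrable_if_bounded_support)
    fix x
    show "\<bar>?K x\<bar> \<le> (sqrt t * (mU * B) + M * B) * indicat_real {- N..N} x"
    proof (cases "x \<in> {- N..N}")
      case True
      have "\<bar>?K x\<bar> \<le> sqrt t * (\<bar>f x\<bar> * \<bar>st.Zt (x * sqrt t, t)\<bar>) + \<bar>G x\<bar> * \<bar>st.Zx (x * sqrt t, t)\<bar>"
        using t' abs_triangle_ineq4[of "sqrt t * (f x * st.Zt (x * sqrt t, t))" "G x * st.Zx (x * sqrt t, t)"]
        by (simp add: abs_mult)
      also have "\<dots> \<le> sqrt t * (mU * B) + M * B"
        using t' M_pos mU_pos st.B_nonneg by (intro add_mono mult_mono f_bound bnd G_bounded) auto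
      finally show ?thesis using True by simp
    qed (use zero in auto)
  qed measurable
  have "(LINT x|lborel. f x * (st.Z (x * sqrt t, t) / (2 * sqrt t) + x / 2 * st.Zx (x * sqrt t, t) + sqrt t * st.Zt (x * sqrt t, t)))
      = (LINT x|lborel. ?K x + 1 / (2 * sqrt t) * ?A x)"
    by (rule Bochner_Integration.integral_cong) (use t' in \<open>auto simp: P_def field_simps\<close>)
  also have "\<dots> = (LINT x|lborel. ?K x)"
    using A0 A_int K_int by (subst Bochner_Integration.integral_add) auto
  also have "\<dots> = slice t"
  proof -
    have "slice t = \<bar>sqrt t\<bar> *\<^sub>R (LINT x|lborel. w (0 + sqrt t * x, t) * st.Zt (0 + sqrt t * x, t) - wx (0 + sqrt t * x, t) * st.Zx (0 + sqrt t * x, t))"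
      unfolding slice_def using t' by (intro lborel_integral_real_affine) simp
    also have "\<dots> = (LINT x|lborel. sqrt t * (w (0 + sqrt t * x, t) * st.Zt (0 + sqrt t * x, t) - wx (0 + sqrt t * x, t) * st.Zx (0 + sqrt t * x, t)))"
      using t' by simp
    also have "\<dots> = (LINT x|lborel. ?K x)"
      by (rule Bochner_Integration.integral_cong) (use t' in \<open>auto simp: w_def wx_def mult.commute[of "sqrt t"] right_diff_distrib\<close>)
    finally show ?thesis by simp
  qed
  finally show ?thesis .
qed

text \<open>Fubini exchanges the integrals, and for each fixed similarity variable the time integral
  follows from the fundamental theorem: the value at T is zero and the value at \<tau> remains.
  Starting at a positive \<tau> keeps away from the factor 1 / sqrt t.\<close>

lemma slice_integral:
  assumes \<tau>: "\<tau> \<in> {0<..<T}"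
  shows "(LINT t|lborel. indicat_real {\<tau><..<T} t * slice t) = - (LINT x|lborel. w (x, \<tau>) * st.Z (x, \<tau>))"
proof -
  have \<tau>': "\<tau> \<in> {0..T}" "sqrt \<tau> > 0" using \<tau> by auto
  define D where "D x t = st.Z (x * sqrt t, t) / (2 * sqrt t) + x / 2 * st.Zx (x * sqrt t, t) + sqrt t * st.Zt (x * sqrt t, t)" for x t
  define h where "h = (\<lambda>(x, t). indicat_real {\<tau><..<T} t * (f x * D x t))"
  have FTC: "(LINT t|lborel. indicat_real {\<tau><..<T} t * D x t) = - (sqrt \<tau> * st.Z (x * sqrt \<tau>, \<tau>))" for x
  proof -
    have sub: "{\<tau>..T} \<subseteq> {0<..T}" using \<tau> by auto
    have "(LINT t|lborel. indicat_real {\<tau><..<T} t * D x t) = (LINT t|lborel. indicat_real {\<tau>..T} t *\<^sub>R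
        (\<Psi> (x * sqrt t, t) / (2 * sqrt t) + x / 2 * \<Psi>x (x * sqrt t, t) + sqrt t * \<Psi>t (x * sqrt t, t)))"
    proof (rule integral_cong_AE)
      show "(\<lambda>t. indicat_real {\<tau><..<T} t * D x t) \<in> borel_measurable lborel" unfolding D_def by measurable
      show "AE t in lborel. indicat_real {\<tau><..<T} t * D x t = indicat_real {\<tau>..T} t *\<^sub>R
        (\<Psi> (x * sqrt t, t) / (2 * sqrt t) + x / 2 * \<Psi>x (x * sqrt t, t) + sqrt t * \<Psi>t (x * sqrt t, t))"
        using AE_lborel_singleton[of \<tau>] AE_lborel_singleton[of T]
        by eventually_elim (use \<tau> in \<open>auto simp: D_def st.Z_eq indicator_def\<close>)
      have "(\<lambda>t. indicat_real {\<tau>..T} t * (st.Z (x * sqrt t, t) / (2 * sqrt t) + x / 2 * st.Zx (x * sqrt t, t) + sqrt t * st.Zt (x * sqrt t, t)))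
          \<in> borel_measurable lborel" by measurable
      also have "(\<lambda>t. indicat_real {\<tau>..T} t * (st.Z (x * sqrt t, t) / (2 * sqrt t) + x / 2 * st.Zx (x * sqrt t, t) + sqrt t * st.Zt (x * sqrt t, t)))
          = (\<lambda>t. indicat_real {\<tau>..T} t *\<^sub>R (\<Psi> (x * sqrt t, t) / (2 * sqrt t) + x / 2 * \<Psi>x (x * sqrt t, t) + sqrt t * \<Psi>t (x * sqrt t, t)))"
        using \<tau> by (auto simp: fun_eq_iff indicator_def st.Z_eq)
      finally show "(\<lambda>t. indicat_real {\<tau>..T} t *\<^sub>R (\<Psi> (x * sqrt t, t) / (2 * sqrt t) + x / 2 * \<Psi>x (x * sqrt t, t) + sqrt t * \<Psi>t (x * sqrt t, t)))
          \<in> borel_measurable lborel" .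
    qed
    also have "\<dots> = sqrt T * \<Psi> (x * sqrt T, T) - sqrt \<tau> * \<Psi> (x * sqrt \<tau>, \<tau>)"
    proof (rule integral_FTC_Icc)
      show "continuous_on {\<tau>..T} (\<lambda>t. \<Psi> (x * sqrt t, t) / (2 * sqrt t) + x / 2 * \<Psi>x (x * sqrt t, t) + sqrt t * \<Psi>t (x * sqrt t, t))"
        by (intro continuous_intros continuous_on_compose2[OF st.continuous_strip(1)] continuous_on_compose2[OF st.continuous_strip(2)]
            continuous_on_compose2[OF st.continuous_strip(3)]) (use \<tau> in auto)
      fix t assume "\<tau> \<le> t" "t \<le> T"
      then have t: "t \<in> {0<..T}" using \<tau> by auto
      have s: "(sqrt has_real_derivative 1 / (2 * sqrt t)) (at t within {\<tau>..T})"
        using t by (auto intro!: derivative_eq_intros simp: field_simps)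
      have "((\<lambda>t. sqrt t * \<Psi> (x * sqrt t, t)) has_real_derivative
          1 / (2 * sqrt t) * \<Psi> (x * sqrt t, t) + (\<Psi>x (x * sqrt t, t) * (x / (2 * sqrt t)) + \<Psi>t (x * sqrt t, t)) * sqrt t) (at t within {\<tau>..T})"
        by (rule DERIV_mult[OF s DERIV_subset[OF st.DERIV_curve[OF t] sub]])
      also have "1 / (2 * sqrt t) * \<Psi> (x * sqrt t, t) + (\<Psi>x (x * sqrt t, t) * (x / (2 * sqrt t)) + \<Psi>t (x * sqrt t, t)) * sqrt t
          = \<Psi> (x * sqrt t, t) / (2 * sqrt t) + x / 2 * \<Psi>x (x * sqrt t, t) + sqrt t * \<Psi>t (x * sqrt t, t)"
        using t by (simp add: field_simps)
      finally show "((\<lambda>t. sqrt t * \<Psi> (x * sqrt t, t)) has_vector_derivative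
          \<Psi> (x * sqrt t, t) / (2 * sqrt t) + x / 2 * \<Psi>x (x * sqrt t, t) + sqrt t * \<Psi>t (x * sqrt t, t)) (at t within {\<tau>..T})"
        by (simp add: has_real_derivative_iff_has_vector_derivative)
    qed (use \<tau> in auto)
    finally show ?thesis by (simp add: st.final_zero st.Z_eq[OF \<tau>'(1)])
  qed
  \<comment> \<open>For all t >= \<tau> the support in the similarity variable lies in [-N, N]; as t
    tends to 0 no such bound exists.\<close>
  define N where "N = J / sqrt \<tau>"
  have N: "N > 0" using st.J \<tau>' by (simp add: N_def)
  define C where "C = mU * (B / (2 * sqrt \<tau>) + N / 2 * B + sqrt T * B)"
  have h_int: "integrable (lborel \<Otimes>\<^sub>M lborel) h"
  proof (rule Bochner_Integration.integrable_bound)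
    show "integrable (lborel \<Otimes>\<^sub>M lborel) (\<lambda>(x, t). (C * indicat_real {- N..N} x) * indicat_real {\<tau>..T} t)"
      by (rule integrable_pair_product) auto
    show "h \<in> borel_measurable (lborel \<Otimes>\<^sub>M lborel)" unfolding h_def D_def by measurable
    show "AE p in lborel \<Otimes>\<^sub>M lborel. norm (h p) \<le> norm ((\<lambda>(x, t). (C * indicat_real {- N..N} x) * indicat_real {\<tau>..T} t) p)"
    proof (rule AE_I2)
      fix p :: "real \<times> real"
      obtain x t where p: "p = (x, t)" by fastforce
      show "norm (h p) \<le> norm ((\<lambda>(x, t). (C * indicat_real {- N..N} x) * indicat_real {\<tau>..T} t) p)"
      proof (cases "t \<in> {\<tau><..<T}")
        case True
        then have t: "t \<in> {0<..<T}" "t \<in> {0..T}" using \<tau> by auto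
        show ?thesis
        proof (cases "\<bar>x\<bar> \<le> N")
          case True
          have bi': "\<bar>st.Z (x * sqrt t, t)\<bar> \<le> B" "\<bar>st.Zx (x * sqrt t, t)\<bar> \<le> B" "\<bar>st.Zt (x * sqrt t, t)\<bar> \<le> B"
            using st.bound_interior'[OF t(1)] by (auto simp: st.Z_eq[OF t(2)])
          have "\<bar>D x t\<bar> \<le> \<bar>st.Z (x * sqrt t, t)\<bar> / (2 * sqrt t) + \<bar>x\<bar> / 2 * \<bar>st.Zx (x * sqrt t, t)\<bar> + sqrt t * \<bar>st.Zt (x * sqrt t, t)\<bar>"
            unfolding D_def using t
            by (auto intro!: order_trans[OF abs_triangle_ineq] add_mono simp: abs_mult abs_divide)
          also have "\<dots> \<le> B / (2 * sqrt \<tau>) + N / 2 * B + sqrt T * B"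
            using bi' True \<open>t \<in> {\<tau><..<T}\<close> \<tau> st.B_nonneg N T by (intro add_mono frac_le mult_mono) auto
          finally have "\<bar>f x * D x t\<bar> \<le> C"
            unfolding abs_mult C_def using f_bound[of x] mU_pos by (intro mult_mono) auto
          then show ?thesis using True \<open>t \<in> {\<tau><..<T}\<close> by (auto simp: p h_def indicator_def)
        next
          case False
          have "J < \<bar>x\<bar> * sqrt \<tau>" using False \<tau>' by (simp add: N_def pos_divide_less_eq not_le)
          also have "\<dots> \<le> \<bar>x\<bar> * sqrt t" using True by (intro mult_left_mono) auto
          finally have "J < \<bar>x * sqrt t\<bar>" using t by (simp add: abs_mult)
          then have "D x t = 0"
            using st.derivatives_support[OF t(1)] st.support[OF t(2)] by (simp add: D_def st.Z_eq[OF t(2)])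
          then show ?thesis by (simp add: p h_def)
        qed
      qed (simp add: p h_def)
    qed
  qed
  have "(LINT t|lborel. indicat_real {\<tau><..<T} t * slice t) = (LINT t|lborel. LINT x|lborel. h (x, t))"
  proof (rule Bochner_Integration.integral_cong)
    fix t
    show "indicat_real {\<tau><..<T} t * slice t = (LINT x|lborel. h (x, t))"
      using slice_eq[of t] \<tau> by (auto simp: h_def D_def indicator_def)
  qed simp
  also have "\<dots> = (LINT x|lborel. LINT t|lborel. h (x, t))"
    using lborel_pair.Fubini_integral[of "\<lambda>x t. h (x, t)"] h_int by simp
  also have "\<dots> = (LINT x|lborel. - (sqrt \<tau> * (w (0 + sqrt \<tau> * x, \<tau>) * st.Z (0 + sqrt \<tau> * x, \<tau>))))"
  proof (rule Bochner_Integration.integral_cong)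
    fix x
    have "(LINT t|lborel. h (x, t)) = f x * (LINT t|lborel. indicat_real {\<tau><..<T} t * D x t)"
      by (subst integral_mult_right_zero[symmetric]) (simp add: h_def mult_ac)
    also have "\<dots> = - (sqrt \<tau> * (w (0 + sqrt \<tau> * x, \<tau>) * st.Z (0 + sqrt \<tau> * x, \<tau>)))"
      using \<tau>' unfolding FTC by (simp add: w_def mult_ac)
    finally show "(LINT t|lborel. h (x, t)) = - (sqrt \<tau> * (w (0 + sqrt \<tau> * x, \<tau>) * st.Z (0 + sqrt \<tau> * x, \<tau>)))" .
  qed simp
  also have "\<dots> = - (\<bar>sqrt \<tau>\<bar> *\<^sub>R (LINT x|lborel. w (0 + sqrt \<tau> * x, \<tau>) * st.Z (0 + sqrt \<tau> * x, \<tau>)))"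
    using \<tau>' by simp
  also have "\<dots> = - (LINT x|lborel. w (x, \<tau>) * st.Z (x, \<tau>))"
    using lborel_integral_real_affine[of "sqrt \<tau>" "\<lambda>x. w (x, \<tau>) * st.Z (x, \<tau>)" 0] \<tau>' by simp
  finally show ?thesis .
qed

text \<open>Let \<tau> tend to 0 in the identity for slices. The double integral converges by
  integrability over the strip. On the other side \<open>w (x, \<tau>)\<close> tends to the datum at
  every x other than 0, because x / sqrt \<tau> tends to -\<infinity> or eventually exceeds
  \<open>a\<close>.\<close>

lemma weak_identity:
  "(LINT x|lebesgue. initial_datum U V x * \<Psi> (x, 0)) + (LINT p|lebesgue_on (QT T). w p * \<Psi>t p)
    = (LINT p|lebesgue_on (QT T). wx p * \<Psi>x p)"
proof -
  \<comment> \<open>The 2 keeps even the first of these times strictly below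
    \<open>T\<close>.\<close>
  let ?\<tau> = "\<lambda>n. T / (real n + 2)"
  have \<tau>: "?\<tau> n \<in> {0<..<T}" for n using T by (auto simp: field_simps intro: add_pos_nonneg)
  have \<tau>_lim: "?\<tau> \<longlonglongrightarrow> 0"
    by (intro real_tendsto_divide_at_top[OF tendsto_const] filterlim_at_top_mono[OF filterlim_real_sequentially]) simp
  define K1 where "K1 p = indicat_real (QT T) p * (w p * \<Psi>t p)" for p
  define K2 where "K2 p = indicat_real (QT T) p * (wx p * \<Psi>x p)" for p
  have K_eq: "K1 = (\<lambda>p. indicat_real (QT T) p * (w p * st.Zt p))" "K2 = (\<lambda>p. indicat_real (QT T) p * (wx p * st.Zx p))"
    by (auto simp: K1_def K2_def fun_eq_iff QT_def indicator_def st.Zt_def st.Zx_def)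
  have [measurable]: "K1 \<in> borel_measurable borel" "K2 \<in> borel_measurable borel"
    unfolding K_eq by measurable
  have K1_int: "integrable (lborel \<Otimes>\<^sub>M lborel) K1"
  proof (rule Bochner_Integration.integrable_bound)
    show "integrable (lborel \<Otimes>\<^sub>M lborel) (\<lambda>(x, t). (mU * B * indicat_real {- J..J} x) * indicat_real {0..T} t)"
      by (rule integrable_pair_product) auto
    show "K1 \<in> borel_measurable (lborel \<Otimes>\<^sub>M lborel)" by (simp add: lborel_prod)
    show "AE p in lborel \<Otimes>\<^sub>M lborel. norm (K1 p) \<le> norm ((\<lambda>(x, t). (mU * B * indicat_real {- J..J} x) * indicat_real {0..T} t) p)"
    proof (rule AE_I2)
      fix p :: "real \<times> real"
      obtain x t where p: "p = (x, t)" by fastforce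
      have "\<bar>w p * \<Psi>t p\<bar> \<le> mU * (B * indicat_real {- J..J} x)" if "t \<in> {0<..<T}"
        unfolding abs_mult p using st.bound_interior(3)[OF that, of x] f_bound mU_pos
        by (intro mult_mono) (auto simp: w_def)
      then show "norm (K1 p) \<le> norm ((\<lambda>(x, t). (mU * B * indicat_real {- J..J} x) * indicat_real {0..T} t) p)"
        using mU_pos st.B_nonneg by (auto simp: K1_def p QT_def indicator_def split: if_splits)
    qed
  qed
  have sq_int: "integrable lborel (\<lambda>t. indicat_real {0..T} t * (1 / sqrt t))"
    using set_integrable_inverse_sqrt[of T] by (simp add: set_integrable_def)
  have K2_int: "integrable (lborel \<Otimes>\<^sub>M lborel) K2"
  proof (rule Bochner_Integration.integrable_bound)
    show "integrable (lborel \<Otimes>\<^sub>M lborel) (\<lambda>(x, t). (M * B * indicat_real {- J..J} x) * (indicat_real {0..T} t * (1 / sqrt t)))"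
      by (rule integrable_pair_product[OF _ sq_int]) auto
    show "K2 \<in> borel_measurable (lborel \<Otimes>\<^sub>M lborel)" by (simp add: lborel_prod)
    show "AE p in lborel \<Otimes>\<^sub>M lborel. norm (K2 p) \<le> norm ((\<lambda>(x, t). (M * B * indicat_real {- J..J} x) * (indicat_real {0..T} t * (1 / sqrt t))) p)"
    proof (rule AE_I2)
      fix p :: "real \<times> real"
      obtain x t where p: "p = (x, t)" by fastforce
      have "\<bar>wx p * \<Psi>x p\<bar> \<le> (M / sqrt t) * (B * indicat_real {- J..J} x)" if "t \<in> {0<..<T}"
        unfolding abs_mult p using st.bound_interior(2)[OF that, of x] G_bounded M_pos that
        by (intro mult_mono) (auto simp: wx_def abs_divide divide_right_mono)
      then show "norm (K2 p) \<le> norm ((\<lambda>(x, t). (M * B * indicat_real {- J..J} x) * (indicat_real {0..T} t * (1 / sqrt t))) p)"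
        using M_pos st.B_nonneg by (auto simp: K2_def p QT_def indicator_def split: if_splits)
    qed
  qed
  have slice_K: "indicat_real {0<..<T} t * slice t = (LINT x|lborel. K1 (x, t) - K2 (x, t))" for t
    unfolding K_eq slice_def by (auto simp: QT_def indicator_def intro!: Bochner_Integration.integral_cong)
  have D_int: "integrable (lborel \<Otimes>\<^sub>M lborel) (\<lambda>(x, t). K1 (x, t) - K2 (x, t))"
    using Bochner_Integration.integrable_diff[OF K1_int K2_int] by (simp add: case_prod_beta')
  have slice_int: "integrable lborel (\<lambda>t. indicat_real {0<..<T} t * slice t)"
    unfolding slice_K by (rule lborel_pair.integrable_snd[OF D_int])
  have full: "(LINT t|lborel. indicat_real {0<..<T} t * slice t)
      = (LINT p|lebesgue_on (QT T). w p * \<Psi>t p) - (LINT p|lebesgue_on (QT T). wx p * \<Psi>x p)"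
  proof -
    have "(LINT t|lborel. indicat_real {0<..<T} t * slice t) = (LINT p|(lborel \<Otimes>\<^sub>M lborel). K1 p - K2 p)"
      unfolding slice_K using lborel_pair.integral_snd[OF D_int] by (simp add: case_prod_beta')
    also have "\<dots> = (LINT p|(lborel \<Otimes>\<^sub>M lborel). K1 p) - (LINT p|(lborel \<Otimes>\<^sub>M lborel). K2 p)"
      by (rule Bochner_Integration.integral_diff[OF K1_int K2_int])
    finally show ?thesis
      using lebesgue_on_QT_integral[of T "\<lambda>p. w p * \<Psi>t p"] lebesgue_on_QT_integral[of T "\<lambda>p. wx p * \<Psi>x p"]
      by (simp add: K1_def[symmetric] K2_def[symmetric])
  qed
  have lim1: "(\<lambda>n. LINT t|lborel. indicat_real {?\<tau> n<..<T} t * slice t) \<longlonglongrightarrow> (LINT t|lborel. indicat_real {0<..<T} t * slice t)"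
  proof (rule integral_dominated_convergence[where w = "\<lambda>t. \<bar>indicat_real {0<..<T} t * slice t\<bar>"])
    show "AE t in lborel. (\<lambda>n. indicat_real {?\<tau> n<..<T} t * slice t) \<longlonglongrightarrow> indicat_real {0<..<T} t * slice t"
    proof (rule AE_I2)
      fix t
      show "(\<lambda>n. indicat_real {?\<tau> n<..<T} t * slice t) \<longlonglongrightarrow> indicat_real {0<..<T} t * slice t"
      proof (cases "t > 0")
        case True
        from order_tendstoD(2)[OF \<tau>_lim this] show ?thesis
          by (intro tendsto_eventually, elim eventually_mono) (auto simp: indicator_def True)
      next
        case False
        have "t \<notin> {?\<tau> n<..<T}" for n using \<tau>[of n] False by auto
        then show ?thesis using False by simp
      qed
    qed
    have "(\<lambda>t. indicat_real {?\<tau> n<..<T} t * (indicat_real {0<..<T} t * slice t)) \<in> borel_measurable lborel" for n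
      using borel_measurable_integrable[OF slice_int]
      by (rule borel_measurable_times[rotated]) measurable
    moreover have "(\<lambda>t. indicat_real {?\<tau> n<..<T} t * (indicat_real {0<..<T} t * slice t)) = (\<lambda>t. indicat_real {?\<tau> n<..<T} t * slice t)" for n
      using \<tau>[of n] by (auto simp: indicator_def fun_eq_iff)
    ultimately show "(\<lambda>t. indicat_real {?\<tau> n<..<T} t * slice t) \<in> borel_measurable lborel" for n by simp
    show "AE t in lborel. norm (indicat_real {?\<tau> n<..<T} t * slice t) \<le> \<bar>indicat_real {0<..<T} t * slice t\<bar>" for n
      using \<tau>[of n] by (intro AE_I2) (auto simp: indicator_def)
  qed (use slice_int in auto)
  have lim2: "(\<lambda>n. LINT x|lborel. w (x, ?\<tau> n) * st.Z (x, ?\<tau> n)) \<longlonglongrightarrow> (LINT x|lborel. initial_datum U V x * st.Z (x, 0))"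
  proof (rule integral_dominated_convergence[where w = "\<lambda>x. mU * B * indicat_real {- J..J} x"])
    have [measurable]: "(\<lambda>x. w (x, t)) \<in> borel_measurable borel" for t
      unfolding w_def fst_conv snd_conv by measurable
    show "(\<lambda>x. w (x, ?\<tau> n) * st.Z (x, ?\<tau> n)) \<in> borel_measurable lborel" for n by measurable
    have [measurable]: "initial_datum U V \<in> borel_measurable borel"
      unfolding initial_datum_def[abs_def] by measurable
    show "(\<lambda>x. initial_datum U V x * st.Z (x, 0)) \<in> borel_measurable lborel" by measurable
    show "AE x in lborel. (\<lambda>n. w (x, ?\<tau> n) * st.Z (x, ?\<tau> n)) \<longlonglongrightarrow> initial_datum U V x * st.Z (x, 0)"
      using AE_lborel_singleton[of 0]
    proof eventually_elim
      case (elim x)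
      have "(\<lambda>n. \<Psi> (x, ?\<tau> n)) \<longlonglongrightarrow> \<Psi> (x, 0)"
      proof (rule continuous_on_tendsto_compose[OF st.continuous_strip(1)])
        show "(\<lambda>n. (x, ?\<tau> n)) \<longlonglongrightarrow> (x, 0)" by (intro tendsto_intros \<tau>_lim)
        show "\<forall>\<^sub>F n in sequentially. (x, ?\<tau> n) \<in> UNIV \<times> {0..T}"
        proof (intro always_eventually allI)
          show "(x, ?\<tau> n) \<in> UNIV \<times> {0..T}" for n using \<tau>[of n] by auto
        qed
      qed (use T in auto)
      moreover have "st.Z (x, ?\<tau> n) = \<Psi> (x, ?\<tau> n)" for n using \<tau>[of n] by (intro st.Z_eq) auto
      moreover have "st.Z (x, 0) = \<Psi> (x, 0)" using T by (intro st.Z_eq) auto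
      ultimately have Zlim: "(\<lambda>n. st.Z (x, ?\<tau> n)) \<longlonglongrightarrow> st.Z (x, 0)" by simp
      have inv_lim: "filterlim (\<lambda>n. 1 / sqrt (?\<tau> n)) at_top sequentially"
      proof -
        have "(\<lambda>n. sqrt (?\<tau> n)) \<longlonglongrightarrow> sqrt 0" by (intro tendsto_real_sqrt \<tau>_lim)
        then have "filterlim (\<lambda>n. sqrt (?\<tau> n)) (at_right 0) sequentially"
          using \<tau> by (auto simp: filterlim_at intro!: always_eventually)
        then show ?thesis using filterlim_compose[OF filterlim_inverse_at_top_right] by (simp add: inverse_eq_divide)
      qed
      have "(\<lambda>n. w (x, ?\<tau> n)) \<longlonglongrightarrow> initial_datum U V x"
      proof (cases "x < 0")
        case True
        have "filterlim (\<lambda>n. x * (1 / sqrt (?\<tau> n))) at_bot sequentially"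
          by (rule filterlim_tendsto_neg_mult_at_bot[OF tendsto_const True inv_lim])
        then have "(\<lambda>n. f (x * (1 / sqrt (?\<tau> n)))) \<longlonglongrightarrow> U" by (rule filterlim_compose[OF f_bot])
        then show ?thesis using True by (simp add: w_def initial_datum_def)
      next
        case False
        then have x: "x > 0" using elim by simp
        have "filterlim (\<lambda>n. x * (1 / sqrt (?\<tau> n))) at_top sequentially"
          by (rule filterlim_tendsto_pos_mult_at_top[OF tendsto_const x inv_lim])
        then have "eventually (\<lambda>n. a \<le> x * (1 / sqrt (?\<tau> n))) sequentially" by (simp add: filterlim_at_top)
        then have "eventually (\<lambda>n. w (x, ?\<tau> n) = - V) sequentially"
          by eventually_elim (simp add: w_def f_right)
        then show ?thesis using False by (simp add: initial_datum_def tendsto_eventually)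
      qed
      then show ?case by (intro tendsto_mult Zlim)
    qed
    show "AE x in lborel. norm (w (x, ?\<tau> n) * st.Z (x, ?\<tau> n)) \<le> mU * B * indicat_real {- J..J} x" for n
    proof (rule AE_I2)
      fix x
      have "\<bar>w (x, ?\<tau> n)\<bar> * \<bar>st.Z (x, ?\<tau> n)\<bar> \<le> mU * (B * indicat_real {- J..J} x)"
        using st.bound_interior(1)[OF \<tau>[of n], of x] \<tau>[of n] f_bound mU_pos
        by (intro mult_mono) (auto simp: w_def st.Z_eq)
      then show "norm (w (x, ?\<tau> n) * st.Z (x, ?\<tau> n)) \<le> mU * B * indicat_real {- J..J} x"
        by (simp add: abs_mult mult.assoc)
    qed
  qed auto
  have "(\<lambda>n. - (LINT x|lborel. w (x, ?\<tau> n) * st.Z (x, ?\<tau> n))) \<longlonglongrightarrow> - (LINT x|lborel. initial_datum U V x * st.Z (x, 0))"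
    by (rule tendsto_minus[OF lim2])
  then have "(LINT t|lborel. indicat_real {0<..<T} t * slice t) = - (LINT x|lborel. initial_datum U V x * st.Z (x, 0))"
    using lim1 unfolding slice_integral[OF \<tau>] by (rule LIMSEQ_unique[rotated])
  moreover have "(LINT x|lborel. initial_datum U V x * st.Z (x, 0)) = (LINT x|lebesgue. initial_datum U V x * \<Psi> (x, 0))"
  proof -
    have "(\<lambda>x. initial_datum U V x * \<Psi> (x, 0)) = (\<lambda>x. initial_datum U V x * st.Z (x, 0))"
      using T by (simp add: st.Z_eq)
    moreover have "(\<lambda>x. initial_datum U V x * st.Z (x, 0)) \<in> borel_measurable lborel"
      unfolding initial_datum_def[abs_def] by measurable
    ultimately show ?thesis by (simp only: integral_completion)
  qed
  ultimately show ?thesis using full by simp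
qed

end

lemma weak_solution_w: "weak_solution \<phi> U V what T w"
  unfolding weak_solution_def
proof (intro conjI exI[of _ wx] allI impI Linfty_w L2_W12_w weak_dx_w)
  fix \<Psi> \<Psi>x \<Psi>t assume "test_function T \<Psi> \<Psi>x \<Psi>t"
  then obtain J B where "strip_test T \<Psi> \<Psi>x \<Psi>t J B" using strip_test_exists[OF T] by blast
  then show "(LINT x|lebesgue. initial_datum U V x * \<Psi> (x, 0)) + (LINT p|lebesgue_on (QT T). w p * \<Psi>t p)
    = (LINT p|lebesgue_on (QT T). wx p * \<Psi>x p)"
    by (rule weak_identity)
qed

end

section \<open>The difference of two solutions\<close>

lemma AE_plane_fst:
  fixes Q :: "real \<times> real \<Rightarrow> bool"
  assumes "Measurable.pred borel Q"
  shows "(AE p in lborel \<Otimes>\<^sub>M lborel. Q p) \<longleftrightarrow> (AE x in lborel. AE t in lborel. Q (x, t))"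
proof -
  have "{p \<in> space (lborel \<Otimes>\<^sub>M lborel). Q p} \<in> sets (lborel \<Otimes>\<^sub>M lborel)"
    unfolding lborel_prod using assms by (simp add: pred_def)
  then show ?thesis using lborel_pair.AE_pair_iff[of "\<lambda>x t. Q (x, t)"] by simp
qed

lemma AE_plane_commute:
  fixes Q :: "real \<times> real \<Rightarrow> bool"
  assumes "Measurable.pred borel Q"
  shows "(AE x in lborel. AE t in lborel. Q (x, t)) \<longleftrightarrow> (AE t in lborel. AE x in lborel. Q (x, t))"
proof -
  have "{p \<in> space (lborel \<Otimes>\<^sub>M lborel). Q p} \<in> sets (lborel \<Otimes>\<^sub>M lborel)"
    unfolding lborel_prod using assms by (simp add: pred_def)
  then show ?thesis using lborel_pair.AE_commute[of "\<lambda>x t. Q (x, t)"] by simp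
qed

text \<open>The exceptional set need not be measurable; covering it by a measurable null set makes
  the theorem on sections applicable.\<close>

lemma AE_plane_snd_dest:
  fixes Q :: "real \<times> real \<Rightarrow> bool"
  assumes "AE p in lborel \<Otimes>\<^sub>M lborel. Q p"
  shows "AE t in lborel. AE x in lborel. Q (x, t)"
proof -
  obtain N where N: "N \<in> null_sets (lborel \<Otimes>\<^sub>M lborel)" "{p. \<not> Q p} \<subseteq> N"
    using assms by (auto simp: eventually_ae_filter space_pair_measure)
  have [measurable]: "N \<in> sets borel" using N(1) by (simp add: lborel_prod null_sets_def)
  have pred: "Measurable.pred borel (\<lambda>p. p \<notin> N)" by measurable
  have "AE p in lborel \<Otimes>\<^sub>M lborel. p \<notin> N" by (rule AE_not_in[OF N(1)])
  then have "AE t in lborel. AE x in lborel. (x, t) \<notin> N"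
    using AE_plane_fst[OF pred] AE_plane_commute[OF pred] by simp
  then show ?thesis by eventually_elim (elim eventually_mono, use N(2) in auto)
qed

text \<open>Use |h| <= 1 + h^2; the function \<open>K\<close> pays for the 1 wherever
  \<open>h\<close> does not vanish.\<close>

lemma integrable_on_bounded_if_square_integrable:
  fixes h K :: "'a \<Rightarrow> real"
  assumes [measurable]: "h \<in> borel_measurable M" and sq: "integrable M (\<lambda>x. (h x)\<^sup>2)"
    and K: "integrable M K" and K_nonneg: "\<And>x. 0 \<le> K x" and K_ge: "\<And>x. x \<in> space M \<Longrightarrow> h x \<noteq> 0 \<Longrightarrow> K x \<ge> 1"
  shows "integrable M h"
proof (rule Bochner_Integration.integrable_bound)
  show "integrable M (\<lambda>x. K x + (h x)\<^sup>2)" using K sq by (rule Bochner_Integration.integrable_add)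
  show "AE x in M. norm (h x) \<le> norm (K x + (h x)\<^sup>2)"
  proof (rule AE_I2)
    fix x assume x: "x \<in> space M"
    have "\<bar>h x\<bar> \<le> 1 + (h x)\<^sup>2" using zero_le_power2[of "\<bar>h x\<bar> - 1 / 2"] by (simp add: power2_eq_square algebra_simps)
    then show "norm (h x) \<le> norm (K x + (h x)\<^sup>2)"
      using K_ge[OF x] K_nonneg[of x] by (cases "h x = 0") auto
  qed
qed simp

lemma AE_lborel_reflect:
  assumes "AE x in lborel. Q (x :: real)" "Measurable.pred borel Q"
  shows "AE x in lborel. Q (- x)"
proof -
  have "AE x in distr lborel borel uminus. Q x" using assms(1) unfolding lborel_distr_uminus .
  then show ?thesis by (subst (asm) AE_distr_iff) (use assms(2) in \<open>auto simp: pred_def\<close>)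
qed

text \<open>\<open>z\<close> is the difference of two solutions, \<open>e\<close> that of their
  images under \<open>Dfun \<phi>\<close>, and \<open>d\<close> the x-derivative of
  \<open>e\<close>, all extended by zero in time. \<open>weak_z\<close> is the difference of two
  weak identities, tested with a bump times the integral of \<alpha> from t to T, which vanishes at
  T by construction; the initial data have cancelled. \<open>ze_zero\<close> amounts to
  \<open>e\<close> vanishing wherever \<open>z\<close> does.\<close>

locale difference_energy = smooth_step +
  fixes z e d :: "real \<times> real \<Rightarrow> real" and T C :: real
  assumes T: "T > 0"
    and borel_z [measurable]: "z \<in> borel_measurable borel" and borel_e [measurable]: "e \<in> borel_measurable borel"
    and borel_d [measurable]: "d \<in> borel_measurable borel"
    and z_le: "\<And>p. \<bar>z p\<bar> \<le> C"
    and out: "\<And>x t. t \<notin> {0<..<T} \<Longrightarrow> z (x, t) = 0 \<and> e (x, t) = 0 \<and> d (x, t) = 0"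
    and e2: "integrable (lborel \<Otimes>\<^sub>M lborel) (\<lambda>p. (e p)\<^sup>2)"
    and d2: "integrable (lborel \<Otimes>\<^sub>M lborel) (\<lambda>p. (d p)\<^sup>2)"
    and weak_e: "AE t in lborel. \<forall>n b c. (LINT x|lborel. e (x, t) * comb S n b c x) = - (LINT x|lborel. d (x, t) * bump n b c x)"
    and weak_z: "\<And>n b c \<alpha>. continuous_on UNIV \<alpha> \<Longrightarrow>
      (LINT p|(lborel \<Otimes>\<^sub>M lborel). z p * (bump n b c (fst p) * \<alpha> (snd p)))
      = - (LINT p|(lborel \<Otimes>\<^sub>M lborel). d p * (comb S n b c (fst p) * (LINT s|lborel. (if snd p \<le> s \<and> s \<le> T then \<alpha> s else 0))))"
    and ze_nonneg: "\<And>p. 0 \<le> z p * e p" and ze_zero: "\<And>p. z p * e p = 0 \<Longrightarrow> e p = 0"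
begin

text \<open>Integration from -\<infinity> is the same as from 0, because \<open>d\<close> vanishes
  outside the strip. A conditional under an integral with fixed domain makes joint measurability in
  x and t immediate.\<close>

definition H :: "real \<Rightarrow> real \<Rightarrow> real" where
  "H x t = (LINT s|lborel. (if s \<le> t then d (x, s) else 0))"

lemma C_nonneg: "C \<ge> 0" using z_le[of undefined] by linarith

lemma borel_sections [measurable]:
  "(\<lambda>x. e (x, t)) \<in> borel_measurable borel"
  "(\<lambda>x. d (x, t)) \<in> borel_measurable borel" "(\<lambda>t. d (x, t)) \<in> borel_measurable borel"
  by measurable

lemma borel_pair_iff: "h \<in> borel_measurable (lborel \<Otimes>\<^sub>M lborel) \<longleftrightarrow> h \<in> borel_measurable (borel :: (real \<times> real) measure)"
  by (simp add: lborel_prod)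

lemma borel_H [measurable]: "(\<lambda>p. H (fst p) (snd p)) \<in> borel_measurable borel"
proof -
  have "(\<lambda>p. LINT s|lborel. (if s \<le> snd p then d (fst p, s) else 0)) \<in> borel_measurable (borel :: (real \<times> real) measure)"
    by (intro lborel.borel_measurable_lebesgue_integral) measurable
  then show ?thesis by (simp add: H_def)
qed

lemma borel_H_section [measurable]: "(\<lambda>x. H x t) \<in> borel_measurable borel" "(\<lambda>t. H x t) \<in> borel_measurable borel"
proof -
  have "(\<lambda>x. (\<lambda>p. H (fst p) (snd p)) (x, t)) \<in> borel_measurable borel" by measurable
  then show "(\<lambda>x. H x t) \<in> borel_measurable borel" by simp
  have "(\<lambda>t. (\<lambda>p. H (fst p) (snd p)) (x, t)) \<in> borel_measurable borel" by measurable
  then show "(\<lambda>t. H x t) \<in> borel_measurable borel" by simp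
qed

lemma box_integrable: "integrable (lborel \<Otimes>\<^sub>M lborel) (\<lambda>(x, t). indicat_real {a..b :: real} x * indicat_real {0..T} t)"
  by (rule integrable_pair_product) auto

lemma box_integrable_if_square:
  fixes a b :: real
  assumes [measurable]: "h \<in> borel_measurable borel" and sq: "integrable (lborel \<Otimes>\<^sub>M lborel) (\<lambda>p. (h p)\<^sup>2)"
    and h_out: "\<And>x t. t \<notin> {0<..<T} \<Longrightarrow> h (x, t) = 0"
  shows "integrable (lborel \<Otimes>\<^sub>M lborel) (\<lambda>(x, t). indicat_real {a..b} x * h (x, t))"
proof (rule integrable_on_bounded_if_square_integrable[OF _ _ box_integrable[of a b]])
  have *: "(\<lambda>p. indicat_real {a..b} (fst p) * h p) \<in> borel_measurable borel" by measurable
  then show "(\<lambda>(x, t). indicat_real {a..b} x * h (x, t)) \<in> borel_measurable (lborel \<Otimes>\<^sub>M lborel)"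
    by (simp add: borel_pair_iff case_prod_beta')
  show "integrable (lborel \<Otimes>\<^sub>M lborel) (\<lambda>p. ((\<lambda>(x, t). indicat_real {a..b} x * h (x, t)) p)\<^sup>2)"
    by (rule Bochner_Integration.integrable_bound[OF sq])
       (use * in \<open>auto simp: borel_pair_iff case_prod_beta' indicator_def\<close>)
  fix p :: "real \<times> real"
  show "0 \<le> (\<lambda>(x, t). indicat_real {a..b} x * indicat_real {0..T} t) p" by (auto simp: case_prod_beta')
  assume nz: "(\<lambda>(x, t). indicat_real {a..b} x * h (x, t)) p \<noteq> 0"
  show "(\<lambda>(x, t). indicat_real {a..b} x * indicat_real {0..T} t) p \<ge> 1"
  proof -
    have "snd p \<in> {0<..<T}" using nz h_out[of "snd p" "fst p"] by (auto simp: case_prod_beta')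
    moreover have "fst p \<in> {a..b}" using nz by (auto simp: case_prod_beta' indicator_def split: if_splits)
    ultimately show "(\<lambda>(x, t). indicat_real {a..b} x * indicat_real {0..T} t) p \<ge> 1" by (simp add: case_prod_beta')
  qed
qed

lemma d_box: "integrable (lborel \<Otimes>\<^sub>M lborel) (\<lambda>(x, t). indicat_real {a..b} x * d (x, t))"
  using out by (intro box_integrable_if_square d2) auto

lemma e_box: "integrable (lborel \<Otimes>\<^sub>M lborel) (\<lambda>(x, t). indicat_real {a..b} x * e (x, t))"
  using out by (intro box_integrable_if_square e2) auto

lemma d_time_integrable:
  assumes "integrable lborel (\<lambda>s. (d (x, s))\<^sup>2)"
  shows "integrable lborel (\<lambda>s. d (x, s))"
proof (rule integrable_on_bounded_if_square_integrable[OF _ assms integrable_indicator_Icc[of 0 T]])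
  show "1 \<le> indicat_real {0..T} s" if "d (x, s) \<noteq> 0" for s
  proof -
    have "s \<in> {0<..<T}" using that out by blast
    then show ?thesis by simp
  qed
qed auto

text \<open>Cauchy-Schwarz on a time interval of length T, obtained by expanding the square of
  \<open>c s\<close> minus its mean y = H / T.\<close>

lemma H_square_le:
  assumes sq: "integrable lborel (\<lambda>s. (d (x, s))\<^sup>2)"
  shows "(H x t)\<^sup>2 \<le> T * (LINT s|lborel. (d (x, s))\<^sup>2)"
proof -
  define c where "c s = (if s \<le> t then d (x, s) else 0)" for s
  have [measurable]: "c \<in> borel_measurable borel" unfolding c_def[abs_def] by measurable
  have c2: "integrable lborel (\<lambda>s. (c s)\<^sup>2)"
    by (rule Bochner_Integration.integrable_bound[OF sq]) (auto simp: c_def)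
  have c1: "integrable lborel c"
    by (rule Bochner_Integration.integrable_bound[OF d_time_integrable[OF sq]]) (auto simp: c_def)
  have c_ind: "indicat_real {0..T} s * c s = c s" for s
  proof (cases "s \<in> {0<..<T}")
    case False
    then show ?thesis using out[of s x] by (simp add: c_def)
  qed auto
  define y where "y = H x t / T"
  have "0 \<le> (LINT s|lborel. (c s - y * indicat_real {0..T} s)\<^sup>2)" by simp
  also have "\<dots> = (LINT s|lborel. (c s)\<^sup>2 - (2 * y) * c s + y\<^sup>2 * indicat_real {0..T} s)"
  proof (rule Bochner_Integration.integral_cong)
    fix s
    show "(c s - y * indicat_real {0..T} s)\<^sup>2 = (c s)\<^sup>2 - (2 * y) * c s + y\<^sup>2 * indicat_real {0..T} s"
      using c_ind[of s] by (cases "s \<in> {0..T}") (auto simp: power2_eq_square algebra_simps)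
  qed simp
  also have "\<dots> = (LINT s|lborel. (c s)\<^sup>2) - (2 * y) * (LINT s|lborel. c s) + y\<^sup>2 * T"
    using c1 c2 T by (simp add: Bochner_Integration.integral_add Bochner_Integration.integral_diff)
  also have "(LINT s|lborel. c s) = y * T" using T by (simp add: y_def H_def c_def)
  finally have "y\<^sup>2 * T \<le> (LINT s|lborel. (c s)\<^sup>2)" by (simp add: power2_eq_square algebra_simps)
  also have "\<dots> \<le> (LINT s|lborel. (d (x, s))\<^sup>2)"
    by (rule integral_mono[OF c2 sq]) (auto simp: c_def)
  finally have "T * (y\<^sup>2 * T) \<le> T * (LINT s|lborel. (d (x, s))\<^sup>2)" using T by simp
  moreover have "T * (y\<^sup>2 * T) = (H x t)\<^sup>2" using T by (simp add: y_def power2_eq_square)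
  ultimately show ?thesis by simp
qed

lemma AE_d_square_integrable: "AE x in lborel. integrable lborel (\<lambda>s. (d (x, s))\<^sup>2)"
  using lborel_pair.AE_integrable_fst'[OF d2] by simp

text \<open>The pointwise bound is uniform in time, so integration over {0..T} costs one more factor
  T. The cut is essential: after T the function \<open>H x\<close> keeps its final value.\<close>

lemma H_square_integrable: "integrable (lborel \<Otimes>\<^sub>M lborel) (\<lambda>(x, t). indicat_real {0..T} t * (H x t)\<^sup>2)"
proof (rule Bochner_Integration.integrable_bound)
  let ?D = "\<lambda>x. LINT s|lborel. (d (x, s))\<^sup>2"
  have "integrable lborel ?D" using lborel_pair.integrable_fst'[OF d2] by simp
  then show "integrable (lborel \<Otimes>\<^sub>M lborel) (\<lambda>(x, t). ?D x * (T * indicat_real {0..T} t))"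
    by (intro integrable_pair_product) auto
  have D_meas [measurable]: "?D \<in> borel_measurable borel" by measurable
  have "(\<lambda>p. indicat_real {0..T} (snd p) * (H (fst p) (snd p))\<^sup>2) \<in> borel_measurable borel" by measurable
  then show "(\<lambda>(x, t). indicat_real {0..T} t * (H x t)\<^sup>2) \<in> borel_measurable (lborel \<Otimes>\<^sub>M lborel)"
    by (simp add: borel_pair_iff case_prod_beta')
  have "AE p in lborel \<Otimes>\<^sub>M lborel. norm (indicat_real {0..T} (snd p) * (H (fst p) (snd p))\<^sup>2) \<le> norm (?D (fst p) * (T * indicat_real {0..T} (snd p)))"
  proof (subst AE_plane_fst)
    show "AE x in lborel. AE t in lborel. norm (indicat_real {0..T} (snd (x, t)) * (H (fst (x, t)) (snd (x, t)))\<^sup>2)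
        \<le> norm (?D (fst (x, t)) * (T * indicat_real {0..T} (snd (x, t))))"
      using AE_d_square_integrable
    proof eventually_elim
      case (elim x)
      show ?case using H_square_le[OF elim] T by (intro AE_I2) (auto simp: indicator_def abs_mult mult.commute)
    qed
  qed measurable
  then show "AE p in lborel \<Otimes>\<^sub>M lborel. norm ((\<lambda>(x, t). indicat_real {0..T} t * (H x t)\<^sup>2) p)
      \<le> norm ((\<lambda>(x, t). ?D x * (T * indicat_real {0..T} t)) p)"
    by (simp add: case_prod_beta')
qed

lemma H_product_integrable:
  assumes [measurable]: "h \<in> borel_measurable borel" and sq: "integrable (lborel \<Otimes>\<^sub>M lborel) (\<lambda>p. (h p)\<^sup>2)"
    and h_out: "\<And>x t. t \<notin> {0<..<T} \<Longrightarrow> h (x, t) = 0"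
  shows "integrable (lborel \<Otimes>\<^sub>M lborel) (\<lambda>(x, t). H x t * h (x, t))"
proof (rule Bochner_Integration.integrable_bound[OF Bochner_Integration.integrable_add[OF H_square_integrable sq]])
  have "(\<lambda>p. H (fst p) (snd p) * h p) \<in> borel_measurable borel" by measurable
  then show "(\<lambda>(x, t). H x t * h (x, t)) \<in> borel_measurable (lborel \<Otimes>\<^sub>M lborel)"
    by (simp add: borel_pair_iff case_prod_beta')
  show "AE p in lborel \<Otimes>\<^sub>M lborel. norm ((\<lambda>(x, t). H x t * h (x, t)) p)
      \<le> norm ((\<lambda>(x, t). indicat_real {0..T} t * (H x t)\<^sup>2) p + (h p)\<^sup>2)"
  proof (rule AE_I2)
    fix p :: "real \<times> real"
    obtain x t where p: "p = (x, t)" by fastforce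
    have "2 * \<bar>H x t * h (x, t)\<bar> \<le> (H x t)\<^sup>2 + (h (x, t))\<^sup>2"
      using zero_le_power2[of "\<bar>H x t\<bar> - \<bar>h (x, t)\<bar>"] by (simp add: power2_eq_square algebra_simps abs_mult)
    then have "\<bar>H x t * h (x, t)\<bar> \<le> (H x t)\<^sup>2 + (h (x, t))\<^sup>2"
      using abs_ge_zero[of "H x t * h (x, t)"] by linarith
    then show "norm ((\<lambda>(x, t). H x t * h (x, t)) p) \<le> norm ((\<lambda>(x, t). indicat_real {0..T} t * (H x t)\<^sup>2) p + (h p)\<^sup>2)"
      using h_out[of t x] by (cases "t \<in> {0<..<T}") (auto simp: p)
  qed
qed

text \<open>Fubini moves the time integral from \<alpha> onto the flux, so the weak identity makes
  \<open>zb + \<Gamma>\<close> orthogonal to every continuous \<alpha>, hence zero almost everywhere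
  on the time interval. This is H_x = z tested with a single bump; the exceptional null set of times
  depends on n, b and c.\<close>

lemma space_potential:
  "AE t in lborel. t \<in> {0<..<T} \<longrightarrow> (LINT x|lborel. z (x, t) * bump n b c x) = - (LINT x|lborel. H x t * comb S n b c x)"
proof -
  obtain K J where K: "K \<ge> 0" "\<And>x. \<bar>comb S n b c x\<bar> \<le> K * indicat_real {- J..J} x"
    "\<And>x. \<bar>bump n b c x\<bar> \<le> K * indicat_real {- J..J} x"
    using test_bounds by metis
  define zb where "zb t = (LINT x|lborel. z (x, t) * bump n b c x)" for t
  define g where "g t = (LINT x|lborel. d (x, t) * comb S n b c x)" for t
  define \<Gamma> where "\<Gamma> t = (LINT s|lborel. (if s \<le> t then g s else 0))" for t
  have zb_int2: "integrable (lborel \<Otimes>\<^sub>M lborel) (\<lambda>(x, t). z (x, t) * bump n b c x)"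
  proof (rule Bochner_Integration.integrable_bound[OF integrable_mult_right[OF box_integrable, of "C * K" "- J" J]])
    have "(\<lambda>p. z p * bump n b c (fst p)) \<in> borel_measurable borel" by measurable
    then show "(\<lambda>(x, t). z (x, t) * bump n b c x) \<in> borel_measurable (lborel \<Otimes>\<^sub>M lborel)"
      by (simp add: borel_pair_iff case_prod_beta')
    show "AE p in lborel \<Otimes>\<^sub>M lborel. norm ((\<lambda>(x, t). z (x, t) * bump n b c x) p)
        \<le> norm (C * K * (\<lambda>(x, t). indicat_real {- J..J} x * indicat_real {0..T} t) p)"
    proof (rule AE_I2)
      fix p :: "real \<times> real"
      obtain x t where p: "p = (x, t)" by fastforce
      have "\<bar>z (x, t)\<bar> * \<bar>bump n b c x\<bar> \<le> C * (K * indicat_real {- J..J} x)"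
        using z_le[of "(x, t)"] K C_nonneg by (intro mult_mono) auto
      then show "norm ((\<lambda>(x, t). z (x, t) * bump n b c x) p)
        \<le> norm (C * K * (\<lambda>(x, t). indicat_real {- J..J} x * indicat_real {0..T} t) p)"
        using out[of t x] C_nonneg K(1) by (cases "t \<in> {0<..<T}") (auto simp: p abs_mult)
    qed
  qed
  have dc_int: "integrable (lborel \<Otimes>\<^sub>M lborel) (\<lambda>(x, t). d (x, t) * comb S n b c x)"
  proof (rule Bochner_Integration.integrable_bound[OF integrable_mult_right[OF d_box, of K "- J" J]])
    have "(\<lambda>p. d p * comb S n b c (fst p)) \<in> borel_measurable borel" by measurable
    then show "(\<lambda>(x, t). d (x, t) * comb S n b c x) \<in> borel_measurable (lborel \<Otimes>\<^sub>M lborel)"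
      by (simp add: borel_pair_iff case_prod_beta')
    show "AE p in lborel \<Otimes>\<^sub>M lborel. norm ((\<lambda>(x, t). d (x, t) * comb S n b c x) p)
        \<le> norm (K * (\<lambda>(x, t). indicat_real {- J..J} x * d (x, t)) p)"
    proof (rule AE_I2)
      fix p :: "real \<times> real"
      obtain x t where p: "p = (x, t)" by fastforce
      have "\<bar>d (x, t)\<bar> * \<bar>comb S n b c x\<bar> \<le> \<bar>d (x, t)\<bar> * (K * indicat_real {- J..J} x)"
        using K by (intro mult_left_mono) auto
      then show "norm ((\<lambda>(x, t). d (x, t) * comb S n b c x) p) \<le> norm (K * (\<lambda>(x, t). indicat_real {- J..J} x * d (x, t)) p)"
        using K(1) by (simp add: p abs_mult mult_ac)
    qed
  qed
  have zb_int: "integrable lborel zb"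
    unfolding zb_def by (rule lborel_pair.integrable_snd[OF zb_int2])
  have g_int: "integrable lborel g"
    unfolding g_def by (rule lborel_pair.integrable_snd[OF dc_int])
  have [measurable]: "zb \<in> borel_measurable borel" "g \<in> borel_measurable borel"
    using zb_int g_int by auto
  have g_out: "g t = 0" if "t \<notin> {0<..<T}" for t using out[OF that] by (simp add: g_def)
  have \<Gamma>_meas [measurable]: "\<Gamma> \<in> borel_measurable borel"
    unfolding \<Gamma>_def[abs_def] by measurable
  have \<Gamma>_le: "\<bar>\<Gamma> t\<bar> \<le> (LINT s|lborel. \<bar>g s\<bar>)" for t
  proof -
    have "\<bar>\<Gamma> t\<bar> \<le> (LINT s|lborel. norm (if s \<le> t then g s else 0))"
      unfolding \<Gamma>_def real_norm_def[symmetric] by (rule integral_norm_bound)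
    also have "\<dots> \<le> (LINT s|lborel. \<bar>g s\<bar>)"
    proof (rule integral_mono)
      show "integrable lborel (\<lambda>s. norm (if s \<le> t then g s else 0))"
        by (rule Bochner_Integration.integrable_bound[OF g_int]) auto
    qed (use g_int in auto)
    finally show ?thesis .
  qed
  define Y where "Y t = zb t + indicat_real {0..T} t * \<Gamma> t" for t
  have \<Gamma>_int: "integrable lborel (\<lambda>t. indicat_real {0..T} t * \<Gamma> t)"
    by (rule Bochner_Integration.integrable_bound[OF integrable_mult_right[OF integrable_indicator_Icc, of "LINT s|lborel. \<bar>g s\<bar>" 0 T]])
       (use \<Gamma>_le in \<open>auto simp: indicator_def intro!: AE_I2 order_trans[OF _ abs_ge_self]\<close>)
  have "AE t in lborel. Y t = 0"
  proof (rule AE_zero_if_continuous_tests_zero)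
    show Y_int: "integrable lborel Y" unfolding Y_def[abs_def] using zb_int \<Gamma>_int by (rule Bochner_Integration.integrable_add)
    fix \<alpha> :: "real \<Rightarrow> real" assume \<alpha>: "continuous_on UNIV \<alpha>"
    have [measurable]: "\<alpha> \<in> borel_measurable borel" by (rule borel_measurable_continuous_onI[OF \<alpha>])
    have "compact (\<alpha> ` {0..T})" by (intro compact_continuous_image continuous_on_subset[OF \<alpha>]) auto
    then obtain L where L: "\<And>t. t \<in> {0..T} \<Longrightarrow> \<bar>\<alpha> t\<bar> \<le> L"
      by (auto dest!: compact_imp_bounded simp: bounded_iff simp del: atLeastAtMost_iff, blast)
    have L0: "L \<ge> 0" using L[of 0] T by force
    define \<theta> where "\<theta> t = (LINT s|lborel. (if t \<le> s \<and> s \<le> T then \<alpha> s else 0))" for t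
    have [measurable]: "\<theta> \<in> borel_measurable borel" unfolding \<theta>_def[abs_def] by measurable
    have \<theta>_le: "\<bar>\<theta> t\<bar> \<le> L * T" if "t \<in> {0<..<T}" for t
    proof -
      have int: "integrable lborel (\<lambda>s. if t \<le> s \<and> s \<le> T then \<alpha> s else 0)"
        by (rule Bochner_Integration.integrable_bound[OF integrable_mult_right[OF integrable_indicator_Icc, of L 0 T]])
           (use L L0 that in \<open>auto intro!: AE_I2\<close>)
      have "\<bar>\<theta> t\<bar> \<le> (LINT s|lborel. norm (if t \<le> s \<and> s \<le> T then \<alpha> s else 0))"
        unfolding \<theta>_def real_norm_def[symmetric] by (rule integral_norm_bound)
      also have "\<dots> \<le> (LINT s|lborel. L * indicat_real {0..T} s)"
        by (rule integral_mono[OF integrable_norm[OF int] integrable_mult_right[OF integrable_indicator_Icc]])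
           (use L L0 that in \<open>auto simp: indicator_def\<close>)
      also have "\<dots> = L * T" using T by simp
      finally show ?thesis .
    qed
    have 1: "(LINT p|(lborel \<Otimes>\<^sub>M lborel). z p * (bump n b c (fst p) * \<alpha> (snd p))) = (LINT t|lborel. \<alpha> t * zb t)"
    proof -
      have int: "integrable (lborel \<Otimes>\<^sub>M lborel) (\<lambda>(x, t). z (x, t) * (bump n b c x * \<alpha> t))"
      proof (rule Bochner_Integration.integrable_bound[OF integrable_mult_right[OF zb_int2, of L]])
        have "(\<lambda>p. z p * (bump n b c (fst p) * \<alpha> (snd p))) \<in> borel_measurable borel" by measurable
        then show "(\<lambda>(x, t). z (x, t) * (bump n b c x * \<alpha> t)) \<in> borel_measurable (lborel \<Otimes>\<^sub>M lborel)"
          by (simp add: borel_pair_iff case_prod_beta')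
        show "AE p in lborel \<Otimes>\<^sub>M lborel. norm ((\<lambda>(x, t). z (x, t) * (bump n b c x * \<alpha> t)) p)
            \<le> norm (L * (\<lambda>(x, t). z (x, t) * bump n b c x) p)"
        proof (rule AE_I2)
          fix p :: "real \<times> real"
          obtain x t where p: "p = (x, t)" by fastforce
          have "\<bar>\<alpha> t\<bar> * \<bar>z (x, t) * bump n b c x\<bar> \<le> L * \<bar>z (x, t) * bump n b c x\<bar>" if "t \<in> {0<..<T}"
            using L[of t] that by (intro mult_right_mono) auto
          then show "norm ((\<lambda>(x, t). z (x, t) * (bump n b c x * \<alpha> t)) p) \<le> norm (L * (\<lambda>(x, t). z (x, t) * bump n b c x) p)"
            using out[of t x] L0 by (cases "t \<in> {0<..<T}") (auto simp: p abs_mult mult_ac)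
        qed
      qed
      have "(LINT t|lborel. \<alpha> t * zb t) = (LINT t|lborel. LINT x|lborel. z (x, t) * (bump n b c x * \<alpha> t))"
        unfolding zb_def by (intro Bochner_Integration.integral_cong refl, subst integral_mult_right_zero[symmetric]) (simp add: mult_ac)
      then show ?thesis using lborel_pair.integral_snd[OF int] by (simp add: case_prod_beta')
    qed
    have 2: "(LINT p|(lborel \<Otimes>\<^sub>M lborel). d p * (comb S n b c (fst p) * \<theta> (snd p))) = (LINT t|lborel. \<theta> t * g t)"
    proof -
      have int: "integrable (lborel \<Otimes>\<^sub>M lborel) (\<lambda>(x, t). d (x, t) * (comb S n b c x * \<theta> t))"
      proof (rule Bochner_Integration.integrable_bound[OF integrable_mult_right[OF dc_int, of "L * T"]])
        have "(\<lambda>p. d p * (comb S n b c (fst p) * \<theta> (snd p))) \<in> borel_measurable borel" by measurable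
        then show "(\<lambda>(x, t). d (x, t) * (comb S n b c x * \<theta> t)) \<in> borel_measurable (lborel \<Otimes>\<^sub>M lborel)"
          by (simp add: borel_pair_iff case_prod_beta')
        show "AE p in lborel \<Otimes>\<^sub>M lborel. norm ((\<lambda>(x, t). d (x, t) * (comb S n b c x * \<theta> t)) p)
            \<le> norm (L * T * (\<lambda>(x, t). d (x, t) * comb S n b c x) p)"
        proof (rule AE_I2)
          fix p :: "real \<times> real"
          obtain x t where p: "p = (x, t)" by fastforce
          have "\<bar>\<theta> t\<bar> * \<bar>d (x, t) * comb S n b c x\<bar> \<le> (L * T) * \<bar>d (x, t) * comb S n b c x\<bar>" if "t \<in> {0<..<T}"
            by (intro mult_right_mono \<theta>_le that) auto
          then show "norm ((\<lambda>(x, t). d (x, t) * (comb S n b c x * \<theta> t)) p) \<le> norm (L * T * (\<lambda>(x, t). d (x, t) * comb S n b c x) p)"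
            using out[of t x] L0 T by (cases "t \<in> {0<..<T}") (auto simp: p abs_mult mult_ac)
        qed
      qed
      have "(LINT t|lborel. \<theta> t * g t) = (LINT t|lborel. LINT x|lborel. d (x, t) * (comb S n b c x * \<theta> t))"
        unfolding g_def by (intro Bochner_Integration.integral_cong refl, subst integral_mult_right_zero[symmetric]) (simp add: mult_ac)
      then show ?thesis using lborel_pair.integral_snd[OF int] by (simp add: case_prod_beta')
    qed
    have 3: "(LINT t|lborel. \<theta> t * g t) = (LINT s|lborel. \<alpha> s * (indicat_real {0..T} s * \<Gamma> s))"
    proof -
      \<comment> \<open>Interchanging the integrals over t <= s <= T converts the backward primitive
        of \<alpha> into the forward primitive of \<open>g\<close>.\<close>
      define k where "k = (\<lambda>(s, t). if t \<le> s \<and> s \<le> T then \<alpha> s * g t else 0)"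
      have int: "integrable (lborel \<Otimes>\<^sub>M lborel) k"
      proof (rule Bochner_Integration.integrable_bound)
        show "integrable (lborel \<Otimes>\<^sub>M lborel) (\<lambda>(s, t). (L * indicat_real {0..T} s) * g t)"
          by (rule integrable_pair_product[OF _ g_int]) auto
        show "k \<in> borel_measurable (lborel \<Otimes>\<^sub>M lborel)" unfolding k_def by measurable
        show "AE p in lborel \<Otimes>\<^sub>M lborel. norm (k p) \<le> norm ((\<lambda>(s, t). (L * indicat_real {0..T} s) * g t) p)"
        proof (rule AE_I2)
          fix p :: "real \<times> real"
          obtain s t where p: "p = (s, t)" by fastforce
          show "norm (k p) \<le> norm ((\<lambda>(s, t). (L * indicat_real {0..T} s) * g t) p)"
          proof (cases "t \<le> s \<and> s \<le> T \<and> t \<in> {0<..<T}")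
            case True
            then show ?thesis using L[of s] L0 by (auto simp: p k_def abs_mult intro!: mult_right_mono)
          next
            case False
            then show ?thesis using g_out[of t] by (auto simp: p k_def)
          qed
        qed
      qed
      have "(LINT t|lborel. \<theta> t * g t) = (LINT t|lborel. LINT s|lborel. k (s, t))"
      proof (rule Bochner_Integration.integral_cong)
        fix t
        have "\<theta> t * g t = (LINT s|lborel. g t * (if t \<le> s \<and> s \<le> T then \<alpha> s else 0))" by (simp add: \<theta>_def)
        also have "\<dots> = (LINT s|lborel. k (s, t))"
          by (rule Bochner_Integration.integral_cong) (auto simp: k_def)
        finally show "\<theta> t * g t = (LINT s|lborel. k (s, t))" .
      qed simp
      also have "\<dots> = (LINT s|lborel. LINT t|lborel. k (s, t))"
        using lborel_pair.Fubini_integral[of "\<lambda>s t. k (s, t)"] int by simp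
      also have "\<dots> = (LINT s|lborel. \<alpha> s * (indicat_real {0..T} s * \<Gamma> s))"
      proof (rule Bochner_Integration.integral_cong)
        fix s
        have "(LINT t|lborel. k (s, t)) = (LINT t|lborel. (\<alpha> s * indicat_real {..T} s) * (if t \<le> s then g t else 0))"
          by (rule Bochner_Integration.integral_cong) (auto simp: k_def indicator_def)
        also have "\<dots> = \<alpha> s * indicat_real {..T} s * \<Gamma> s" by (simp add: \<Gamma>_def)
        also have "\<dots> = \<alpha> s * (indicat_real {0..T} s * \<Gamma> s)"
        proof (cases "s < 0")
          case True
          then have *: "(if t \<le> s then g t else 0) = 0" for t using g_out[of t] by auto
          have "\<Gamma> s = 0" unfolding \<Gamma>_def * by simp
          then show ?thesis by simp
        qed (auto simp: indicator_def)
        finally show "(LINT t|lborel. k (s, t)) = \<alpha> s * (indicat_real {0..T} s * \<Gamma> s)" .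
      qed simp
      finally show ?thesis .
    qed
    have bounded_mult: "integrable lborel (\<lambda>t. \<alpha> t * h t)"
      if h: "integrable lborel h" and "\<And>t. t \<notin> {0..T} \<Longrightarrow> h t = 0" for h
    proof (rule Bochner_Integration.integrable_bound[OF integrable_mult_right[OF h, of L]])
      have "norm (\<alpha> t * h t) \<le> norm (L * h t)" for t
        using L[of t] that(2)[of t] L0 by (cases "t \<in> {0..T}") (auto simp: abs_mult intro!: mult_right_mono)
      then show "AE t in lborel. norm (\<alpha> t * h t) \<le> norm (L * h t)" by simp
    qed (use borel_measurable_integrable[OF h] in auto)
    have "(LINT t|lborel. \<alpha> t * Y t) = (LINT t|lborel. \<alpha> t * zb t + \<alpha> t * (indicat_real {0..T} t * \<Gamma> t))"
      by (simp add: Y_def distrib_left)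
    also have "\<dots> = (LINT t|lborel. \<alpha> t * zb t) + (LINT t|lborel. \<alpha> t * (indicat_real {0..T} t * \<Gamma> t))"
    proof (rule Bochner_Integration.integral_add[OF bounded_mult[OF zb_int] bounded_mult[OF \<Gamma>_int]])
      show "zb t = 0" if "t \<notin> {0..T}" for t
        using out[of t] that by (auto simp: zb_def)
    qed auto
    also have "\<dots> = 0" using weak_z[OF \<alpha>, of n b c] by (simp add: 1 2[unfolded \<theta>_def] 3[symmetric] \<theta>_def)
    finally show "(LINT t|lborel. \<alpha> t * Y t) = 0" .
  qed
  moreover have "\<Gamma> t = (LINT x|lborel. H x t * comb S n b c x)" for t
  proof -
    define k where "k = (\<lambda>(x, s). if s \<le> t then d (x, s) * comb S n b c x else 0)"
    have int: "integrable (lborel \<Otimes>\<^sub>M lborel) k"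
    proof (rule Bochner_Integration.integrable_bound[OF dc_int])
      have "(\<lambda>p. if snd p \<le> t then d p * comb S n b c (fst p) else 0) \<in> borel_measurable borel" by measurable
      then show "k \<in> borel_measurable (lborel \<Otimes>\<^sub>M lborel)" by (simp add: k_def borel_pair_iff case_prod_beta')
    qed (auto simp: k_def)
    have "\<Gamma> t = (LINT s|lborel. LINT x|lborel. k (x, s))"
      unfolding \<Gamma>_def g_def k_def by (intro Bochner_Integration.integral_cong) auto
    also have "\<dots> = (LINT x|lborel. LINT s|lborel. k (x, s))"
      using lborel_pair.Fubini_integral[of "\<lambda>x s. k (x, s)"] int by simp
    also have "\<dots> = (LINT x|lborel. H x t * comb S n b c x)"
    proof (rule Bochner_Integration.integral_cong)
      fix x
      have "(LINT s|lborel. k (x, s)) = (LINT s|lborel. (if s \<le> t then d (x, s) else 0) * comb S n b c x)"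
        by (rule Bochner_Integration.integral_cong) (auto simp: k_def)
      then show "(LINT s|lborel. k (x, s)) = H x t * comb S n b c x" by (simp add: H_def)
    qed simp
    finally show ?thesis .
  qed
  ultimately show ?thesis by (auto simp: Y_def zb_def elim!: eventually_mono)
qed

end

section \<open>The energy identity\<close>

lemma continuous_AE_zero_imp_zero:
  fixes F :: "real \<Rightarrow> real"
  assumes F: "continuous_on UNIV F" and ae: "AE x in lborel. F x = 0"
  shows "F c = 0"
proof -
  have cont: "continuous_on {c..c + 1} (\<lambda>x. \<bar>F x\<bar>)" by (intro continuous_intros continuous_on_subset[OF F]) auto
  have int: "set_integrable lborel {c..c + 1} (\<lambda>x. \<bar>F x\<bar>)"
    unfolding set_integrable_def by (rule borel_integrable_compact[OF _ cont]) simp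
  have "(LINT x:{c..c + 1}|lborel. \<bar>F x\<bar>) = 0"
    unfolding set_lebesgue_integral_def using ae by (intro integral_eq_zero_AE) (auto elim!: eventually_mono)
  then have "integral {c..c + 1} (\<lambda>x. \<bar>F x\<bar>) = 0" using set_borel_integral_eq_integral(2)[OF int] by simp
  then show ?thesis using integral_eq_0_iff[OF cont] by auto
qed

text \<open>A primitive is continuous, so vanishing almost everywhere means vanishing everywhere,
  and all increments are zero.\<close>

lemma primitive_AE_zero:
  assumes g: "locally_lborel_integrable g" and F: "primitive F g" and ae: "AE x in lborel. F x = 0"
  shows "AE x in lborel. g x = 0"
proof (rule AE_zero_if_interval_integrals_zero[OF g])
  have "F x = 0" for x by (rule continuous_AE_zero_imp_zero[OF primitive_continuous_on[OF g F] ae])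
  then show "(LINT x:{a..b}|lborel. g x) = 0" if "a \<le> b" for a b
    using F that by (auto simp: primitive_def)
qed

lemma locally_lborel_integrable_if_square:
  assumes [measurable]: "h \<in> borel_measurable borel" and sq: "integrable lborel (\<lambda>x. (h x)\<^sup>2)"
  shows "locally_lborel_integrable h"
  unfolding locally_lborel_integrable_def set_integrable_def
proof (intro allI)
  fix a b :: real
  show "integrable lborel (\<lambda>x. indicat_real {a..b} x *\<^sub>R h x)"
  proof (rule integrable_on_bounded_if_square_integrable[OF _ _ integrable_indicator_Icc[of a b]])
    show "integrable lborel (\<lambda>x. (indicat_real {a..b} x *\<^sub>R h x)\<^sup>2)"
      by (rule Bochner_Integration.integrable_bound[OF sq]) (auto simp: indicator_def)
  qed (auto simp: indicator_def)
qed

section \<open>Slices at fixed time and the balance over [-R, R]\<close>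

context difference_energy
begin

lemma z_section: "locally_lborel_integrable (\<lambda>x. z (x, t))"
  by (rule locally_lborel_integrable_bounded[OF _ z_le]) simp

lemma H_section: "locally_lborel_integrable (\<lambda>x. H x t)"
  unfolding locally_lborel_integrable_def set_integrable_def
proof (intro allI)
  fix a b :: real
  define k where "k = (\<lambda>(x, s). if s \<le> t then indicat_real {a..b} x * d (x, s) else 0)"
  have "integrable (lborel \<Otimes>\<^sub>M lborel) k"
  proof (rule Bochner_Integration.integrable_bound[OF d_box[of a b]])
    have "(\<lambda>p. if snd p \<le> t then indicat_real {a..b} (fst p) * d p else 0) \<in> borel_measurable borel" by measurable
    then show "k \<in> borel_measurable (lborel \<Otimes>\<^sub>M lborel)" by (simp add: k_def borel_pair_iff case_prod_beta')
  qed (auto simp: k_def)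
  from lborel_pair.integrable_fst'[OF this]
  have "integrable lborel (\<lambda>x. LINT s|lborel. k (x, s))" .
  moreover have "(LINT s|lborel. k (x, s)) = indicat_real {a..b} x *\<^sub>R H x t" for x
  proof -
    have "(LINT s|lborel. k (x, s)) = (LINT s|lborel. indicat_real {a..b} x * (if s \<le> t then d (x, s) else 0))"
      by (rule Bochner_Integration.integral_cong) (auto simp: k_def)
    then show ?thesis by (simp add: H_def)
  qed
  ultimately show "integrable lborel (\<lambda>x. indicat_real {a..b} x *\<^sub>R H x t)" by simp
qed

lemma AE_sections_square:
  "AE t in lborel. integrable lborel (\<lambda>x. (e (x, t))\<^sup>2)" "AE t in lborel. integrable lborel (\<lambda>x. (d (x, t))\<^sup>2)"
  using lborel_pair.AE_integrable_snd[of "\<lambda>x t. (e (x, t))\<^sup>2"] lborel_pair.AE_integrable_snd[of "\<lambda>x t. (d (x, t))\<^sup>2"] e2 d2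
  by (auto simp: case_prod_beta')

text \<open>Restricting to rational b and c leaves countably many tests, so one null set of times
  serves them all; the lemma of du Bois-Reymond asks for no more.\<close>

lemma potential_primitive:
  "AE t in lborel. t \<in> {0<..<T} \<longrightarrow> (\<exists>P. primitive P (\<lambda>x. z (x, t)) \<and> (AE x in lborel. H x t = P x))"
proof -
  have "AE t in lborel. \<forall>n. \<forall>b\<in>\<rat>. \<forall>c\<in>\<rat>. t \<in> {0<..<T} \<longrightarrow>
      (LINT x|lborel. z (x, t) * bump n b c x) = - (LINT x|lborel. H x t * comb S n b c x)"
    unfolding AE_all_countable AE_ball_countable[OF countable_rat] using space_potential by blast
  then show ?thesis
  proof eventually_elim
    case (elim t)
    show ?case
    proof
      assume t: "t \<in> {0<..<T}"
      obtain P where P: "primitive P (\<lambda>x. z (x, t))" using primitive_exists[OF z_section] by blast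
      obtain k where k: "AE x in lborel. H x t = P x + k"
        using du_bois_reymond[OF H_section z_section _ P, of t] elim t by auto
      have "primitive (\<lambda>x. P x + k) (\<lambda>x. z (x, t))" using P by (simp add: primitive_def)
      with k show "\<exists>P. primitive P (\<lambda>x. z (x, t)) \<and> (AE x in lborel. H x t = P x)" by blast
    qed
  qed
qed

lemma e_primitive:
  "AE t in lborel. locally_lborel_integrable (\<lambda>x. e (x, t)) \<and> locally_lborel_integrable (\<lambda>x. d (x, t)) \<and>
    (\<exists>E. primitive E (\<lambda>x. d (x, t)) \<and> (AE x in lborel. e (x, t) = E x))"
  using AE_sections_square weak_e
proof eventually_elim
  case (elim t)
  have loc: "locally_lborel_integrable (\<lambda>x. e (x, t))" "locally_lborel_integrable (\<lambda>x. d (x, t))"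
    using elim by (auto intro!: locally_lborel_integrable_if_square)
  obtain E where E: "primitive E (\<lambda>x. d (x, t))" using primitive_exists[OF loc(2)] by blast
  obtain k where k: "AE x in lborel. e (x, t) = E x + k"
    using du_bois_reymond[OF loc _ E] elim(3) by blast
  have "primitive (\<lambda>x. E x + k) (\<lambda>x. d (x, t))" using E by (simp add: primitive_def)
  with k loc show ?case by blast
qed

text \<open>At fixed time \<open>H\<close> and \<open>e\<close> agree almost everywhere with
  continuous primitives \<open>P\<close> and \<open>E\<close>, to which integration by parts
  applies. The boundary terms can be rewritten in \<open>H\<close> and \<open>e\<close> only for
  almost every R, at R and at -R separately, whence the reflected statements.\<close>

lemma energy_section:
  "AE t in lborel. AE R in lborel. 0 < R \<longrightarrow>
    (LINT x|lborel. indicat_real {- R..R} x * (z (x, t) * e (x, t) + H x t * d (x, t)))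
    = H R t * e (R, t) - H (- R) t * e (- R, t)"
  using potential_primitive e_primitive
proof eventually_elim
  case (elim t)
  show ?case
  proof (cases "t \<in> {0<..<T}")
    case False
    then show ?thesis using out[OF False] by simp
  next
    case True
    obtain P where P: "primitive P (\<lambda>x. z (x, t))" "AE x in lborel. H x t = P x" using elim(1) True by blast
    obtain E where E: "primitive E (\<lambda>x. d (x, t))" "AE x in lborel. e (x, t) = E x" using elim(2) by blast
    have loc: "locally_lborel_integrable (\<lambda>x. d (x, t))" using elim(2) by blast
    have [measurable]: "P \<in> borel_measurable borel" "E \<in> borel_measurable borel"
      using primitive_continuous_on[OF z_section P(1)] primitive_continuous_on[OF loc E(1)]
      by (auto intro: borel_measurable_continuous_onI)
    have P': "AE x in lborel. H (- x) t = P (- x)" by (rule AE_lborel_reflect[OF P(2)]) measurable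
    have E': "AE x in lborel. e (- x, t) = E (- x)" by (rule AE_lborel_reflect[OF E(2)]) measurable
    show ?thesis
      using P(2) E(2) P' E'
    proof eventually_elim
      case (elim R)
      show ?case
      proof
        assume R: "0 < R"
        have "(LINT x|lborel. indicat_real {- R..R} x * (z (x, t) * e (x, t) + H x t * d (x, t)))
            = (LINT x:{- R..R}|lborel. z (x, t) * E x + P x * d (x, t))"
          unfolding set_lebesgue_integral_def
        proof (rule integral_cong_AE)
          show "AE x in lborel. indicat_real {- R..R} x * (z (x, t) * e (x, t) + H x t * d (x, t))
              = indicat_real {- R..R} x *\<^sub>R (z (x, t) * E x + P x * d (x, t))"
            using P(2) E(2) by eventually_elim simp
        qed measurable
        also have "\<dots> = P R * E R - P (- R) * E (- R)"
          using R by (intro primitive_by_parts z_section loc P E) auto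
        finally show "(LINT x|lborel. indicat_real {- R..R} x * (z (x, t) * e (x, t) + H x t * d (x, t)))
            = H R t * e (R, t) - H (- R) t * e (- R, t)" using elim by simp
      qed
    qed
  qed
qed

definition boundary :: "real \<Rightarrow> real" where
  "boundary x = (LINT t|lborel. H x t * e (x, t))"

definition mass :: "real \<Rightarrow> real" where
  "mass R = (LINT p|(lborel \<Otimes>\<^sub>M lborel). indicat_real {- R..R} (fst p) * (z p * e p))"

lemma ze_box: "integrable (lborel \<Otimes>\<^sub>M lborel) (\<lambda>p. indicat_real {- R..R} (fst p) * (z p * e p))"
proof (rule Bochner_Integration.integrable_bound[OF integrable_mult_right[OF e_box, of C "- R" R]])
  have "(\<lambda>p. indicat_real {- R..R} (fst p) * (z p * e p)) \<in> borel_measurable borel" by measurable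
  then show "(\<lambda>p. indicat_real {- R..R} (fst p) * (z p * e p)) \<in> borel_measurable (lborel \<Otimes>\<^sub>M lborel)"
    by (simp add: borel_pair_iff)
  show "AE p in lborel \<Otimes>\<^sub>M lborel. norm (indicat_real {- R..R} (fst p) * (z p * e p))
      \<le> norm (C * (\<lambda>(x, t). indicat_real {- R..R} x * e (x, t)) p)"
  proof (rule AE_I2)
    fix p :: "real \<times> real"
    have "\<bar>z p\<bar> * \<bar>e p\<bar> \<le> C * \<bar>e p\<bar>" by (intro mult_right_mono z_le) auto
    then show "norm (indicat_real {- R..R} (fst p) * (z p * e p)) \<le> norm (C * (\<lambda>(x, t). indicat_real {- R..R} x * e (x, t)) p)"
      using C_nonneg by (auto simp: case_prod_beta' indicator_def abs_mult)
  qed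
qed

lemma Hd_integrable: "integrable (lborel \<Otimes>\<^sub>M lborel) (\<lambda>(x, t). H x t * d (x, t))"
  and He_integrable: "integrable (lborel \<Otimes>\<^sub>M lborel) (\<lambda>(x, t). H x t * e (x, t))"
  using out by (intro H_product_integrable d2 e2; simp)+

text \<open>In time, \<open>H x\<close> is a primitive of \<open>d\<close> and starts at 0, so the
  integral is half the square of \<open>H x T\<close>.\<close>

lemma kinetic_nonneg: "AE x in lborel. 0 \<le> (LINT t|lborel. H x t * d (x, t))"
  using AE_d_square_integrable
proof eventually_elim
  case (elim x)
  have loc: "locally_lborel_integrable (\<lambda>t. d (x, t))"
    by (rule locally_lborel_integrable_if_square[OF _ elim]) simp
  have int: "integrable lborel (\<lambda>t. d (x, t))" by (rule d_time_integrable[OF elim])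
  have prim: "primitive (H x) (\<lambda>t. d (x, t))"
    unfolding primitive_def
  proof (intro allI impI)
    fix a b :: real assume ab: "a \<le> b"
    have int_le: "integrable lborel (\<lambda>s. if s \<le> t then d (x, s) else 0)" for t
      by (rule Bochner_Integration.integrable_bound[OF int]) auto
    have "H x b - H x a = (LINT s|lborel. (if s \<le> b then d (x, s) else 0) - (if s \<le> a then d (x, s) else 0))"
      unfolding H_def by (rule Bochner_Integration.integral_diff[symmetric, OF int_le int_le])
    also have "\<dots> = (LINT s|lborel. indicat_real {a..b} s *\<^sub>R d (x, s))"
    proof (rule integral_cong_AE)
      show "AE s in lborel. (if s \<le> b then d (x, s) else 0) - (if s \<le> a then d (x, s) else 0) = indicat_real {a..b} s *\<^sub>R d (x, s)"
        using AE_lborel_singleton[of a] by eventually_elim (use ab in \<open>auto simp: indicator_def\<close>)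
    qed measurable
    finally show "H x b - H x a = (LINT s:{a..b}|lborel. d (x, s))" by (simp add: set_lebesgue_integral_def)
  qed
  have H0: "H x 0 = 0"
  proof -
    have *: "(if s \<le> 0 then d (x, s) else 0) = 0" for s using out[of s x] by auto
    show ?thesis unfolding H_def * by simp
  qed
  have "(LINT t:{0..T}|lborel. d (x, t) * H x t + H x t * d (x, t)) = H x T * H x T - H x 0 * H x 0"
    using T by (intro primitive_by_parts loc prim) simp
  also have "(LINT t:{0..T}|lborel. d (x, t) * H x t + H x t * d (x, t)) = (LINT t|lborel. 2 * (H x t * d (x, t)))"
    unfolding set_lebesgue_integral_def
  proof (rule Bochner_Integration.integral_cong)
    fix t
    show "indicat_real {0..T} t *\<^sub>R (d (x, t) * H x t + H x t * d (x, t)) = 2 * (H x t * d (x, t))"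
      using out[of t x] by (cases "t \<in> {0<..<T}") auto
  qed simp
  finally have "2 * (LINT t|lborel. H x t * d (x, t)) = (H x T)\<^sup>2" by (simp add: H0 power2_eq_square)
  then show ?case by (smt (verit) zero_le_power2)
qed

text \<open>Integrate the slice identity over time and discard the nonnegative kinetic term. That
  identity holds for almost every time and then almost every radius; exchanging the two requires
  joint measurability of its left side, which is established first.\<close>

lemma mass_le_boundary: "AE R in lborel. 0 < R \<longrightarrow> mass R \<le> boundary R - boundary (- R)"
proof -
  have meas: "(\<lambda>p. LINT x|lborel. indicat_real {- (fst p)..fst p} x * (z (x, snd p) * e (x, snd p) + H x (snd p) * d (x, snd p)))
      \<in> borel_measurable (borel :: (real \<times> real) measure)"
  proof (rule lborel.borel_measurable_lebesgue_integral)
    have "(\<lambda>y :: (real \<times> real) \<times> real. if - fst (fst y) \<le> snd y \<and> snd y \<le> fst (fst y) then z (snd y, snd (fst y)) * e (snd y, snd (fst y))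
        + (\<lambda>p. H (fst p) (snd p)) (snd y, snd (fst y)) * d (snd y, snd (fst y)) else 0) \<in> borel_measurable (borel \<Otimes>\<^sub>M lborel)"
      by measurable
    also have "(\<lambda>y :: (real \<times> real) \<times> real. if - fst (fst y) \<le> snd y \<and> snd y \<le> fst (fst y) then z (snd y, snd (fst y)) * e (snd y, snd (fst y))
        + (\<lambda>p. H (fst p) (snd p)) (snd y, snd (fst y)) * d (snd y, snd (fst y)) else 0)
      = (\<lambda>(p, x). indicat_real {- (fst p)..fst p} x * (z (x, snd p) * e (x, snd p) + H x (snd p) * d (x, snd p)))"
      by (auto simp: fun_eq_iff indicator_def)
    finally show "(\<lambda>(p, x). indicat_real {- (fst p)..fst p} x * (z (x, snd p) * e (x, snd p) + H x (snd p) * d (x, snd p)))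
        \<in> borel_measurable (borel \<Otimes>\<^sub>M lborel)" .
  qed
  have [measurable]: "(\<lambda>p. H (- fst p) (snd p)) \<in> borel_measurable (borel :: (real \<times> real) measure)"
  proof -
    have "(\<lambda>p. (\<lambda>p. H (fst p) (snd p)) (- fst p, snd p)) \<in> borel_measurable (borel :: (real \<times> real) measure)" by measurable
    then show ?thesis by simp
  qed
  have "Measurable.pred borel (\<lambda>p. 0 < fst p \<longrightarrow>
      (LINT x|lborel. indicat_real {- (fst p)..fst p} x * (z (x, snd p) * e (x, snd p) + H x (snd p) * d (x, snd p)))
      = H (fst p) (snd p) * e (fst p, snd p) - H (- fst p) (snd p) * e (- fst p, snd p))"
    using meas by measurable
  from AE_plane_commute[OF this]
  have eq: "AE R in lborel. AE t in lborel. 0 < R \<longrightarrow>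
      (LINT x|lborel. indicat_real {- R..R} x * (z (x, t) * e (x, t) + H x t * d (x, t)))
      = H R t * e (R, t) - H (- R) t * e (- R, t)"
    using energy_section by simp
  have int1: "AE R in lborel. integrable lborel (\<lambda>t. H R t * e (R, t))"
    using lborel_pair.AE_integrable_fst'[OF He_integrable] by simp
  have int2: "AE R in lborel. integrable lborel (\<lambda>t. H (- R) t * e (- R, t))"
  proof -
    have "AE R in distr lborel borel uminus. integrable lborel (\<lambda>t. H R t * e (R, t))"
      using int1 unfolding lborel_distr_uminus .
    then have "AE R in lborel. integrable lborel (\<lambda>t. H (- R) t * e (- R, t))"
      by (rule AE_distrD[rotated]) simp
    then show ?thesis .
  qed
  show ?thesis
    using eq int1 int2
  proof eventually_elim
    case (elim R)
    show ?case
    proof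
      assume R: "0 < R"
      have Hd_box: "integrable (lborel \<Otimes>\<^sub>M lborel) (\<lambda>(x, t). indicat_real {- R..R} x * (H x t * d (x, t)))"
      proof (rule Bochner_Integration.integrable_bound[OF Hd_integrable])
        have "(\<lambda>p. indicat_real {- R..R} (fst p) * (H (fst p) (snd p) * d p)) \<in> borel_measurable borel" by measurable
        then show "(\<lambda>(x, t). indicat_real {- R..R} x * (H x t * d (x, t))) \<in> borel_measurable (lborel \<Otimes>\<^sub>M lborel)"
          by (simp add: borel_pair_iff case_prod_beta')
      qed (auto simp: indicator_def)
      have ze_box': "integrable (lborel \<Otimes>\<^sub>M lborel) (\<lambda>(x, t). indicat_real {- R..R} x * (z (x, t) * e (x, t)))"
        using ze_box[of R] by (simp add: case_prod_beta')
      have sum_box: "integrable (lborel \<Otimes>\<^sub>M lborel) (\<lambda>(x, t). indicat_real {- R..R} x * (z (x, t) * e (x, t) + H x t * d (x, t)))"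
        using Bochner_Integration.integrable_add[OF ze_box' Hd_box] by (simp add: case_prod_beta' distrib_left)
      have "boundary R - boundary (- R) = (LINT t|lborel. H R t * e (R, t) - H (- R) t * e (- R, t))"
        unfolding boundary_def by (rule Bochner_Integration.integral_diff[symmetric]) (use elim in auto)
      also have "\<dots> = (LINT t|lborel. LINT x|lborel. indicat_real {- R..R} x * (z (x, t) * e (x, t) + H x t * d (x, t)))"
      proof (rule integral_cong_AE)
        show "(\<lambda>t. H R t * e (R, t) - H (- R) t * e (- R, t)) \<in> borel_measurable lborel" by measurable
        show "(\<lambda>t. LINT x|lborel. indicat_real {- R..R} x * (z (x, t) * e (x, t) + H x t * d (x, t))) \<in> borel_measurable lborel"
          using lborel_pair.integrable_snd[OF sum_box] by auto
        show "AE t in lborel. H R t * e (R, t) - H (- R) t * e (- R, t)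
            = (LINT x|lborel. indicat_real {- R..R} x * (z (x, t) * e (x, t) + H x t * d (x, t)))"
          using elim(1) by eventually_elim (use R in simp)
      qed
      also have "\<dots> = (LINT p|(lborel \<Otimes>\<^sub>M lborel). (\<lambda>(x, t). indicat_real {- R..R} x * (z (x, t) * e (x, t) + H x t * d (x, t))) p)"
        using lborel_pair.integral_snd[OF sum_box] by simp
      also have "\<dots> = mass R + (LINT p|(lborel \<Otimes>\<^sub>M lborel). (\<lambda>(x, t). indicat_real {- R..R} x * (H x t * d (x, t))) p)"
        unfolding mass_def
        by (subst Bochner_Integration.integral_add[OF ze_box Hd_box, symmetric])
           (auto intro!: Bochner_Integration.integral_cong simp: distrib_left)
      also have "(LINT p|(lborel \<Otimes>\<^sub>M lborel). (\<lambda>(x, t). indicat_real {- R..R} x * (H x t * d (x, t))) p)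
          = (LINT x|lborel. indicat_real {- R..R} x * (LINT t|lborel. H x t * d (x, t)))"
        using lborel_pair.integral_fst'[OF Hd_box] by simp
      finally have "boundary R - boundary (- R) = mass R + (LINT x|lborel. indicat_real {- R..R} x * (LINT t|lborel. H x t * d (x, t)))" .
      moreover have "0 \<le> (LINT x|lborel. indicat_real {- R..R} x * (LINT t|lborel. H x t * d (x, t)))"
        by (rule integral_nonneg_AE) (use kinetic_nonneg in eventually_elim, simp)
      ultimately show "mass R \<le> boundary R - boundary (- R)" by simp
    qed
  qed
qed

text \<open>\<open>boundary\<close> is integrable over the line because H e is integrable over the
  plane. As \<open>mass\<close> is nondecreasing, (N - R0) times \<open>mass R0\<close> stays below
  a fixed constant for every N. This replaces a limit of the boundary terms, which need not
  exist.\<close>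

lemma mass_zero:
  assumes R0: "R0 > 0"
  shows "mass R0 = 0"
proof -
  define \<beta> where "\<beta> R = \<bar>boundary R\<bar> + \<bar>boundary (- R)\<bar>" for R
  have b_int: "integrable lborel boundary"
    using lborel_pair.integrable_fst'[OF He_integrable] by (simp add: boundary_def[abs_def])
  then have "integrable lborel (\<lambda>R. boundary (0 + - 1 * R))" by (rule lborel_integrable_real_affine) simp
  then have \<beta>_int: "integrable lborel \<beta>" unfolding \<beta>_def[abs_def] using b_int by simp
  have mass_nonneg: "0 \<le> mass R" for R
    unfolding mass_def using ze_nonneg by (intro integral_nonneg_AE AE_I2) simp
  have mass_mono: "mass R \<le> mass R'" if "R \<le> R'" for R R'
    unfolding mass_def
    by (rule integral_mono[OF ze_box ze_box]) (use that ze_nonneg in \<open>auto simp: indicator_def\<close>)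
  have bound: "(N - R0) * mass R0 \<le> (LINT R|lborel. \<beta> R)" if N: "N \<ge> R0" for N
  proof -
    have "(LINT R|lborel. mass R0 * indicat_real {R0..N} R) \<le> (LINT R|lborel. \<beta> R)"
    proof (rule integral_mono_AE)
      show "integrable lborel (\<lambda>R. mass R0 * indicat_real {R0..N} R)" by (intro integrable_mult_right integrable_indicator_Icc)
      show "AE R in lborel. mass R0 * indicat_real {R0..N} R \<le> \<beta> R"
        using mass_le_boundary
      proof eventually_elim
        case (elim R)
        show ?case
        proof (cases "R \<in> {R0..N}")
          case True
          then have "mass R0 \<le> boundary R - boundary (- R)" using elim mass_mono[of R0 R] R0 by auto
          also have "\<dots> \<le> \<beta> R" unfolding \<beta>_def by linarith
          finally show ?thesis using True by simp
        qed (simp add: \<beta>_def)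
      qed
    qed (rule \<beta>_int)
    then show ?thesis using N by (simp add: mult.commute)
  qed
  show ?thesis
  proof (rule ccontr)
    assume "mass R0 \<noteq> 0"
    then have pos: "mass R0 > 0" using mass_nonneg[of R0] by simp
    let ?L = "LINT R|lborel. \<beta> R"
    have L: "?L \<ge> 0" by (intro integral_nonneg_AE AE_I2) (simp add: \<beta>_def)
    \<comment> \<open>This choice of N makes the left side equal to \<open>?L + 1\<close>.\<close>
    have "(R0 + (?L + 1) / mass R0 - R0) * mass R0 \<le> ?L"
      by (rule bound) (use L pos in simp)
    then show False using pos by simp
  qed
qed

lemma e_AE_zero: "AE p in lborel \<Otimes>\<^sub>M lborel. e p = 0"
proof -
  have "AE p in lborel \<Otimes>\<^sub>M lborel. indicat_real {- real (Suc n)..real (Suc n)} (fst p) * (z p * e p) = 0" for n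
  proof -
    \<comment> \<open>\<open>Suc n\<close> rather than \<open>n\<close>, since the radius has to be
      positive.\<close>
    have "mass (real (Suc n)) = 0" by (rule mass_zero) simp
    then show ?thesis
      unfolding mass_def using ze_nonneg by (subst (asm) integral_nonneg_eq_0_iff_AE[OF ze_box]) auto
  qed
  then have "AE p in lborel \<Otimes>\<^sub>M lborel. \<forall>n. indicat_real {- real (Suc n)..real (Suc n)} (fst p) * (z p * e p) = 0"
    by (subst AE_all_countable) blast
  then show ?thesis
  proof eventually_elim
    case (elim p)
    obtain n where n: "\<bar>fst p\<bar> \<le> real n" using real_arch_simple by blast
    then have "z p * e p = 0" using elim[rule_format, of n] by (auto simp: indicator_def)
    then show ?case by (rule ze_zero)
  qed
qed

text \<open>Vanishing of z e yields only e = 0, since \<open>Dfun \<phi>\<close> is constant on the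
  negative half-line. From e = 0 follow d = 0 and H = 0, and H_x = z then gives z = 0 on almost
  every slice.\<close>

theorem z_AE_zero: "AE p in lborel \<Otimes>\<^sub>M lborel. z p = 0"
proof -
  have "AE t in lborel. AE x in lborel. e (x, t) = 0" by (rule AE_plane_snd_dest[OF e_AE_zero])
  then have "AE t in lborel. AE x in lborel. d (x, t) = 0"
    using e_primitive
  proof eventually_elim
    case (elim t)
    obtain E where E: "primitive E (\<lambda>x. d (x, t))" "AE x in lborel. e (x, t) = E x" using elim(2) by blast
    have "AE x in lborel. E x = 0" using E(2) elim(1) by eventually_elim simp
    then show ?case using elim(2) by (intro primitive_AE_zero[OF _ E(1)]) auto
  qed
  moreover have "Measurable.pred borel (\<lambda>p. d p = 0)" by measurable
  ultimately have "AE x in lborel. AE t in lborel. d (x, t) = 0" using AE_plane_commute by blast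
  then have H0: "AE x in lborel. \<forall>t. H x t = 0"
  proof eventually_elim
    case (elim x)
    show ?case
    proof
      fix t
      show "H x t = 0" unfolding H_def by (rule integral_eq_zero_AE) (use elim in eventually_elim, simp)
    qed
  qed
  have "AE t in lborel. AE x in lborel. z (x, t) = 0"
    using potential_primitive
  proof eventually_elim
    case (elim t)
    show ?case
    proof (cases "t \<in> {0<..<T}")
      case False then show ?thesis using out by simp
    next
      case True
      then obtain P where P: "primitive P (\<lambda>x. z (x, t))" "AE x in lborel. H x t = P x" using elim by blast
      have "AE x in lborel. P x = 0" using P(2) H0 by eventually_elim auto
      then show ?thesis by (rule primitive_AE_zero[OF z_section P(1)])
    qed
  qed
  moreover have pred: "Measurable.pred borel (\<lambda>p. z p = 0)" by measurable
  ultimately show ?thesis using AE_plane_commute[OF pred] AE_plane_fst[OF pred] by blast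
qed

end

section \<open>Borel representatives\<close>

lemma AE_lebesgue_on_iff:
  fixes Q :: "'a :: euclidean_space \<Rightarrow> bool"
  assumes "X \<in> sets borel"
  shows "(AE p in lebesgue_on X. Q p) \<longleftrightarrow> (AE p in lborel. p \<in> X \<longrightarrow> Q p)"
  using assms by (subst AE_restrict_space_iff) (auto simp: AE_completion_iff)

text \<open>Sections of a Lebesgue measurable function on the plane need not all be measurable, so
  Fubini is applied to Borel versions, extended by zero.\<close>

lemma borel_representative:
  fixes h :: "'a :: euclidean_space \<Rightarrow> real"
  assumes h: "h \<in> borel_measurable (lebesgue_on X)" and X [measurable]: "X \<in> sets borel"
  obtains h' where "h' \<in> borel_measurable borel" "\<And>p. p \<notin> X \<Longrightarrow> h' p = 0" "AE p in lborel. p \<in> X \<longrightarrow> h p = h' p"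
proof -
  have "(\<lambda>p. if p \<in> X then h p else 0) \<in> borel_measurable lebesgue"
    by (rule borel_measurable_if_I[OF h]) simp
  then obtain g where [measurable]: "g \<in> borel_measurable lborel" and g: "AE p in lborel. (if p \<in> X then h p else 0) = g p"
    using completion_ex_borel_measurable_real by blast
  show ?thesis
  proof (rule that[of "\<lambda>p. indicator X p * g p"])
    show "(\<lambda>p. indicator X p * g p) \<in> borel_measurable borel" by measurable
    show "AE p in lborel. p \<in> X \<longrightarrow> h p = indicator X p * g p"
      using g by eventually_elim auto
  qed simp
qed

lemma AE_QT_sections:
  assumes "AE p in lborel. p \<in> QT T \<longrightarrow> Q p"
  shows "AE t in lborel. t \<in> {0<..<T} \<longrightarrow> (AE x in lborel. Q (x, t))"
proof -
  have "AE p in lborel \<Otimes>\<^sub>M lborel. p \<in> QT T \<longrightarrow> Q p" using assms unfolding lborel_prod .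
  from AE_plane_snd_dest[OF this] show ?thesis by eventually_elim (auto simp: QT_def elim: eventually_mono)
qed

lemma QT_integral_representative:
  fixes h h' g :: "real \<times> real \<Rightarrow> real"
  assumes ae: "AE p in lborel. p \<in> QT T \<longrightarrow> h p = h' p"
    and [measurable]: "h' \<in> borel_measurable borel" "g \<in> borel_measurable borel"
    and out: "\<And>p. p \<notin> QT T \<Longrightarrow> h' p = 0"
  shows "(LINT p|lebesgue_on (QT T). h p * g p) = (LINT p|(lborel \<Otimes>\<^sub>M lborel). h' p * g p)"
proof -
  have eq: "AE p in lebesgue. h' p * g p = indicator (QT T) p *\<^sub>R (h p * g p)"
    unfolding AE_completion_iff using ae by eventually_elim (auto simp: indicator_def out)
  have meas: "(\<lambda>p. h' p * g p) \<in> borel_measurable lebesgue" by (intro measurable_completion) measurable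
  have "(LINT p|lebesgue_on (QT T). h p * g p) = (LINT p|lebesgue. indicator (QT T) p *\<^sub>R (h p * g p))"
    by (rule integral_restrict_space) simp
  also have "\<dots> = (LINT p|lebesgue. h' p * g p)"
    by (rule integral_cong_AE) (use eq meas borel_measurable_AE[OF meas eq] in \<open>auto elim!: eventually_mono\<close>)
  also have "\<dots> = (LINT p|lborel. h' p * g p)" by (rule integral_completion) measurable
  finally show ?thesis by (simp add: lborel_prod)
qed

lemma antiderivative_exists:
  fixes f :: "real \<Rightarrow> real"
  assumes "continuous_on UNIV f"
  obtains F where "\<And>x. (F has_real_derivative f x) (at x)"
proof -
  have "\<exists>F. \<forall>x::real. - \<infinity> < ereal x \<longrightarrow> ereal x < \<infinity> \<longrightarrow> (F has_vector_derivative f x) (at x)"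
    by (rule einterval_antiderivative) (use assms in \<open>auto simp: continuous_on_eq_continuous_at\<close>)
  then show ?thesis using that by (auto simp: has_real_derivative_iff_has_vector_derivative)
qed

lemma integral_if_antiderivative:
  fixes A :: "real \<Rightarrow> real"
  assumes "\<And>x. (A has_real_derivative \<alpha> x) (at x)" "continuous_on UNIV \<alpha>" "t \<le> T"
  shows "(LINT s|lborel. (if t \<le> s \<and> s \<le> T then \<alpha> s else 0)) = A T - A t"
proof -
  have "A T - A t = (LINT s:{t..T}|lborel. \<alpha> s)"
    using primitive_if_DERIV[OF assms(1,2)] assms(3) by (simp add: primitive_def)
  also have "\<dots> = (LINT s|lborel. (if t \<le> s \<and> s \<le> T then \<alpha> s else 0))"
    unfolding set_lebesgue_integral_def by (rule Bochner_Integration.integral_cong) (auto simp: indicator_def)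
  finally show ?thesis by simp
qed

lemma integrable_square_add:
  fixes f g :: "'a \<Rightarrow> real"
  assumes [measurable]: "f \<in> borel_measurable M" "g \<in> borel_measurable M"
    and "integrable M (\<lambda>x. (f x)\<^sup>2)" "integrable M (\<lambda>x. (g x)\<^sup>2)"
  shows "integrable M (\<lambda>x. (f x - g x)\<^sup>2)" "integrable M (\<lambda>x. (f x + g x)\<^sup>2)"
proof -
  have int: "integrable M (\<lambda>x. 2 * (f x)\<^sup>2 + 2 * (g x)\<^sup>2)" using assms by simp
  have le: "(y - u)\<^sup>2 \<le> 2 * y\<^sup>2 + 2 * u\<^sup>2 \<and> (y + u)\<^sup>2 \<le> 2 * y\<^sup>2 + 2 * u\<^sup>2" for y u :: real
    using zero_le_power2[of "y - u"] zero_le_power2[of "y + u"] by (simp add: power2_eq_square algebra_simps)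
  show "integrable M (\<lambda>x. (f x - g x)\<^sup>2)" "integrable M (\<lambda>x. (f x + g x)\<^sup>2)"
    by (rule Bochner_Integration.integrable_bound[OF int]; use le in \<open>auto intro!: AE_I2\<close>)+
qed

text \<open>On the support of the test |h| <= 1 + h^2, with both terms integrable over a box; square
  integrability of \<open>h\<close> is therefore asked for only locally in x.\<close>

lemma integrable_times_compact_test:
  fixes h g :: "real \<times> real \<Rightarrow> real"
  assumes [measurable]: "h \<in> borel_measurable borel" "g \<in> borel_measurable borel"
    and sq: "\<And>J. integrable (lborel \<Otimes>\<^sub>M lborel) (\<lambda>p. indicat_real {- J..J} (fst p) * (h p)\<^sup>2)"
    and out: "\<And>p. p \<notin> QT T \<Longrightarrow> h p = 0"
    and g: "\<And>p. p \<in> QT T \<Longrightarrow> \<bar>g p\<bar> \<le> K * indicat_real {- J..J :: real} (fst p)"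
  shows "integrable (lborel \<Otimes>\<^sub>M lborel) (\<lambda>p. h p * g p)"
proof (rule Bochner_Integration.integrable_bound)
  have box: "integrable (lborel \<Otimes>\<^sub>M lborel) (\<lambda>(x, t). indicat_real {- J..J} x * indicat_real {0..T} t)"
    by (rule integrable_pair_product) auto
  show "integrable (lborel \<Otimes>\<^sub>M lborel) (\<lambda>p. K * ((\<lambda>(x, t). indicat_real {- J..J} x * indicat_real {0..T} t) p
      + indicat_real {- J..J} (fst p) * (h p)\<^sup>2))"
    by (intro integrable_mult_right Bochner_Integration.integrable_add box sq)
  have "(\<lambda>p. h p * g p) \<in> borel_measurable borel" by measurable
  then show "(\<lambda>p. h p * g p) \<in> borel_measurable (lborel \<Otimes>\<^sub>M lborel)" by (simp add: lborel_prod)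
  show "AE p in lborel \<Otimes>\<^sub>M lborel. norm (h p * g p) \<le> norm (K * ((\<lambda>(x, t). indicat_real {- J..J} x * indicat_real {0..T} t) p
      + indicat_real {- J..J} (fst p) * (h p)\<^sup>2))"
  proof (rule AE_I2)
    fix p :: "real \<times> real"
    show "norm (h p * g p) \<le> norm (K * ((\<lambda>(x, t). indicat_real {- J..J} x * indicat_real {0..T} t) p
      + indicat_real {- J..J} (fst p) * (h p)\<^sup>2))"
    proof (cases "p \<in> QT T")
      case True
      have h: "\<bar>h p\<bar> \<le> 1 + (h p)\<^sup>2" using zero_le_power2[of "\<bar>h p\<bar> - 1 / 2"] by (simp add: power2_eq_square algebra_simps)
      show ?thesis
      proof (cases "fst p \<in> {- J..J}")
        case True
        then have K: "\<bar>g p\<bar> \<le> K" using g[OF \<open>p \<in> QT T\<close>] by simp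
        have "\<bar>h p\<bar> * \<bar>g p\<bar> \<le> (1 + (h p)\<^sup>2) * K" using h K by (intro mult_mono) auto
        moreover have "K \<ge> 0" using K by linarith
        ultimately show ?thesis using True \<open>p \<in> QT T\<close> by (auto simp: QT_def abs_mult mult.commute case_prod_beta')
      next
        case False
        then have "g p = 0" using g[OF \<open>p \<in> QT T\<close>] by simp
        then show ?thesis by simp
      qed
    qed (simp add: out)
  qed
qed

section \<open>Weak derivatives and the weak identity against the constructed tests\<close>

context smooth_step
begin

lemma test_integrable:
  assumes "locally_lborel_integrable h"
  shows "integrable lborel (\<lambda>x. h x * comb S n b c x)" "integrable lborel (\<lambda>x. h x * bump n b c x)"
proof -
  define J where "J = 2 + \<bar>b\<bar> + \<bar>c\<bar>"
  have z: "comb S n b c x = 0 \<and> bump n b c x = 0" if "x \<notin> {- J..J}" for x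
    using comb_support[of b c x n] that by (auto simp: J_def)
  have "integrable lborel (\<lambda>x. indicat_real {- J..J} x *\<^sub>R (h x * comb S n b c x))"
    "integrable lborel (\<lambda>x. indicat_real {- J..J} x *\<^sub>R (h x * bump n b c x))"
    using locally_lborel_integrable_mult_continuous[OF assms continuous_comb_S]
      locally_lborel_integrable_mult_continuous[OF assms continuous_bump]
    by (auto simp: locally_lborel_integrable_def set_integrable_def)
  moreover have "(\<lambda>x. indicat_real {- J..J} x *\<^sub>R (h x * comb S n b c x)) = (\<lambda>x. h x * comb S n b c x)"
    "(\<lambda>x. indicat_real {- J..J} x *\<^sub>R (h x * bump n b c x)) = (\<lambda>x. h x * bump n b c x)"
    using z by (auto simp: fun_eq_iff indicator_def)
  ultimately show "integrable lborel (\<lambda>x. h x * comb S n b c x)" "integrable lborel (\<lambda>x. h x * bump n b c x)"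
    by simp_all
qed

text \<open>Changes on null sets preserve local integrability and all integrals, so the defining
  identity can be read off for the test \<open>bump n b c\<close>, whose derivative is
  \<open>comb S n b c\<close>.\<close>

lemma weak_deriv_representative:
  assumes weak: "weak_deriv v g" and ae: "AE x in lborel. v x = v' x" "AE x in lborel. g x = g' x"
    and [measurable]: "v' \<in> borel_measurable borel" "g' \<in> borel_measurable borel"
  shows "locally_lborel_integrable v'" "locally_lborel_integrable g'"
    "(LINT x|lborel. v' x * comb S n b c x) = - (LINT x|lborel. g' x * bump n b c x)"
proof -
  have loc: "locally_lborel_integrable h'"
    if "locally_integrable h" "AE x in lborel. h x = h' x" and [measurable]: "h' \<in> borel_measurable borel" for h h'
    unfolding locally_lborel_integrable_def
  proof (intro allI)
    fix a b :: real
    define J where "J = max \<bar>a\<bar> \<bar>b\<bar>"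
    have h_int: "integrable lebesgue (\<lambda>x. indicat_real {- J..J} x *\<^sub>R h x)"
      using that(1) by (simp add: locally_integrable_def set_integrable_def)
    have "integrable lebesgue (\<lambda>x. indicat_real {- J..J} x *\<^sub>R h' x)"
    proof (rule integrable_cong_AE_imp[OF h_int])
      show "(\<lambda>x. indicat_real {- J..J} x *\<^sub>R h' x) \<in> borel_measurable lebesgue" by (intro measurable_completion) measurable
      show "AE x in lebesgue. indicat_real {- J..J} x *\<^sub>R h x = indicat_real {- J..J} x *\<^sub>R h' x"
        unfolding AE_completion_iff using that(2) by eventually_elim simp
    qed
    then have "set_integrable lborel {- J..J} h'" by (simp add: set_integrable_def integrable_completion)
    then show "set_integrable lborel {a..b} h'" by (rule set_integrable_subset) (auto simp: J_def)
  qed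
  show "locally_lborel_integrable v'" "locally_lborel_integrable g'"
    using weak ae by (auto simp: weak_deriv_def intro: loc)
  have eq: "(LINT x|lebesgue. h x * \<psi> x) = (LINT x|lborel. h' x * \<psi> x)"
    if ae: "AE x in lborel. h x = h' x" and [measurable]: "h' \<in> borel_measurable borel" "\<psi> \<in> borel_measurable borel" for h h' \<psi> :: "real \<Rightarrow> real"
  proof -
    have meas: "(\<lambda>x. h' x * \<psi> x) \<in> borel_measurable lebesgue" by (intro measurable_completion) measurable
    have ae': "AE x in lebesgue. h' x * \<psi> x = h x * \<psi> x"
      unfolding AE_completion_iff using ae by eventually_elim simp
    have "(LINT x|lebesgue. h x * \<psi> x) = (LINT x|lebesgue. h' x * \<psi> x)"
      by (rule integral_cong_AE) (use ae' meas borel_measurable_AE[OF meas ae'] in \<open>auto elim!: eventually_mono\<close>)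
    also have "\<dots> = (LINT x|lborel. h' x * \<psi> x)" by (rule integral_completion) measurable
    finally show ?thesis .
  qed
  have "\<exists>J. \<forall>x. \<bar>x\<bar> > J \<longrightarrow> bump n b c x = 0" using comb_support(2) by blast
  then have "(LINT x|lebesgue. v x * deriv (bump n b c) x) = - (LINT x|lebesgue. g x * bump n b c x)"
    using weak smooth_bump by (auto simp: weak_deriv_def)
  then show "(LINT x|lborel. v' x * comb S n b c x) = - (LINT x|lborel. g' x * bump n b c x)"
    by (simp add: deriv_bump eq[OF ae(1)] eq[OF ae(2)])
qed

text \<open>A merely continuous \<alpha> is admissible because its antiderivative \<open>B\<close>
  enters the test function. The difference \<open>B T - B (snd p)\<close> enforces the final value
  zero and leaves the value at t = 0 free.\<close>

lemma product_test_function: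
  assumes A': "\<And>x. (B has_real_derivative \<alpha> x) (at x)" and \<alpha>: "continuous_on UNIV \<alpha>"
  shows "test_function T (\<lambda>p. bump n b c (fst p) * (B T - B (snd p)))
    (\<lambda>p. comb S n b c (fst p) * (B T - B (snd p))) (\<lambda>p. - (bump n b c (fst p) * \<alpha> (snd p)))"
  unfolding test_function_def
proof (intro conjI ballI allI)
  fix p :: "real \<times> real"
  have "((\<lambda>p. bump n b c (fst p)) has_derivative (\<lambda>h. fst h * comb S n b c (fst p))) (at p within UNIV \<times> {0..T})"
    by (rule has_derivative_eq_rhs[OF DERIV_compose_FDERIV[OF bump_DERIV has_derivative_fst[OF has_derivative_ident]]]) simp
  moreover have "((\<lambda>p. B (snd p)) has_derivative (\<lambda>h. snd h * \<alpha> (snd p))) (at p within UNIV \<times> {0..T})"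
    by (rule has_derivative_eq_rhs[OF DERIV_compose_FDERIV[OF A' has_derivative_snd[OF has_derivative_ident]]]) simp
  ultimately have "((\<lambda>p. bump n b c (fst p) * (B T - B (snd p))) has_derivative
      (\<lambda>h. bump n b c (fst p) * (0 - snd h * \<alpha> (snd p)) + fst h * comb S n b c (fst p) * (B T - B (snd p)))) (at p within UNIV \<times> {0..T})"
    by (intro has_derivative_mult has_derivative_diff has_derivative_const)
  then show "((\<lambda>p. bump n b c (fst p) * (B T - B (snd p))) has_derivative
      (\<lambda>h. comb S n b c (fst p) * (B T - B (snd p)) * fst h + - (bump n b c (fst p) * \<alpha> (snd p)) * snd h)) (at p within UNIV \<times> {0..T})"
    by (rule has_derivative_eq_rhs) (auto simp: fun_eq_iff algebra_simps)
next
  have B_cont: "continuous_on UNIV B" using A' by (meson DERIV_isCont continuous_at_imp_continuous_on)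
  show "continuous_on (UNIV \<times> {0..T}) (\<lambda>p. comb S n b c (fst p) * (B T - B (snd p)))"
    "continuous_on (UNIV \<times> {0..T}) (\<lambda>p. - (bump n b c (fst p) * \<alpha> (snd p)))"
    by (intro continuous_intros continuous_on_compose2[OF continuous_comb_S[of UNIV]] continuous_on_compose2[OF B_cont]
        continuous_on_compose2[OF \<alpha>] continuous_on_compose2[OF continuous_bump[of UNIV]]; simp)+
  show "\<exists>J>0. \<forall>x. \<forall>t\<in>{0..T}. \<bar>x\<bar> > J \<longrightarrow> bump n b c (fst (x, t)) * (B T - B (snd (x, t))) = 0"
    by (intro exI[of _ "2 + \<bar>b\<bar> + \<bar>c\<bar>"]) (auto simp: comb_support)
qed simp

text \<open>Under the hypothesis the zero function has weak derivative g - g' against these tests,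
  so by du Bois-Reymond every primitive of g - g' is constant.\<close>

lemma AE_eq_if_same_tests:
  assumes g: "locally_lborel_integrable g" and g': "locally_lborel_integrable g'"
    and eq: "\<And>n b c. (LINT x|lborel. g x * bump n b c x) = (LINT x|lborel. g' x * bump n b c x)"
  shows "AE x in lborel. g x = g' x"
proof -
  have d: "locally_lborel_integrable (\<lambda>x. g x - g' x)"
    using g g' by (auto simp: locally_lborel_integrable_def)
  obtain F where F: "primitive F (\<lambda>x. g x - g' x)" using primitive_exists[OF d] by blast
  have zero: "locally_lborel_integrable (\<lambda>_. 0)" by (rule locally_lborel_integrable_continuous) simp
  obtain k where k: "AE x in lborel. 0 = F x + k"
  proof (rule du_bois_reymond[OF zero d _ F])
    fix n b c
    show "(LINT x|lborel. 0 * comb S n b c x) = - (LINT x|lborel. (g x - g' x) * bump n b c x)"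
      unfolding left_diff_distrib using eq[of n b c] test_integrable(2)[OF g, of n b c] test_integrable(2)[OF g', of n b c]
      by simp
  qed
  have "primitive (\<lambda>x. F x + k) (\<lambda>x. g x - g' x)" using F by (simp add: primitive_def)
  then have "AE x in lborel. g x - g' x = 0"
    by (rule primitive_AE_zero[OF d]) (use k in eventually_elim, simp)
  then show ?thesis by eventually_elim simp
qed

end

section \<open>Uniqueness\<close>

context far_field
begin

text \<open>The fixed reference function of the problem also provides the smooth step from which all test
  functions of the uniqueness proof are built.\<close>

definition unit_step :: "real \<Rightarrow> real" where
  "unit_step y = (U - what y) / (U + V)"

definition unit_ramp :: "real \<Rightarrow> real" where
  "unit_ramp = (SOME A. (\<forall>y. (A has_real_derivative unit_step y) (at y)) \<and> (\<forall>y < -1. A y = 0))"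

lemma smooth_unit_step: "smooth unit_step"
proof -
  have "smooth (\<lambda>y. (1 / (U + V)) * (U - what y))"
    by (intro smooth_cmult smooth_diff smooth_const what_smooth)
  then show ?thesis by (simp add: unit_step_def[abs_def])
qed

lemma unit_step_values: "y < -1 \<Longrightarrow> unit_step y = 0" "y > 1 \<Longrightarrow> unit_step y = 1"
  using U V by (auto simp: unit_step_def what_left what_right)

lemma unit_ramp_properties:
  "(\<forall>y. (unit_ramp has_real_derivative unit_step y) (at y)) \<and> (\<forall>y < -1. unit_ramp y = 0)"
proof -
  have cont: "continuous_on UNIV unit_step"
    using smooth_deriv[OF smooth_unit_step] by (meson DERIV_isCont continuous_at_imp_continuous_on)
  obtain B where B: "\<And>y. (B has_real_derivative unit_step y) (at y)"
    using antiderivative_exists[OF cont] by blast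
  have "\<exists>c. \<forall>y\<in>{..<-1}. B y = c"
  proof (rule has_field_derivative_zero_constant)
    fix y :: real assume "y \<in> {..<-1}"
    then show "(B has_real_derivative 0) (at y within {..<-1})"
      using B[of y] unit_step_values(1)[of y] by (simp add: has_field_derivative_at_within)
  qed simp
  then obtain c where c: "\<And>y. y < -1 \<Longrightarrow> B y = c" by auto
  have "((\<lambda>y. B y - c) has_real_derivative unit_step y) (at y)" for y
    using DERIV_diff[OF B DERIV_const[of c]] by simp
  with c have "\<exists>A. (\<forall>y. (A has_real_derivative unit_step y) (at y)) \<and> (\<forall>y < -1. A y = 0)"
    by (intro exI[of _ "\<lambda>y. B y - c"]) auto
  from someI_ex[OF this] show ?thesis unfolding unit_ramp_def .
qed

sublocale ramp: smooth_step unit_step unit_ramp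
  by unfold_locales (use smooth_unit_step unit_step_values unit_ramp_properties in auto)

abbreviation "tstx \<equiv> ramp.comb unit_step"
abbreviation "tst \<equiv> ramp.bump"

text \<open>For a weak solution \<open>Dfun \<phi> (v p)\<close> is not square integrable over the
  strip, since the reference equals \<phi>(U) on the far left; the difference from the reference is.
  The reference cancels when two solutions are subtracted.\<close>

definition excess :: "(real \<times> real \<Rightarrow> real) \<Rightarrow> real \<times> real \<Rightarrow> real" where
  "excess v p = indicator (QT T) p * (Dfun \<phi> (v p) - Dfun \<phi> (what (fst p)))"

text \<open>Borel versions \<open>v\<close> of a weak solution and \<open>k\<close> of the \<open>x\<close>-derivative of
  \<open>Dfun \<phi> v - Dfun \<phi> what\<close>, both extended by zero outside the strip.\<close>

definition represents :: "(real \<times> real \<Rightarrow> real) \<Rightarrow> (real \<times> real \<Rightarrow> real) \<Rightarrow> bool" where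
  "represents v k \<longleftrightarrow>
     v \<in> borel_measurable borel \<and> k \<in> borel_measurable borel \<and> (\<exists>C. \<forall>p. \<bar>v p\<bar> \<le> C) \<and>
     (\<forall>p. p \<notin> QT T \<longrightarrow> v p = 0 \<and> k p = 0) \<and>
     integrable (lborel \<Otimes>\<^sub>M lborel) (\<lambda>p. (excess v p)\<^sup>2) \<and>
     integrable (lborel \<Otimes>\<^sub>M lborel) (\<lambda>p. (k p)\<^sup>2) \<and>
     (AE t in lborel. \<forall>n b c. (LINT x|lborel. excess v (x, t) * tstx n b c x) = - (LINT x|lborel. k (x, t) * tst n b c x)) \<and>
     (\<forall>n b c \<alpha> B. continuous_on UNIV \<alpha> \<and> (\<forall>x. (B has_real_derivative \<alpha> x) (at x)) \<longrightarrow>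
        (LINT x|lebesgue. initial_datum U V x * (tst n b c x * (B T - B 0)))
          - (LINT p|(lborel \<Otimes>\<^sub>M lborel). v p * (tst n b c (fst p) * \<alpha> (snd p)))
        = (LINT p|(lborel \<Otimes>\<^sub>M lborel). (k p + indicator (QT T) p * what_x (fst p)) * (tstx n b c (fst p) * (B T - B (snd p)))))"

lemma locally_square_bounded:
  fixes h :: "real \<times> real \<Rightarrow> real"
  assumes [measurable]: "h \<in> borel_measurable borel" and out: "\<And>p. p \<notin> QT T \<Longrightarrow> h p = 0" and le: "\<And>p. \<bar>h p\<bar> \<le> C"
  shows "integrable (lborel \<Otimes>\<^sub>M lborel) (\<lambda>p. indicat_real {- J..J} (fst p) * (h p)\<^sup>2)"
proof (rule Bochner_Integration.integrable_bound)
  show "integrable (lborel \<Otimes>\<^sub>M lborel) (\<lambda>(x, t). (C\<^sup>2 * indicat_real {- J..J} x) * indicat_real {0..T} t)"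
    by (rule integrable_pair_product) auto
  have "(\<lambda>p. indicat_real {- J..J} (fst p) * (h p)\<^sup>2) \<in> borel_measurable borel" by measurable
  then show "(\<lambda>p. indicat_real {- J..J} (fst p) * (h p)\<^sup>2) \<in> borel_measurable (lborel \<Otimes>\<^sub>M lborel)" by (simp add: lborel_prod)
  show "AE p in lborel \<Otimes>\<^sub>M lborel. norm (indicat_real {- J..J} (fst p) * (h p)\<^sup>2)
      \<le> norm ((\<lambda>(x, t). (C\<^sup>2 * indicat_real {- J..J} x) * indicat_real {0..T} t) p)"
  proof (rule AE_I2)
    fix p :: "real \<times> real"
    have "(h p)\<^sup>2 \<le> C\<^sup>2" using le[of p] by (intro abs_le_square_iff[THEN iffD1]) auto
    then show "norm (indicat_real {- J..J} (fst p) * (h p)\<^sup>2)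
      \<le> norm ((\<lambda>(x, t). (C\<^sup>2 * indicat_real {- J..J} x) * indicat_real {0..T} t) p)"
      using out[of p] by (cases "p \<in> QT T") (auto simp: QT_def case_prod_beta' indicator_def)
  qed
qed

lemma locally_square_square:
  fixes h :: "real \<times> real \<Rightarrow> real"
  assumes [measurable]: "h \<in> borel_measurable borel" and sq: "integrable (lborel \<Otimes>\<^sub>M lborel) (\<lambda>p. (h p)\<^sup>2)"
  shows "integrable (lborel \<Otimes>\<^sub>M lborel) (\<lambda>p. indicat_real {- J..J} (fst p) * (h p)\<^sup>2)"
proof (rule Bochner_Integration.integrable_bound[OF sq])
  have "(\<lambda>p. indicat_real {- J..J} (fst p) * (h p)\<^sup>2) \<in> borel_measurable borel" by measurable
  then show "(\<lambda>p. indicat_real {- J..J} (fst p) * (h p)\<^sup>2) \<in> borel_measurable (lborel \<Otimes>\<^sub>M lborel)" by (simp add: lborel_prod)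
qed (auto simp: indicator_def)

lemma what_x_bounded: obtains B where "B \<ge> 0" "\<And>x. \<bar>what_x x\<bar> \<le> B"
proof -
  have "compact (what_x ` {-1..1})" by (intro compact_continuous_image continuous_on_subset[OF what_x_cont]) auto
  then obtain B0 where B0: "\<forall>x\<in>{-1..1}. \<bar>what_x x\<bar> \<le> B0"
    by (auto dest!: compact_imp_bounded simp: bounded_iff simp del: atLeastAtMost_iff)
  have "\<bar>what_x x\<bar> \<le> max B0 0" for x
    using B0 what_x_support[of x] by (cases "x \<in> {-1..1}") (auto simp: le_max_iff_disj)
  then show ?thesis by (intro that[of "max B0 0"]) auto
qed

text \<open>The definition of a weak solution supplies two derivatives, \<open>g\<close> from
  membership in the function space and \<open>gx\<close> from the integral identity. Uniqueness of
  weak derivatives matches them slice by slice, gx = g + what_x; only this makes \<open>gx\<close>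
  locally square integrable.\<close>

lemma weak_solution_represented:
  assumes sol: "weak_solution \<phi> U V what T v"
  obtains v' k where "represents v' k" "AE p in lborel. p \<in> QT T \<longrightarrow> v p = v' p"
proof -
  obtain C where v_meas: "v \<in> borel_measurable (lebesgue_on (QT T))" and C: "AE p in lebesgue_on (QT T). \<bar>v p\<bar> \<le> C"
    using sol by (auto simp: weak_solution_def Linfty_def)
  obtain v0 where [measurable]: "v0 \<in> borel_measurable borel" and v0_out: "\<And>p. p \<notin> QT T \<Longrightarrow> v0 p = 0"
    and v0: "AE p in lborel. p \<in> QT T \<longrightarrow> v p = v0 p"
    using borel_representative[OF v_meas QT_borel] by metis
  \<comment> \<open>Clipping at the essential bound changes \<open>v0\<close> only on a null set and
    makes the bound hold everywhere.\<close>
  define v' where "v' p = max (- \<bar>C\<bar>) (min \<bar>C\<bar> (v0 p))" for p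
  have [measurable]: "v' \<in> borel_measurable borel" unfolding v'_def[abs_def] by measurable
  have v'_out: "v' p = 0" if "p \<notin> QT T" for p using v0_out[OF that] by (simp add: v'_def)
  have v'_le: "\<bar>v' p\<bar> \<le> \<bar>C\<bar>" for p by (auto simp: v'_def)
  have v_eq: "AE p in lborel. p \<in> QT T \<longrightarrow> v p = v' p"
    using v0 C unfolding AE_lebesgue_on_iff[OF QT_borel] by eventually_elim (auto simp: v'_def)
  have D_sec: "(\<lambda>x. Dfun \<phi> (v' (x, t))) \<in> borel_measurable borel" for t by measurable
  obtain g where g_meas: "g \<in> borel_measurable (lebesgue_on (QT T))"
    and g_W: "AE t in lebesgue_on {0<..<T}. W12 (\<lambda>x. Dfun \<phi> (v (x, t)) - Dfun \<phi> (what x)) (\<lambda>x. g (x, t))"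
    and g_fin: "(\<integral>\<^sup>+ t. (\<integral>\<^sup>+ x. ennreal ((Dfun \<phi> (v (x, t)) - Dfun \<phi> (what x))\<^sup>2 + (g (x, t))\<^sup>2) \<partial>lebesgue) \<partial>lebesgue_on {0<..<T}) < \<infinity>"
    using sol unfolding weak_solution_def L2_W12_def by auto
  obtain k where [measurable]: "k \<in> borel_measurable borel" and k_out: "\<And>p. p \<notin> QT T \<Longrightarrow> k p = 0"
    and k: "AE p in lborel. p \<in> QT T \<longrightarrow> g p = k p"
    using borel_representative[OF g_meas QT_borel] by metis
  have [measurable]: "excess v' \<in> borel_measurable borel" unfolding excess_def[abs_def] by measurable
  have exc_sec [measurable]: "(\<lambda>x. excess v' (x, t)) \<in> borel_measurable borel" "(\<lambda>x. k (x, t)) \<in> borel_measurable borel" for t by measurable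
  have exc_eq: "excess v' (x, t) = Dfun \<phi> (v' (x, t)) - Dfun \<phi> (what x)" if "t \<in> {0<..<T}" for x t
    using that by (simp add: excess_def QT_def)
  have out_t: "excess v' (x, t) = 0" "k (x, t) = 0" if "t \<notin> {0<..<T}" for x t
    using that k_out[of "(x, t)"] by (auto simp: excess_def QT_def)
  have v_sec: "AE t in lborel. t \<in> {0<..<T} \<longrightarrow> (AE x in lborel. v (x, t) = v' (x, t))"
    by (rule AE_QT_sections[OF v_eq])
  have k_sec: "AE t in lborel. t \<in> {0<..<T} \<longrightarrow> (AE x in lborel. g (x, t) = k (x, t))"
    by (rule AE_QT_sections[OF k])
  \<comment> \<open>Tonelli turns the iterated integral of the definition into one over the plane,
    after v and g have been replaced on almost every slice.\<close>
  have sq_fin: "(\<integral>\<^sup>+ p. ennreal ((excess v' p)\<^sup>2 + (k p)\<^sup>2) \<partial>(lborel \<Otimes>\<^sub>M lborel)) < \<infinity>"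
  proof -
    have "(\<integral>\<^sup>+ p. ennreal ((excess v' p)\<^sup>2 + (k p)\<^sup>2) \<partial>(lborel \<Otimes>\<^sub>M lborel))
        = (\<integral>\<^sup>+ t. (\<integral>\<^sup>+ x. ennreal ((excess v' (x, t))\<^sup>2 + (k (x, t))\<^sup>2) \<partial>lborel) \<partial>lborel)"
      by (rule lborel_pair.nn_integral_snd[symmetric]) (simp add: lborel_prod)
    also have "\<dots> = (\<integral>\<^sup>+ t. (\<integral>\<^sup>+ x. ennreal ((Dfun \<phi> (v (x, t)) - Dfun \<phi> (what x))\<^sup>2 + (g (x, t))\<^sup>2) \<partial>lborel) * indicator {0<..<T} t \<partial>lborel)"
    proof (rule nn_integral_cong_AE)
      show "AE t in lborel. (\<integral>\<^sup>+ x. ennreal ((excess v' (x, t))\<^sup>2 + (k (x, t))\<^sup>2) \<partial>lborel)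
          = (\<integral>\<^sup>+ x. ennreal ((Dfun \<phi> (v (x, t)) - Dfun \<phi> (what x))\<^sup>2 + (g (x, t))\<^sup>2) \<partial>lborel) * indicator {0<..<T} t"
        using v_sec k_sec
      proof eventually_elim
        case (elim t)
        show ?case
        proof (cases "t \<in> {0<..<T}")
          case True
          then have ae: "AE x in lborel. v (x, t) = v' (x, t)" "AE x in lborel. g (x, t) = k (x, t)" using elim by auto
          have "(\<integral>\<^sup>+ x. ennreal ((excess v' (x, t))\<^sup>2 + (k (x, t))\<^sup>2) \<partial>lborel)
              = (\<integral>\<^sup>+ x. ennreal ((Dfun \<phi> (v (x, t)) - Dfun \<phi> (what x))\<^sup>2 + (g (x, t))\<^sup>2) \<partial>lborel)"
            by (rule nn_integral_cong_AE) (use ae in eventually_elim, simp add: exc_eq[OF True])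
          then show ?thesis using True by simp
        qed (simp add: out_t)
      qed
    qed
    also have "\<dots> = (\<integral>\<^sup>+ t. (\<integral>\<^sup>+ x. ennreal ((Dfun \<phi> (v (x, t)) - Dfun \<phi> (what x))\<^sup>2 + (g (x, t))\<^sup>2) \<partial>lebesgue) \<partial>lebesgue_on {0<..<T})"
      by (simp add: nn_integral_restrict_space nn_integral_completion)
    finally show ?thesis using g_fin by simp
  qed
  have sq: "integrable (lborel \<Otimes>\<^sub>M lborel) (\<lambda>p. (excess v' p)\<^sup>2)" "integrable (lborel \<Otimes>\<^sub>M lborel) (\<lambda>p. (k p)\<^sup>2)"
  proof -
    have "(\<integral>\<^sup>+ p. ennreal (norm ((excess v' p)\<^sup>2)) \<partial>(lborel \<Otimes>\<^sub>M lborel)) < \<infinity>" "(\<integral>\<^sup>+ p. ennreal (norm ((k p)\<^sup>2)) \<partial>(lborel \<Otimes>\<^sub>M lborel)) < \<infinity>"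
      by (rule le_less_trans[OF nn_integral_mono sq_fin]; simp add: ennreal_leI)+
    then show "integrable (lborel \<Otimes>\<^sub>M lborel) (\<lambda>p. (excess v' p)\<^sup>2)" "integrable (lborel \<Otimes>\<^sub>M lborel) (\<lambda>p. (k p)\<^sup>2)"
      by (intro integrableI_bounded; simp add: lborel_prod)+
  qed
  have weak_k: "AE t in lborel. t \<in> {0<..<T} \<longrightarrow> locally_lborel_integrable (\<lambda>x. k (x, t)) \<and>
      (\<forall>n b c. (LINT x|lborel. excess v' (x, t) * tstx n b c x) = - (LINT x|lborel. k (x, t) * tst n b c x))"
    using g_W[unfolded AE_lebesgue_on_iff[OF borel_open[OF open_greaterThanLessThan]]] v_sec k_sec
  proof eventually_elim
    case (elim t)
    show ?case
    proof
      assume t: "t \<in> {0<..<T}"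
      have weak: "weak_deriv (\<lambda>x. Dfun \<phi> (v (x, t)) - Dfun \<phi> (what x)) (\<lambda>x. g (x, t))" using elim t by (auto simp: W12_def)
      have ae: "AE x in lborel. Dfun \<phi> (v (x, t)) - Dfun \<phi> (what x) = excess v' (x, t)" "AE x in lborel. g (x, t) = k (x, t)"
        using elim t by (auto simp: exc_eq[OF t] elim: eventually_mono)
      show "locally_lborel_integrable (\<lambda>x. k (x, t)) \<and>
        (\<forall>n b c. (LINT x|lborel. excess v' (x, t) * tstx n b c x) = - (LINT x|lborel. k (x, t) * tst n b c x))"
        using ramp.weak_deriv_representative[OF weak ae exc_sec] by blast
    qed
  qed
  obtain gx where gx_weak: "weak_dx T (\<lambda>p. Dfun \<phi> (v p)) gx"
    and gx_id: "\<And>\<Psi> \<Psi>x \<Psi>t. test_function T \<Psi> \<Psi>x \<Psi>t \<Longrightarrow> (LINT x|lebesgue. initial_datum U V x * \<Psi> (x, 0))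
             + (LINT p|lebesgue_on (QT T). v p * \<Psi>t p) = (LINT p|lebesgue_on (QT T). gx p * \<Psi>x p)"
    using sol unfolding weak_solution_def by blast
  have gx_meas: "gx \<in> borel_measurable (lebesgue_on (QT T))" using gx_weak by (simp add: weak_dx_def)
  obtain h where [measurable]: "h \<in> borel_measurable borel" and h_out: "\<And>p. p \<notin> QT T \<Longrightarrow> h p = 0"
    and h: "AE p in lborel. p \<in> QT T \<longrightarrow> gx p = h p"
    using borel_representative[OF gx_meas QT_borel] by metis
  define kx where "kx p = k p + indicator (QT T) p * what_x (fst p)" for p
  have [measurable]: "kx \<in> borel_measurable borel" unfolding kx_def[abs_def] by measurable
  have kx_out: "kx p = 0" if "p \<notin> QT T" for p using k_out[OF that] that by (simp add: kx_def)
  have h_eq: "AE p in lborel. h p = kx p"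
  proof -
    have "AE t in lborel. t \<in> {0<..<T} \<longrightarrow> weak_deriv (\<lambda>x. Dfun \<phi> (v (x, t))) (\<lambda>x. gx (x, t))"
      using gx_weak unfolding weak_dx_def AE_lebesgue_on_iff[OF borel_open[OF open_greaterThanLessThan]] by blast
    then have "AE t in lborel. AE x in lborel. h (x, t) = kx (x, t)"
      using weak_k v_sec AE_QT_sections[OF h]
    proof eventually_elim
      case (elim t)
      show ?case
      proof (cases "t \<in> {0<..<T}")
        case False
        then show ?thesis using h_out kx_out by (simp add: QT_def)
      next
        case True
        have h_sec: "(\<lambda>x. h (x, t)) \<in> borel_measurable borel" by measurable
        have weak: "weak_deriv (\<lambda>x. Dfun \<phi> (v (x, t))) (\<lambda>x. gx (x, t))" using elim True by blast
        have ae: "AE x in lborel. Dfun \<phi> (v (x, t)) = Dfun \<phi> (v' (x, t))" "AE x in lborel. gx (x, t) = h (x, t)"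
          using elim True by (auto elim: eventually_mono)
        note rep = ramp.weak_deriv_representative[OF weak ae D_sec h_sec]
        have k_loc: "locally_lborel_integrable (\<lambda>x. k (x, t))" using elim True by blast
        have wx_loc: "locally_lborel_integrable what_x" by (rule locally_lborel_integrable_continuous[OF what_x_cont])
        have Dw_loc: "locally_lborel_integrable (\<lambda>x. Dfun \<phi> (what x))"
          by (intro locally_lborel_integrable_continuous continuous_on_compose2[OF continuous_Dfun[of UNIV]] what_cont) auto
        have kx_eq: "kx (x, t) = k (x, t) + what_x x" for x using True by (simp add: kx_def QT_def)
        show ?thesis
        proof (rule ramp.AE_eq_if_same_tests[OF rep(2)])
          show "locally_lborel_integrable (\<lambda>x. kx (x, t))"
            unfolding kx_eq using k_loc wx_loc by (auto simp: locally_lborel_integrable_def)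
          fix n b c
          have "weak_deriv (\<lambda>x. Dfun \<phi> (what x)) what_x"
            by (rule weak_deriv_if_primitive[OF primitive_Dfun_what wx_loc borel_what_x])
          from ramp.weak_deriv_representative(3)[OF this _ _ _ borel_what_x]
          have 1: "(LINT x|lborel. Dfun \<phi> (what x) * tstx n b c x) = - (LINT x|lborel. what_x x * tst n b c x)" by simp
          have 2: "(LINT x|lborel. excess v' (x, t) * tstx n b c x) = - (LINT x|lborel. k (x, t) * tst n b c x)"
            using elim True by blast
          have "(LINT x|lborel. excess v' (x, t) * tstx n b c x)
              = (LINT x|lborel. Dfun \<phi> (v' (x, t)) * tstx n b c x) - (LINT x|lborel. Dfun \<phi> (what x) * tstx n b c x)"
            unfolding exc_eq[OF True] left_diff_distrib
            by (rule Bochner_Integration.integral_diff) (intro ramp.test_integrable rep(1) Dw_loc)+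
          moreover have "(LINT x|lborel. kx (x, t) * tst n b c x)
              = (LINT x|lborel. k (x, t) * tst n b c x) + (LINT x|lborel. what_x x * tst n b c x)"
            unfolding kx_eq distrib_right
            by (rule Bochner_Integration.integral_add) (intro ramp.test_integrable k_loc wx_loc)+
          ultimately show "(LINT x|lborel. h (x, t) * tst n b c x) = (LINT x|lborel. kx (x, t) * tst n b c x)"
            using 1 2 rep(3)[of n b c] by simp
        qed
      qed
    qed
    moreover have pred: "Measurable.pred borel (\<lambda>p. h p = kx p)" by measurable
    ultimately have "AE p in lborel \<Otimes>\<^sub>M lborel. h p = kx p" using AE_plane_commute[OF pred] AE_plane_fst[OF pred] by blast
    then show ?thesis unfolding lborel_prod .
  qed
  have gx_eq: "AE p in lborel. p \<in> QT T \<longrightarrow> gx p = kx p" using h h_eq by eventually_elim simp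
  show ?thesis
  proof (rule that[of v' k])
    show "represents v' k"
      unfolding represents_def kx_def[symmetric]
    proof (intro conjI allI impI)
      show "AE t in lborel. \<forall>n b c. (LINT x|lborel. excess v' (x, t) * tstx n b c x) = - (LINT x|lborel. k (x, t) * tst n b c x)"
        using weak_k
      proof eventually_elim
        case (elim t)
        then show ?case by (cases "t \<in> {0<..<T}") (auto simp: out_t)
      qed
      fix n b c \<alpha> B assume "continuous_on UNIV \<alpha> \<and> (\<forall>x. (B has_real_derivative \<alpha> x) (at x))"
      then have \<alpha>: "continuous_on UNIV \<alpha>" and B: "\<And>x. (B has_real_derivative \<alpha> x) (at x)" by auto
      have [measurable]: "\<alpha> \<in> borel_measurable borel" by (rule borel_measurable_continuous_onI[OF \<alpha>])
      have [measurable]: "B \<in> borel_measurable borel"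
        using B by (intro borel_measurable_continuous_onI) (meson DERIV_isCont continuous_at_imp_continuous_on)
      have "(LINT p|lebesgue_on (QT T). v p * - (tst n b c (fst p) * \<alpha> (snd p)))
          = (LINT p|(lborel \<Otimes>\<^sub>M lborel). v' p * - (tst n b c (fst p) * \<alpha> (snd p)))"
        by (rule QT_integral_representative[OF v_eq _ _ v'_out]) measurable
      moreover have "(LINT p|lebesgue_on (QT T). gx p * (tstx n b c (fst p) * (B T - B (snd p))))
          = (LINT p|(lborel \<Otimes>\<^sub>M lborel). kx p * (tstx n b c (fst p) * (B T - B (snd p))))"
        by (rule QT_integral_representative[OF gx_eq _ _ kx_out]) measurable
      ultimately show "(LINT x|lebesgue. initial_datum U V x * (tst n b c x * (B T - B 0)))
          - (LINT p|(lborel \<Otimes>\<^sub>M lborel). v' p * (tst n b c (fst p) * \<alpha> (snd p)))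
        = (LINT p|(lborel \<Otimes>\<^sub>M lborel). kx p * (tstx n b c (fst p) * (B T - B (snd p))))"
        using gx_id[OF ramp.product_test_function[OF B \<alpha>], of n b c] by simp
    qed (use v'_le v'_out k_out sq in auto)
  qed (rule v_eq)
qed

text \<open>Both identities contain the same initial term and the same contribution of
  \<open>what\<close>, so subtraction leaves the homogeneous problem of
  \<open>difference_energy\<close>. Monotonicity of \<open>Dfun \<phi>\<close> supplies the sign of
  z e.\<close>

lemma representatives_unique:
  assumes r1: "represents v1 k1" and r2: "represents v2 k2"
  shows "AE p in lborel \<Otimes>\<^sub>M lborel. v1 p = v2 p"
proof -
  have [measurable]: "v1 \<in> borel_measurable borel" "k1 \<in> borel_measurable borel"
    "v2 \<in> borel_measurable borel" "k2 \<in> borel_measurable borel"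
    using r1 r2 by (auto simp: represents_def)
  obtain C1 C2 where C: "\<And>p. \<bar>v1 p\<bar> \<le> C1" "\<And>p. \<bar>v2 p\<bar> \<le> C2" using r1 r2 by (auto simp: represents_def)
  have out: "p \<notin> QT T \<Longrightarrow> v1 p = 0 \<and> v2 p = 0 \<and> k1 p = 0 \<and> k2 p = 0" for p
    using r1 r2 unfolding represents_def by blast
  have [measurable]: "excess v1 \<in> borel_measurable borel" "excess v2 \<in> borel_measurable borel"
    unfolding excess_def[abs_def] by measurable
  define z e d where "z p = v1 p - v2 p" and "e p = excess v1 p - excess v2 p" and "d p = k1 p - k2 p" for p
  have e_eq: "e p = indicator (QT T) p * (Dfun \<phi> (v1 p) - Dfun \<phi> (v2 p))" for p
    by (simp add: e_def excess_def algebra_simps)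
  have sq: "integrable (lborel \<Otimes>\<^sub>M lborel) (\<lambda>p. (excess v1 p)\<^sup>2)" "integrable (lborel \<Otimes>\<^sub>M lborel) (\<lambda>p. (excess v2 p)\<^sup>2)"
    "integrable (lborel \<Otimes>\<^sub>M lborel) (\<lambda>p. (k1 p)\<^sup>2)" "integrable (lborel \<Otimes>\<^sub>M lborel) (\<lambda>p. (k2 p)\<^sup>2)"
    using r1 r2 by (auto simp: represents_def)
  interpret difference_energy unit_step unit_ramp z e d T "C1 + C2"
  proof
    show "T > 0" by (rule T)
    show "z \<in> borel_measurable borel" "e \<in> borel_measurable borel" "d \<in> borel_measurable borel"
      unfolding z_def[abs_def] e_def[abs_def] d_def[abs_def] by measurable
    show "\<bar>z p\<bar> \<le> C1 + C2" for p using C(1)[of p] C(2)[of p] by (simp add: z_def)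
    show "z (x, t) = 0 \<and> e (x, t) = 0 \<and> d (x, t) = 0" if "t \<notin> {0<..<T}" for x t
      using out[of "(x, t)"] that by (auto simp: z_def e_def d_def excess_def QT_def)
    show "integrable (lborel \<Otimes>\<^sub>M lborel) (\<lambda>p. (e p)\<^sup>2)" "integrable (lborel \<Otimes>\<^sub>M lborel) (\<lambda>p. (d p)\<^sup>2)"
      unfolding e_def d_def by (intro integrable_square_add sq; simp add: lborel_prod)+
    show "0 \<le> z p * e p" for p
    proof -
      have "0 \<le> (v1 p - v2 p) * (Dfun \<phi> (v1 p) - Dfun \<phi> (v2 p))"
        using Dfun_mono[of "v1 p" "v2 p"] Dfun_mono[of "v2 p" "v1 p"]
        by (cases "v1 p \<le> v2 p") (auto intro: mult_nonneg_nonneg mult_nonpos_nonpos)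
      then show ?thesis by (auto simp: z_def e_eq indicator_def)
    qed
    show "e p = 0" if "z p * e p = 0" for p using that by (auto simp: z_def e_eq)
    have sections: "AE t in lborel. \<forall>h\<in>{excess v1, excess v2, k1, k2}. integrable lborel (\<lambda>x. (h (x, t))\<^sup>2)"
    proof -
      have "AE t in lborel. integrable lborel (\<lambda>x. (h (x, t))\<^sup>2)" if "integrable (lborel \<Otimes>\<^sub>M lborel) (\<lambda>p. (h p)\<^sup>2)" for h :: "real \<times> real \<Rightarrow> real"
        using lborel_pair.AE_integrable_snd[of "\<lambda>x t. (h (x, t))\<^sup>2"] that by (simp add: case_prod_beta')
      from this[OF sq(1)] this[OF sq(2)] this[OF sq(3)] this[OF sq(4)] show ?thesis by eventually_elim simp
    qed
    have "AE t in lborel. \<forall>n b c. (LINT x|lborel. excess v1 (x, t) * tstx n b c x) = - (LINT x|lborel. k1 (x, t) * tst n b c x)"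
      "AE t in lborel. \<forall>n b c. (LINT x|lborel. excess v2 (x, t) * tstx n b c x) = - (LINT x|lborel. k2 (x, t) * tst n b c x)"
      using r1 r2 unfolding represents_def by blast+
    then show "AE t in lborel. \<forall>n b c. (LINT x|lborel. e (x, t) * tstx n b c x) = - (LINT x|lborel. d (x, t) * tst n b c x)"
      using sections
    proof eventually_elim
      case (elim t)
      have loc: "locally_lborel_integrable (\<lambda>x. h (x, t))" if "h \<in> {excess v1, excess v2, k1, k2}" for h
      proof (rule locally_lborel_integrable_if_square)
        have [measurable]: "h \<in> borel_measurable borel" using that by auto
        show "(\<lambda>x. h (x, t)) \<in> borel_measurable borel" by measurable
        show "integrable lborel (\<lambda>x. (h (x, t))\<^sup>2)" using elim(3) that by blast
      qed
      show ?case
      proof (intro allI)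
        fix n b c
        have "(LINT x|lborel. e (x, t) * tstx n b c x) = (LINT x|lborel. excess v1 (x, t) * tstx n b c x) - (LINT x|lborel. excess v2 (x, t) * tstx n b c x)"
          unfolding e_def left_diff_distrib by (rule Bochner_Integration.integral_diff) (intro ramp.test_integrable loc; simp)+
        moreover have "(LINT x|lborel. d (x, t) * tst n b c x) = (LINT x|lborel. k1 (x, t) * tst n b c x) - (LINT x|lborel. k2 (x, t) * tst n b c x)"
          unfolding d_def left_diff_distrib by (rule Bochner_Integration.integral_diff) (intro ramp.test_integrable loc; simp)+
        ultimately show "(LINT x|lborel. e (x, t) * tstx n b c x) = - (LINT x|lborel. d (x, t) * tst n b c x)"
          using elim(1,2) by simp
      qed
    qed
    fix n b c and \<alpha> :: "real \<Rightarrow> real" assume \<alpha>: "continuous_on UNIV \<alpha>"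
    obtain B where B: "\<And>x. (B has_real_derivative \<alpha> x) (at x)" using antiderivative_exists[OF \<alpha>] by blast
    have B_cont: "continuous_on UNIV B" using B by (meson DERIV_isCont continuous_at_imp_continuous_on)
    have [measurable]: "\<alpha> \<in> borel_measurable borel" "B \<in> borel_measurable borel"
      using \<alpha> B_cont by (auto intro: borel_measurable_continuous_onI)
    obtain K J where K: "K \<ge> 0" "\<And>x. \<bar>tstx n b c x\<bar> \<le> K * indicat_real {- J..J} x" "\<And>x. \<bar>tst n b c x\<bar> \<le> K * indicat_real {- J..J} x"
      using ramp.test_bounds by metis
    have bounded: "\<exists>L\<ge>0. \<forall>t\<in>{0..T}. \<bar>h t\<bar> \<le> L" if "continuous_on UNIV h" for h :: "real \<Rightarrow> real"
    proof -
      have "compact (h ` {0..T})" by (intro compact_continuous_image continuous_on_subset[OF that]) auto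
      then obtain L where "\<forall>t\<in>{0..T}. \<bar>h t\<bar> \<le> L"
        by (auto dest!: compact_imp_bounded simp: bounded_iff simp del: atLeastAtMost_iff)
      then show ?thesis by (intro exI[of _ "max L 0"]) (auto simp: le_max_iff_disj)
    qed
    obtain L1 where L1: "L1 \<ge> 0" "\<And>t. t \<in> {0..T} \<Longrightarrow> \<bar>\<alpha> t\<bar> \<le> L1" using bounded[OF \<alpha>] by blast
    obtain L2 where L2: "L2 \<ge> 0" "\<And>t. t \<in> {0..T} \<Longrightarrow> \<bar>B T - B t\<bar> \<le> L2"
      using bounded[of "\<lambda>t. B T - B t"] B_cont continuous_on_diff[OF continuous_on_const[of UNIV "B T"] B_cont] by blast
    have tb: "\<bar>tst n b c (fst p) * \<alpha> (snd p)\<bar> \<le> (K * L1) * indicat_real {- J..J} (fst p)"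
      and txb: "\<bar>tstx n b c (fst p) * (B T - B (snd p))\<bar> \<le> (K * L2) * indicat_real {- J..J} (fst p)" if "p \<in> QT T" for p
    proof -
      have t: "snd p \<in> {0..T}" using that by (auto simp: QT_def)
      have "\<bar>tst n b c (fst p)\<bar> * \<bar>\<alpha> (snd p)\<bar> \<le> (K * indicat_real {- J..J} (fst p)) * L1"
        using K L1 t by (intro mult_mono) auto
      then show "\<bar>tst n b c (fst p) * \<alpha> (snd p)\<bar> \<le> (K * L1) * indicat_real {- J..J} (fst p)" by (simp add: abs_mult mult_ac)
      have "\<bar>tstx n b c (fst p)\<bar> * \<bar>B T - B (snd p)\<bar> \<le> (K * indicat_real {- J..J} (fst p)) * L2"
        using K L2 t by (intro mult_mono) auto
      then show "\<bar>tstx n b c (fst p) * (B T - B (snd p))\<bar> \<le> (K * L2) * indicat_real {- J..J} (fst p)" by (simp add: abs_mult mult_ac)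
    qed
    have v_int: "integrable (lborel \<Otimes>\<^sub>M lborel) (\<lambda>p. vi p * (tst n b c (fst p) * \<alpha> (snd p)))"
      if vi: "vi \<in> borel_measurable borel" "\<And>p. p \<notin> QT T \<Longrightarrow> vi p = 0" "\<And>p. \<bar>vi p\<bar> \<le> Ci" for vi Ci
    proof (rule integrable_times_compact_test[where T = T, OF vi(1) _ locally_square_bounded[OF vi] vi(2) tb])
      show "(\<lambda>p. tst n b c (fst p) * \<alpha> (snd p)) \<in> borel_measurable borel" by measurable
    qed
    define W where "W p = indicator (QT T) p * what_x (fst p)" for p
    have W_meas [measurable]: "W \<in> borel_measurable borel" unfolding W_def[abs_def] by measurable
    obtain Bw where Bw: "\<And>x. \<bar>what_x x\<bar> \<le> Bw" "Bw \<ge> 0" using what_x_bounded by metis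
    have k_int: "integrable (lborel \<Otimes>\<^sub>M lborel) (\<lambda>p. (ki p + W p) * (tstx n b c (fst p) * (B T - B (snd p))))"
      if [measurable]: "ki \<in> borel_measurable borel" and "integrable (lborel \<Otimes>\<^sub>M lborel) (\<lambda>p. (ki p)\<^sup>2)" "\<And>p. p \<notin> QT T \<Longrightarrow> ki p = 0" for ki
    proof -
      have 1: "integrable (lborel \<Otimes>\<^sub>M lborel) (\<lambda>p. ki p * (tstx n b c (fst p) * (B T - B (snd p))))"
      proof (rule integrable_times_compact_test[where T = T, OF that(1) _ locally_square_square[OF that(1,2)] that(3) txb])
        show "(\<lambda>p. tstx n b c (fst p) * (B T - B (snd p))) \<in> borel_measurable borel" by measurable
      qed
      have 2: "integrable (lborel \<Otimes>\<^sub>M lborel) (\<lambda>p. W p * (tstx n b c (fst p) * (B T - B (snd p))))"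
      proof (rule integrable_times_compact_test[where T = T, OF W_meas _ locally_square_bounded[OF W_meas, of Bw] _ txb])
        show "(\<lambda>p. tstx n b c (fst p) * (B T - B (snd p))) \<in> borel_measurable borel" by measurable
        show "\<bar>W p\<bar> \<le> Bw" for p using Bw by (auto simp: W_def indicator_def)
      qed (auto simp: W_def)
      show ?thesis unfolding distrib_right by (rule Bochner_Integration.integrable_add[OF 1 2])
    qed
    have id: "(LINT x|lebesgue. initial_datum U V x * (tst n b c x * (B T - B 0)))
          - (LINT p|(lborel \<Otimes>\<^sub>M lborel). v p * (tst n b c (fst p) * \<alpha> (snd p)))
        = (LINT p|(lborel \<Otimes>\<^sub>M lborel). (k p + W p) * (tstx n b c (fst p) * (B T - B (snd p))))"
      if "represents v k" for v k
      using that \<alpha> B unfolding represents_def W_def by blast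
    have "(LINT p|(lborel \<Otimes>\<^sub>M lborel). z p * (tst n b c (fst p) * \<alpha> (snd p)))
        = (LINT p|(lborel \<Otimes>\<^sub>M lborel). v1 p * (tst n b c (fst p) * \<alpha> (snd p))) - (LINT p|(lborel \<Otimes>\<^sub>M lborel). v2 p * (tst n b c (fst p) * \<alpha> (snd p)))"
      unfolding z_def left_diff_distrib by (rule Bochner_Integration.integral_diff; rule v_int; use C out in auto)
    also have "\<dots> = (LINT p|(lborel \<Otimes>\<^sub>M lborel). (k2 p + W p) * (tstx n b c (fst p) * (B T - B (snd p))))
        - (LINT p|(lborel \<Otimes>\<^sub>M lborel). (k1 p + W p) * (tstx n b c (fst p) * (B T - B (snd p))))"
      using id[OF r1] id[OF r2] by simp
    also have "\<dots> = (LINT p|(lborel \<Otimes>\<^sub>M lborel). (k2 p + W p) * (tstx n b c (fst p) * (B T - B (snd p)))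
        - (k1 p + W p) * (tstx n b c (fst p) * (B T - B (snd p))))"
      by (rule Bochner_Integration.integral_diff[symmetric]; rule k_int; use sq out in auto)
    also have "\<dots> = (LINT p|(lborel \<Otimes>\<^sub>M lborel). - (d p * (tstx n b c (fst p) *
        (LINT s|lborel. (if snd p \<le> s \<and> s \<le> T then \<alpha> s else 0)))))"
    proof (rule Bochner_Integration.integral_cong)
      fix p
      show "(k2 p + W p) * (tstx n b c (fst p) * (B T - B (snd p))) - (k1 p + W p) * (tstx n b c (fst p) * (B T - B (snd p)))
          = - (d p * (tstx n b c (fst p) * (LINT s|lborel. (if snd p \<le> s \<and> s \<le> T then \<alpha> s else 0))))"
      \<comment> \<open>On the strip the integral of \<alpha> from t to T is
        \<open>B T - B (snd p)\<close>; elsewhere both \<open>k1\<close> and \<open>k2\<close>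
        vanish and the factor is immaterial.\<close>
      proof (cases "p \<in> QT T")
        case True
        then have *: "(LINT s|lborel. (if snd p \<le> s \<and> s \<le> T then \<alpha> s else 0)) = B T - B (snd p)"
          by (intro integral_if_antiderivative B \<alpha>) (auto simp: QT_def)
        show ?thesis unfolding * by (simp add: d_def algebra_simps)
      qed (simp add: d_def out)
    qed simp
    finally show "(LINT p|(lborel \<Otimes>\<^sub>M lborel). z p * (tst n b c (fst p) * \<alpha> (snd p)))
      = - (LINT p|(lborel \<Otimes>\<^sub>M lborel). d p * (tstx n b c (fst p) * (LINT s|lborel. (if snd p \<le> s \<and> s \<le> T then \<alpha> s else 0))))"
      by simp
  qed
  show ?thesis using z_AE_zero by eventually_elim (simp add: z_def)
qed

theorem weak_solution_unique:
  assumes "weak_solution \<phi> U V what T v" "weak_solution \<phi> U V what T w"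
  shows "AE p in lebesgue_on (QT T). v p = w p"
proof -
  obtain v' k where v: "represents v' k" "AE p in lborel. p \<in> QT T \<longrightarrow> v p = v' p"
    using weak_solution_represented[OF assms(1)] by blast
  obtain w' l where w: "represents w' l" "AE p in lborel. p \<in> QT T \<longrightarrow> w p = w' p"
    using weak_solution_represented[OF assms(2)] by blast
  have "AE p in lborel. v' p = w' p" using representatives_unique[OF v(1) w(1)] unfolding lborel_prod .
  with v(2) w(2) have "AE p in lborel. p \<in> QT T \<longrightarrow> v p = w p" by eventually_elim simp
  then show ?thesis by (simp add: AE_lebesgue_on_iff)
qed

end

section \<open>The main result\<close>

lemma Ck_on_2_iff:
  "Ck_on 2 f X \<longleftrightarrow> (\<forall>x\<in>X. f field_differentiable at x \<and> deriv f field_differentiable at x) \<and>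
    continuous_on X (deriv (deriv f))"
  by (auto simp: Ck_on_def numeral_2_eq_2 less_Suc_eq)

text \<open>Left of \<open>a\<close> the equation is nondegenerate, so f' = - q / \<phi>'(f) can be
  differentiated once more; continuity of the quotient \<open>f''\<close> is where the second
  derivative of \<phi> enters.\<close>

lemma (in similarity_profile) profile_f:
  assumes phi_C2: "Ck_on 2 \<phi> UNIV"
  shows "profile \<phi> U V f a"
proof -
  have phi2: "(deriv \<phi> has_real_derivative deriv (deriv \<phi>) s) (at s)" for s
    using phi_C2 by (simp add: Ck_on_2_iff DERIV_deriv_iff_field_differentiable)
  have phi2_cont: "continuous_on UNIV (deriv (deriv \<phi>))"
    using phi_C2 by (simp add: Ck_on_2_iff)
  have nz: "deriv \<phi> (f x) \<noteq> 0" if "x < a" for x using phi'_pos[OF f_pos[OF that]] by simp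
  have f': "deriv f x = - q x / deriv \<phi> (f x)" if "x < a" for x
    by (rule DERIV_imp_deriv[OF f_DERIV[OF that]])
  define f'' where "f'' x = - ((- x / 2 * (q x / deriv \<phi> (f x))) * deriv \<phi> (f x)
      - q x * (deriv (deriv \<phi>) (f x) * (- q x / deriv \<phi> (f x)))) / (deriv \<phi> (f x) * deriv \<phi> (f x))" for x
  have f'_DERIV: "(deriv f has_real_derivative f'' x) (at x)" if x: "x < a" for x
  proof -
    have "((\<lambda>x. - (q x / deriv \<phi> (f x))) has_real_derivative f'' x) (at x)"
      using DERIV_minus[OF DERIV_divide[OF q_DERIV[OF x] DERIV_chain2[OF phi2 f_DERIV[OF x]] nz[OF x]]]
      by (simp only: f''_def minus_divide_left)
    then show ?thesis
      by (rule has_field_derivative_transform_within_open[of _ _ _ "{..<a}"]) (use x f' in auto)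
  qed
  have f_cont: "continuous_on {..<a} f" and q_cont: "continuous_on {..<a} q"
    using DERIV_isCont[OF f_DERIV] DERIV_isCont[OF q_DERIV] by (auto intro!: continuous_at_imp_continuous_on)
  have f''_cont: "continuous_on {..<a} f''"
    unfolding f''_def
    by (intro continuous_intros q_cont continuous_on_compose2[OF phi'_cont f_cont] continuous_on_compose2[OF phi2_cont f_cont])
       (use nz in auto)
  have "continuous_on {..<a} (deriv (deriv f))"
    by (rule continuous_on_eq[OF f''_cont]) (simp add: DERIV_imp_deriv[OF f'_DERIV])
  then have "Ck_on 2 f {..<a}"
    unfolding Ck_on_2_iff using f_DERIV f'_DERIV by (auto simp: field_differentiable_def)
  moreover have flux: "deriv \<phi> (f y) * deriv f y = - q y" if "y < a" for y
    using nz[OF that] f'[OF that] by simp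
  have "((\<lambda>y. deriv \<phi> (f y) * deriv f y) has_real_derivative - (1 / 2) * x * deriv f x) (at x)" if x: "x < a" for x
  proof -
    have "((\<lambda>y. - q y) has_real_derivative - (- x / 2 * (q x / deriv \<phi> (f x)))) (at x)"
      by (rule DERIV_minus[OF q_DERIV[OF x]])
    also have "- (- x / 2 * (q x / deriv \<phi> (f x))) = - (1 / 2) * x * deriv f x"
      by (simp add: f'[OF x])
    finally show ?thesis
      by (rule has_field_derivative_transform_within_open[of _ _ _ "{..<a}"]) (use x flux in auto)
  qed
  moreover have "((\<lambda>y. deriv \<phi> (f y) * deriv f y) \<longlongrightarrow> - (a * V / 2)) (at_left a)"
    using eventually_at_left_a
    by (intro Lim_transform_eventually[OF tendsto_minus[OF q_left]]) (auto elim!: eventually_mono simp: flux)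
  ultimately show ?thesis
    unfolding profile_def using f_pos f_right f_bot f_left by auto
qed

lemma (in similarity_solution) free_boundary_w:
  "free_boundary T (initial_datum U V) w (\<lambda>t. a * sqrt t)"
  unfolding free_boundary_def
proof
  show "\<forall>x. (x < a * sqrt 0 \<longrightarrow> 0 < initial_datum U V x) \<and> (a * sqrt 0 < x \<longrightarrow> initial_datum U V x < 0)"
    using U V by (auto simp: initial_datum_def)
  show "AE p in lebesgue_on (QT T). (fst p < a * sqrt (snd p) \<longrightarrow> 0 < w p) \<and> (a * sqrt (snd p) < fst p \<longrightarrow> w p < 0)"
  proof (rule AE_I2)
    fix p assume "p \<in> space (lebesgue_on (QT T))"
    then have "snd p > 0" by (auto simp: QT_def)
    then show "(fst p < a * sqrt (snd p) \<longrightarrow> 0 < w p) \<and> (a * sqrt (snd p) < fst p \<longrightarrow> w p < 0)"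
      using f_pos[of "fst p / sqrt (snd p)"] f_right[of "fst p / sqrt (snd p)"] V
      by (auto simp: w_def pos_divide_less_eq pos_le_divide_eq)
  qed
qed

theorem theorem5p6:
  fixes \<phi> what :: "real \<Rightarrow> real" and U0 V0 T :: real
  assumes phi_C2: "Ck_on 2 \<phi> UNIV"
    and phi_mono: "strict_mono_on {0..} \<phi>"
    and phi'_mono: "strict_mono_on {0..} (deriv \<phi>)"
    and phi_pos: "\<And>s. s > 0 \<Longrightarrow> \<phi> s > 0"
    and phi_0: "\<phi> 0 = 0" and phi'_0: "deriv \<phi> 0 = 0"
    and phi_int_0: "(\<integral>\<^sup>+ s\<in>{0<..1}. ennreal (deriv \<phi> s / s) \<partial>lborel) < \<infinity>"
    and phi_int_infty: "(\<integral>\<^sup>+ s\<in>{1..}. ennreal (deriv \<phi> s / s) \<partial>lborel) = \<infinity>"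
    and pos: "T > 0" "U0 > 0" "V0 > 0"
    and what_smooth: "smooth what"
    and what_left: "\<And>x. x < -1 \<Longrightarrow> what x = U0"
    and what_right: "\<And>x. x > 1 \<Longrightarrow> what x = - V0"
  shows "\<exists>w. weak_solution \<phi> U0 V0 what T w \<and>
           (\<forall>v. weak_solution \<phi> U0 V0 what T v \<longrightarrow> (AE p in lebesgue_on (QT T). v p = w p)) \<and>
           (\<exists>f a. a > 0 \<and>
              (AE p in lebesgue_on (QT T). w p = f (fst p / sqrt (snd p))) \<and>
              free_boundary T (initial_datum U0 V0) w (\<lambda>t. a * sqrt t) \<and>
              profile \<phi> U0 V0 f a)"
proof -
  have phi1: "(\<phi> has_real_derivative deriv \<phi> s) (at s)" for s
    using phi_C2 by (simp add: Ck_on_2_iff DERIV_deriv_iff_field_differentiable)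
  have phi2: "deriv \<phi> field_differentiable at s" for s
    using phi_C2 by (simp add: Ck_on_2_iff)
  interpret degenerate_diffusion \<phi>
  proof
    show "continuous_on UNIV (deriv \<phi>)"
      using phi2 by (auto intro!: continuous_at_imp_continuous_on field_differentiable_imp_continuous_at)
    show "deriv \<phi> s \<le> deriv \<phi> t" if "0 \<le> s" "s \<le> t" for s t
      using strict_mono_onD[OF phi'_mono, of s t] that by (cases "s = t") auto
    show "0 < deriv \<phi> s" if "0 < s" for s
      using strict_mono_onD[OF phi'_mono, of 0 s] that by (simp add: phi'_0)
  qed (rule phi1 phi_0 phi'_0)+
  interpret ff: far_field \<phi> what U0 V0 T
    by unfold_locales (use pos what_smooth what_left what_right in auto)
  interpret hodograph "deriv \<phi>" U0 V0
    by unfold_locales (use pos phi'_cont phi'_nonneg phi'_pos in auto)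
  obtain f q a k M where f: "similarity_profile \<phi> f q U0 V0 a k M"
  proof (rule similarity_profile_exists)
    fix f q :: "real \<Rightarrow> real" and a k M
    assume "a > 0" "k > 0" "\<And>x. x < a \<Longrightarrow> 0 < f x" "\<And>x. x < a \<Longrightarrow> f x < U0"
      "\<And>x. x < a \<Longrightarrow> (f has_real_derivative - q x / deriv \<phi> (f x)) (at x)"
      "\<And>x. x < a \<Longrightarrow> (q has_real_derivative - x / 2 * (q x / deriv \<phi> (f x))) (at x)"
      "\<And>x. x < a \<Longrightarrow> 0 < q x" "\<And>x. x < a \<Longrightarrow> k * (U0 - f x) \<le> q x" "\<And>x. x < a \<Longrightarrow> q x \<le> M"
      "(f \<longlongrightarrow> U0) at_bot" "(f \<longlongrightarrow> 0) (at_left a)" "(q \<longlongrightarrow> a * V0 / 2) (at_left a)"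
      "\<And>x. x \<ge> a \<Longrightarrow> f x = - V0"
    then have "similarity_profile \<phi> f q U0 V0 a k M"
      using pos by unfold_locales
    then show thesis by (rule that)
  qed
  interpret similarity_profile \<phi> f q U0 V0 a k M by (rule f)
  interpret similarity_solution \<phi> f q U0 V0 a k M what T by unfold_locales
  show ?thesis
  proof (intro exI[of _ w] exI[of _ f] exI[of _ a] conjI allI impI)
    show "AE p in lebesgue_on (QT T). v p = w p" if "weak_solution \<phi> U0 V0 what T v" for v
      by (rule ff.weak_solution_unique[OF that weak_solution_w])
    show "AE p in lebesgue_on (QT T). w p = f (fst p / sqrt (snd p))" by (rule AE_I2) (simp add: w_def)
  qed (rule weak_solution_w a free_boundary_w profile_f[OF phi_C2])+
qed

end
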